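(* Let $i\in\{1,\dots,M\}$, let $u_\varepsilon$ be the weak solution of the reaction-diffusion problem, and let $u_i^p=\psi_{\varepsilon,i}|_{\omega_i}$ be the local particular function on $\omega_i$. For any $\varepsilon\in(0,1]$, $$\big\Vert \chi_{i}(u_{\varepsilon}-u_{i}^{p})\big\Vert_{a,\varepsilon,\omega_{i}} \leq \varepsilon\,a_{\max}^{1/2}\, \Vert \nabla\chi_{i}\Vert_{L^{\infty}(\omega_{i})} \big(\Vert u_{\varepsilon}\Vert_{L^{2}(\omega_{i})} + \Vert f\Vert_{L^{2}(\omega^{\ast}_{i})}\big).$$ If, in addition, $\delta^{\ast}_{i} := \mathrm{dist}(\omega_i,\partial\omega_{i}^{\ast}\setminus\partial \Omega)>0$ and $\gamma^{\ast}_{i} := \delta^{\ast}_{i}/(e\,\varepsilon\, a_{\max}^{1/2}C_{d})>1$, then $$\big\Vert \chi_{i}(u_{\varepsilon}-u_{i}^{p})\big\Vert_{a,\varepsilon,\omega_{i}}\leq \varepsilon\,a_{\max}^{1/2} \,e^{1-\gamma^{\ast}_{i}} \,\Vert \nabla\chi_{i}\Vert_{L^{\infty}(\omega_{i})} \big(\Vert u_{\varepsilon}\Vert_{L^{2}(\omega_{i}^{\ast})} + \Vert f\Vert_{L^{2}(\omega_{i}^{\ast})}\big).$$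
   Context: Setting: $\Omega\subset\mathbb{R}^d$ ($d=2,3$) is a bounded Lipschitz polyhedral domain, $\Gamma=\partial\Omega$, $0<\varepsilon\le 1$, $f\in L^2(\Omega)$, and $A\in (L^\infty(\Omega))^{d\times d}$ is pointwise symmetric with $a_{\min}|\xi|^2\le A(x)\xi\cdot\xi\le a_{\max}|\xi|^2$ for all $\xi\in\mathbb{R}^d$, $x\in\Omega$, where $0<a_{\min}<a_{\max}<\infty$. For a subdomain $D\subset\Omega$ and $u,v\in H^1(D)$ put $a_{\varepsilon,D}(u,v)=\varepsilon^2\int_D A\nabla u\cdot\nabla v\,dx+\int_D uv\,dx$ and $\|u\|_{a,\varepsilon,D}=\sqrt{a_{\varepsilon,D}(u,u)}$. The exact solution $u_\varepsilon\in H^1_0(\Omega)$ is the unique function with $a_{\varepsilon,\Omega}(u_\varepsilon,v)=\int_\Omega fv\,dx$ for all $v\in H_0^1(\Omega)$. Cover and partition of unity: $\{\omega_i\}_{i=1}^M$ are connected open subsets of $\Omega$ with $\bigcup_i\omega_i=\Omega$, each point of $\Omega$ lying in at most $\kappa$ of them; $\{\chi_i\}_{i=1}^M$ are functions with $0\le\chi_i\le1$, $\sum_i\chi_i=1$ on $\Omega$, $\chi_i=0$ on $\Omega\setminus\omega_i$, $\chi_i\in W^{1,\infty}(\Omega)$, and $\|\nabla\chi_i\|_{L^\infty(\omega_i)}\le C/\mathrm{diam}(\omega_i)$ for a fixed constant $C$. For each $i$, $\omega_i^\ast$ is a domain with Lipschitz boundary and $\omega_i\subset\omega_i^\ast\subset\Omega$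 (oversampling domain; $\omega_i^\ast=\omega_i$ is allowed in the first estimate). Local particular function: with $H^1_\Gamma(\omega_i^\ast)=\{v\in H^1(\omega_i^\ast): v=0\text{ on }\partial\omega_i^\ast\cap\Gamma\}$, $\psi_{\varepsilon,i}\in H^1_\Gamma(\omega_i^\ast)$ is the unique solution of $a_{\varepsilon,\omega_i^\ast}(\psi_{\varepsilon,i},v)=\int_{\omega_i^\ast}fv\,dx$ for all $v\in H^1_\Gamma(\omega_i^\ast)$. Constant $C_d$: $C_d>0$ is a constant depending only on $d$ such that for all open connected $D\subset D^\ast\subset\Omega$ with $\delta=\mathrm{dist}(D,\partial D^\ast\setminus\partial\Omega)>0$ there is $\eta\in C^1(\overline{D^\ast})$ with $\eta=0$ on $\partial D^\ast\setminus\partial\Omega$, $\eta=1$ in $D$ and $|\nabla\eta|\le C_d/\delta$. Here $e$ is Euler's number. *)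

theory Defs
  imports "HOL-Analysis.Analysis" "HOL-Probability.Essential_Supremum"
begin

text \<open>
  Functions on a domain \<open>D\<close> are represented by total functions on \<open>real ^ 'd\<close> whose values
  outside \<open>D\<close> (for continuous functions up to the boundary: outside \<open>closure D\<close>) are irrelevant.
  Restriction to a subdomain is therefore implicit.
\<close>

section \<open>Domains\<close>

text \<open>
  Near every boundary point the domain is the strict epigraph, in direction \<open>\<nu>\<close>, of a Lipschitz
  function \<open>g\<close> of the component orthogonal to \<open>\<nu>\<close>.
\<close>

definition lipschitz_domain :: "(real ^ 'd) set \<Rightarrow> bool" where
  "lipschitz_domain D \<longleftrightarrow> open D \<and> connected D \<and> bounded D \<and> D \<noteq> {} \<and>
     (\<forall>x\<in>frontier D. \<exists>\<nu> r L g. norm \<nu> = 1 \<and> 0 < r \<and> L-lipschitz_on UNIV (g :: real ^ 'd \<Rightarrow> real) \<and>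
        (\<forall>y\<in>ball x r. y \<in> D \<longleftrightarrow> g (y - (y \<bullet> \<nu>) *\<^sub>R \<nu>) < y \<bullet> \<nu>))"

definition lipschitz_polyhedral_domain :: "(real ^ 'd) set \<Rightarrow> bool" where
  "lipschitz_polyhedral_domain D \<longleftrightarrow> lipschitz_domain D \<and>
     (\<exists>P. finite P \<and> (\<forall>p\<in>P. polytope p) \<and> closure D = \<Union>P)"

section \<open>Lebesgue spaces\<close>

definition L2 :: "(real ^ 'd) set \<Rightarrow> (real ^ 'd \<Rightarrow> 'b::euclidean_space) set" where
  "L2 D = {u. u \<in> borel_measurable (lebesgue_on D) \<and> integrable (lebesgue_on D) (\<lambda>x. (norm (u x))\<^sup>2)}"

definition L2_norm :: "(real ^ 'd) set \<Rightarrow> (real ^ 'd \<Rightarrow> 'b::euclidean_space) \<Rightarrow> real" where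
  "L2_norm D u = sqrt (LINT x|lebesgue_on D. (norm (u x))\<^sup>2)"

definition Linf :: "(real ^ 'd) set \<Rightarrow> (real ^ 'd \<Rightarrow> 'b::euclidean_space) set" where
  "Linf D = {u. u \<in> borel_measurable (lebesgue_on D) \<and>
                esssup (lebesgue_on D) (\<lambda>x. ennreal (norm (u x))) < \<infinity>}"

definition Linf_norm :: "(real ^ 'd) set \<Rightarrow> (real ^ 'd \<Rightarrow> 'b::euclidean_space) \<Rightarrow> real" where
  "Linf_norm D u = enn2real (esssup (lebesgue_on D) (\<lambda>x. ennreal (norm (u x))))"

section \<open>Weak gradients and Sobolev spaces\<close>

definition pderiv_at :: "'d \<Rightarrow> (real ^ 'd \<Rightarrow> real) \<Rightarrow> real ^ 'd \<Rightarrow> real" where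
  "pderiv_at j f x = frechet_derivative f (at x) (axis j 1)"

primrec Ck :: "nat \<Rightarrow> (real ^ 'd \<Rightarrow> real) \<Rightarrow> bool" where
  "Ck 0 f \<longleftrightarrow> continuous_on UNIV f"
| "Ck (Suc k) f \<longleftrightarrow> (\<forall>x. f differentiable (at x)) \<and> (\<forall>j. Ck k (pderiv_at j f))"

definition test_functions :: "(real ^ 'd) set \<Rightarrow> (real ^ 'd \<Rightarrow> real) set" where
  "test_functions D = {\<phi>. (\<forall>k. Ck k \<phi>) \<and> compact (closure {x. \<phi> x \<noteq> 0}) \<and> closure {x. \<phi> x \<noteq> 0} \<subseteq> D}"

definition locally_integrable :: "(real ^ 'd) set \<Rightarrow> (real ^ 'd \<Rightarrow> 'b::euclidean_space) \<Rightarrow> bool" where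
  "locally_integrable D u \<longleftrightarrow> (\<forall>K. compact K \<and> K \<subseteq> D \<longrightarrow> integrable (lebesgue_on K) u)"

definition is_weak_grad :: "(real ^ 'd) set \<Rightarrow> (real ^ 'd \<Rightarrow> real) \<Rightarrow> (real ^ 'd \<Rightarrow> real ^ 'd) \<Rightarrow> bool" where
  "is_weak_grad D u g \<longleftrightarrow> locally_integrable D u \<and> locally_integrable D g \<and>
     (\<forall>\<phi>\<in>test_functions D. \<forall>j.
        (LINT x|lebesgue_on D. u x * pderiv_at j \<phi> x) = - (LINT x|lebesgue_on D. g x $ j * \<phi> x))"

text \<open>
  Weak gradients on an open set are unique up to null sets, so every use below (inside an integral or an
  essential supremum) is independent of the choice.
\<close>

definition wgrad :: "(real ^ 'd) set \<Rightarrow> (real ^ 'd \<Rightarrow> real) \<Rightarrow> real ^ 'd \<Rightarrow> real ^ 'd" where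
  "wgrad D u = (SOME g. is_weak_grad D u g)"

definition H1 :: "(real ^ 'd) set \<Rightarrow> (real ^ 'd \<Rightarrow> real) set" where
  "H1 D = {u. u \<in> L2 D \<and> (\<exists>g. is_weak_grad D u g \<and> g \<in> L2 D)}"

definition H1_norm :: "(real ^ 'd) set \<Rightarrow> (real ^ 'd \<Rightarrow> real) \<Rightarrow> real" where
  "H1_norm D u = sqrt ((L2_norm D u)\<^sup>2 + (L2_norm D (wgrad D u))\<^sup>2)"

definition W1inf :: "(real ^ 'd) set \<Rightarrow> (real ^ 'd \<Rightarrow> real) set" where
  "W1inf D = {u. u \<in> Linf D \<and> (\<exists>g. is_weak_grad D u g \<and> g \<in> Linf D)}"

section \<open>Boundary values\<close>

definition hausdorff_pre :: "nat \<Rightarrow> real \<Rightarrow> (real ^ 'd) set \<Rightarrow> ennreal" where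
  "hausdorff_pre s \<delta> S =
     (INF U \<in> {U :: nat \<Rightarrow> (real ^ 'd) set. S \<subseteq> (\<Union>k. U k) \<and> (\<forall>k. bounded (U k) \<and> diameter (U k) \<le> \<delta>)}.
        \<Sum>k. ennreal (unit_ball_vol (real s) * (diameter (U k) / 2) ^ s))"

definition hausdorff_outer :: "nat \<Rightarrow> (real ^ 'd) set \<Rightarrow> ennreal" where
  "hausdorff_outer s S = (SUP \<delta>\<in>{0<..}. hausdorff_pre s \<delta> S)"

text \<open>
  The \<open>(d-1)\<close>-dimensional Hausdorff measure.  Since \<open>hausdorff_outer\<close> is a metric outer measure, it is
  countably additive on the Borel sets, so \<open>measure_of\<close> does not degenerate.
\<close>

definition surface_measure :: "(real ^ 'd) measure" where
  "surface_measure = measure_of UNIV (sets borel) (hausdorff_outer (CARD('d) - 1))"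

text \<open>
  The trace operator on a Lipschitz domain is the continuous extension, from the \<open>H1\<close> norm to the
  \<open>L2\<close> norm on the boundary, of the restriction \<open>\<phi> \<mapsto> \<phi>|frontier D\<close> defined on the dense subspace
  of those \<open>\<phi> \<in> H1 D\<close> that are continuous on \<open>closure D\<close>.
\<close>

definition has_trace :: "(real ^ 'd) set \<Rightarrow> (real ^ 'd \<Rightarrow> real) \<Rightarrow> (real ^ 'd \<Rightarrow> real) \<Rightarrow> bool" where
  "has_trace D v t \<longleftrightarrow> t \<in> borel_measurable borel \<and>
     (\<exists>\<phi>. (\<forall>n::nat. \<phi> n \<in> H1 D \<and> continuous_on (closure D) (\<phi> n)) \<and>
          (\<lambda>n. H1_norm D (\<lambda>x. \<phi> n x - v x)) \<longlonglongrightarrow> 0 \<and>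
          (\<lambda>n. \<integral>\<^sup>+x\<in>frontier D. ennreal ((\<phi> n x - t x)\<^sup>2) \<partial>surface_measure) \<longlonglongrightarrow> 0)"

definition H1_vanishing :: "(real ^ 'd) set \<Rightarrow> (real ^ 'd) set \<Rightarrow> (real ^ 'd \<Rightarrow> real) set" where
  "H1_vanishing D S = {v \<in> H1 D. \<exists>t. has_trace D v t \<and> (AE x in surface_measure. x \<in> S \<longrightarrow> t x = 0)}"

definition H1_0 :: "(real ^ 'd) set \<Rightarrow> (real ^ 'd \<Rightarrow> real) set" where
  "H1_0 D = H1_vanishing D (frontier D)"

definition H1_Gamma :: "(real ^ 'd) set \<Rightarrow> (real ^ 'd) set \<Rightarrow> (real ^ 'd \<Rightarrow> real) set" where
  "H1_Gamma \<Omega> D = H1_vanishing D (frontier D \<inter> frontier \<Omega>)"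

section \<open>The reaction-diffusion problem\<close>

definition admissible_coeff :: "(real ^ 'd) set \<Rightarrow> (real ^ 'd \<Rightarrow> real ^ 'd ^ 'd) \<Rightarrow> real \<Rightarrow> real \<Rightarrow> bool" where
  "admissible_coeff \<Omega> A amin amax \<longleftrightarrow> 0 < amin \<and> amin < amax \<and> A \<in> Linf \<Omega> \<and>
     (\<forall>x\<in>\<Omega>. transpose (A x) = A x \<and>
        (\<forall>\<xi>. amin * (norm \<xi>)\<^sup>2 \<le> (A x *v \<xi>) \<bullet> \<xi> \<and> (A x *v \<xi>) \<bullet> \<xi> \<le> amax * (norm \<xi>)\<^sup>2))"

definition energy_form ::
    "(real ^ 'd \<Rightarrow> real ^ 'd ^ 'd) \<Rightarrow> real \<Rightarrow> (real ^ 'd) set \<Rightarrow> (real ^ 'd \<Rightarrow> real) \<Rightarrow> (real ^ 'd \<Rightarrow> real) \<Rightarrow> real" where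
  "energy_form A \<epsilon> D u v =
     \<epsilon>\<^sup>2 * (LINT x|lebesgue_on D. (A x *v wgrad D u x) \<bullet> wgrad D v x) + (LINT x|lebesgue_on D. u x * v x)"

definition energy_norm ::
    "(real ^ 'd \<Rightarrow> real ^ 'd ^ 'd) \<Rightarrow> real \<Rightarrow> (real ^ 'd) set \<Rightarrow> (real ^ 'd \<Rightarrow> real) \<Rightarrow> real" where
  "energy_norm A \<epsilon> D u = sqrt (energy_form A \<epsilon> D u u)"

definition weak_solution ::
    "(real ^ 'd \<Rightarrow> real ^ 'd ^ 'd) \<Rightarrow> real \<Rightarrow> (real ^ 'd) set \<Rightarrow> (real ^ 'd \<Rightarrow> real) set \<Rightarrow>
     (real ^ 'd \<Rightarrow> real) \<Rightarrow> (real ^ 'd \<Rightarrow> real) \<Rightarrow> bool" where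
  "weak_solution A \<epsilon> D V f u \<longleftrightarrow>
     u \<in> V \<and> (\<forall>v\<in>V. energy_form A \<epsilon> D u v = (LINT x|lebesgue_on D. f x * v x))"

section \<open>Cover, partition of unity and cutoff functions\<close>

definition open_cover :: "(real ^ 'd) set \<Rightarrow> nat \<Rightarrow> (nat \<Rightarrow> (real ^ 'd) set) \<Rightarrow> nat \<Rightarrow> bool" where
  "open_cover \<Omega> M \<omega> \<kappa> \<longleftrightarrow>
     (\<forall>i\<in>{1..M}. open (\<omega> i) \<and> connected (\<omega> i) \<and> \<omega> i \<subseteq> \<Omega>) \<and> (\<Union>i\<in>{1..M}. \<omega> i) = \<Omega> \<and>
     (\<forall>x\<in>\<Omega>. card {i\<in>{1..M}. x \<in> \<omega> i} \<le> \<kappa>)"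

definition partition_of_unity ::
    "(real ^ 'd) set \<Rightarrow> nat \<Rightarrow> (nat \<Rightarrow> (real ^ 'd) set) \<Rightarrow> (nat \<Rightarrow> real ^ 'd \<Rightarrow> real) \<Rightarrow> real \<Rightarrow> bool" where
  "partition_of_unity \<Omega> M \<omega> \<theta> C \<longleftrightarrow>
     (\<forall>x\<in>\<Omega>. (\<Sum>i\<in>{1..M}. \<theta> i x) = 1) \<and>
     (\<forall>i\<in>{1..M}. (\<forall>x\<in>\<Omega>. 0 \<le> \<theta> i x \<and> \<theta> i x \<le> 1) \<and> (\<forall>x\<in>\<Omega> - \<omega> i. \<theta> i x = 0) \<and> \<theta> i \<in> W1inf \<Omega> \<and>
        Linf_norm (\<omega> i) (wgrad \<Omega> (\<theta> i)) \<le> C / diameter (\<omega> i))"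

text \<open>
  \<open>\<eta> \<in> C\<^sup>1(closure D')\<close> means that \<open>\<eta>\<close> and its gradient \<open>g\<close> on \<open>D'\<close> extend continuously to \<open>closure D'\<close>.
  Note that \<open>setdist\<close> is \<open>0\<close> if one of its arguments is empty.
\<close>

definition cutoff_constant :: "(real ^ 'd) set \<Rightarrow> real \<Rightarrow> bool" where
  "cutoff_constant \<Omega> C \<longleftrightarrow> 0 < C \<and>
     (\<forall>D D'. open D \<and> connected D \<and> open D' \<and> connected D' \<and> D \<subseteq> D' \<and> D' \<subseteq> \<Omega> \<and>
             0 < setdist D (frontier D' - frontier \<Omega>) \<longrightarrow>
        (\<exists>\<eta> g. continuous_on (closure D') \<eta> \<and> continuous_on (closure D') g \<and>
           (\<forall>x\<in>D'. (\<eta> has_derivative (\<lambda>h. g x \<bullet> h)) (at x)) \<and>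
           (\<forall>x\<in>frontier D' - frontier \<Omega>. \<eta> x = 0) \<and> (\<forall>x\<in>D. \<eta> x = (1::real)) \<and>
           (\<forall>x\<in>D'. norm (g x) \<le> C / setdist D (frontier D' - frontier \<Omega>))))"

end

theory Submission
  imports Defs
begin

text \<open>
  Put \<open>w = u - \<psi>\<close> on the oversampling domain \<open>D\<close>.  If \<open>a\<close> is a weight that vanishes on the part of the
  boundary of \<open>D\<close> inside \<open>\<Omega>\<close>, then \<open>a\<^sup>2 w\<close>, extended by zero, is admissible in both weak formulations, and
  subtracting them gives the energy identity
  \<open>\<parallel>a w\<parallel>\<^sup>2 = \<epsilon>\<^sup>2 \<integral> w\<^sup>2 (A \<nabla>a \<bullet> \<nabla>a)\<close> in the energy norm.  For \<open>a\<close> the partition function this bounds the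
  energy norm by the \<open>L2\<close> norm of \<open>w\<close> on \<open>\<omega>\<close>.  For \<open>a = exp (\<gamma> \<eta>) - 1\<close> with the cutoff \<open>\<eta>\<close>, the right-hand side is
  at most \<open>exp (-2) \<parallel>(a + 1) w\<parallel>\<^sup>2\<close> in \<open>L2\<close>, so it can be absorbed, and \<open>a = exp \<gamma> - 1\<close> on \<open>\<omega>\<close> yields the exponential decay.
  \<open>L2\<close> norms of \<open>w\<close> are controlled by those of \<open>u\<close> and \<open>f\<close>, testing the local problem with \<open>\<psi>\<close>.
\<close>

section \<open>Smooth functions and mollifiers\<close>

text \<open>The spaces \<open>H1_0\<close> and \<open>H1_Gamma\<close> are given by traces, that is,
  by continuous functions that converge in \<open>H1\<close> and on the boundary; a test function is
  admissible only once such approximants are exhibited. Squared weights times the approximants of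
  \<open>u\<close> and of the local solution provide them, if the weight is continuous on
  \<open>closure D\<close> and vanishes also at those points of the outer boundary where the inner
  one accumulates. A partition function is merely bounded with bounded weak gradient, so a
  representative continuous up to the boundary must be constructed; the Lipschitz graph condition
  enters here. The square serves twice: by symmetry of the coefficient the mixed terms combine to
  the energy of \<open>a w\<close>, and the gradient of the squared weight vanishes with
  \<open>a\<close>, so that truncations near the zeros converge together with their gradients. The
  exponent \<open>\<gamma>\<close> is normalised so that the gradient term carries exactly the
  factor \<open>exp (-1)\<close>; absorbing it leaves the factor (e - 1) (e^\<gamma> - 1), which is
  at least e^(\<gamma> - 1) once \<open>\<gamma> > 1\<close>.\<close>

lemma Ck_imp_continuous: "Ck k f \<Longrightarrow> continuous_on UNIV f"
  by (cases k) (auto simp: continuous_on_eq_continuous_within intro: differentiable_imp_continuous_within)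

lemma Ck_SucD: "Ck (Suc k) f \<Longrightarrow> Ck k f"
  by (induction k arbitrary: f)
    (auto simp: continuous_on_eq_continuous_within intro: differentiable_imp_continuous_within)

lemma Ck_add: "Ck k f \<Longrightarrow> Ck k g \<Longrightarrow> Ck k (\<lambda>x. f x + g x)"
proof (induction k arbitrary: f g)
  case 0 then show ?case by (auto intro: continuous_intros)
next
  case (Suc k)
  then have df: "\<And>x. f differentiable (at x)" and dg: "\<And>x. g differentiable (at x)" by auto
  have "pderiv_at j (\<lambda>x. f x + g x) = (\<lambda>x. pderiv_at j f x + pderiv_at j g x)" for j
    unfolding pderiv_at_def
  proof
    fix x
    have "((\<lambda>x. f x + g x) has_derivative (\<lambda>h. frechet_derivative f (at x) h + frechet_derivative g (at x) h)) (at x)"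
      using df dg by (intro has_derivative_add) (simp_all add: frechet_derivative_works[symmetric])
    from fun_cong[OF frechet_derivative_at[OF this], of "axis j 1"]
    show "frechet_derivative (\<lambda>x. f x + g x) (at x) (axis j 1) =
      frechet_derivative f (at x) (axis j 1) + frechet_derivative g (at x) (axis j 1)" by simp
  qed
  with Suc df dg show ?case by (auto intro!: differentiable_add)
qed

lemma pderiv_mult:
  assumes "f differentiable (at x)" "g differentiable (at x)"
  shows "pderiv_at j (\<lambda>x. f x * g x) x = f x * pderiv_at j g x + pderiv_at j f x * g x"
proof -
  have "((\<lambda>x. f x * g x) has_derivative (\<lambda>h. f x * frechet_derivative g (at x) h + frechet_derivative f (at x) h * g x)) (at x)"
    using assms by (intro has_derivative_mult) (simp_all add: frechet_derivative_works[symmetric])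
  from fun_cong[OF frechet_derivative_at[OF this], of "axis j 1"] show ?thesis
    unfolding pderiv_at_def by simp
qed

lemma Ck_mult: "Ck k f \<Longrightarrow> Ck k g \<Longrightarrow> Ck k (\<lambda>x. f x * g x)"
proof (induction k arbitrary: f g)
  case 0 then show ?case by (auto intro: continuous_intros)
next
  case (Suc k)
  then have df: "\<And>x. f differentiable (at x)" and dg: "\<And>x. g differentiable (at x)" by auto
  have "pderiv_at j (\<lambda>x. f x * g x) = (\<lambda>x. f x * pderiv_at j g x + pderiv_at j f x * g x)" for j
    by (rule ext) (rule pderiv_mult[OF df dg])
  moreover have "Ck k f" "Ck k g" using Suc.prems Ck_SucD by blast+
  ultimately show ?case using Suc df dg by (auto intro!: Ck_add)
qed

lemma has_derivative_imp_pderiv: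
  "(f has_derivative f') (at x) \<Longrightarrow> pderiv_at j f x = f' (axis j 1)"
  unfolding pderiv_at_def using frechet_derivative_at by metis

lemma Ck_const: "Ck k (\<lambda>x :: real^'a. c)"
proof (induction k arbitrary: c)
  case (Suc k)
  have "pderiv_at j (\<lambda>x. c) = (\<lambda>x. 0)" for j :: 'a
    by (rule ext, rule has_derivative_imp_pderiv[THEN trans]) (auto intro!: derivative_eq_intros)
  then show ?case using Suc by (simp del: Ck.simps(1))
qed auto

lemma Ck_minus: "Ck k f \<Longrightarrow> Ck k (\<lambda>x. - f x)"
  using Ck_mult[OF Ck_const[of k "-1"], of f] by simp

lemma Ck_nth: "Ck k (\<lambda>x. x $ i)"
proof (cases k)
  case (Suc k)
  have d: "((\<lambda>x. x $ i) has_derivative (\<lambda>h. h $ i)) (at x)" for x :: "real^'a"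
    by (rule bounded_linear_imp_has_derivative) (rule bounded_linear_vec_nth)
  have "pderiv_at j (\<lambda>x. x $ i) = (\<lambda>x. axis j 1 $ i)" for j :: 'a
    by (rule ext, rule has_derivative_imp_pderiv[OF d])
  then show ?thesis using d Suc by (auto intro!: Ck_const simp: differentiable_def)
qed (auto intro!: continuous_intros)

text \<open>
  These functions are closed under differentiation, so \<open>expinv 1 (r\<^sup>2 - x \<bullet> x)\<close> is a smooth bump.
\<close>

definition expinv :: "real poly \<Rightarrow> real \<Rightarrow> real" where
  "expinv p t = (if t \<le> 0 then 0 else poly p (1 / t) * exp (- (1 / t)))"

lemma poly_exp_at_top: "((\<lambda>s::real. poly p s * exp (- s)) \<longlongrightarrow> 0) at_top"
proof -
  have "((\<lambda>s::real. (\<Sum>i\<le>degree p. coeff p i * (s ^ i / exp s))) \<longlongrightarrow> (\<Sum>i\<le>degree p. coeff p i * 0)) at_top"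
    by (intro tendsto_intros tendsto_power_div_exp_0)
  moreover have "(\<lambda>s::real. poly p s * exp (- s)) = (\<lambda>s. \<Sum>i\<le>degree p. coeff p i * (s ^ i / exp s))"
    by (simp add: poly_altdef sum_distrib_right exp_minus divide_inverse mult.assoc)
  ultimately show ?thesis by simp
qed

text \<open>With s = 1/t, differentiating p(s) exp(-s) in t gives s^2 (p(s) - p'(s)) exp(-s), again
  of the same form; the factor \<open>[:0,0,1:]\<close> is s^2. At 0 the difference quotient from
  the right is s p(s) exp(-s), which tends to 0 as s grows, and from the left it is 0.\<close>

lemma expinv_deriv:
  "(expinv p has_real_derivative expinv ([:0,0,1:] * (p - pderiv p)) t) (at t)"
proof -
  consider "t < 0" | "t > 0" | "t = 0" by linarith
  then show ?thesis
  proof cases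
    case 1
    have "((\<lambda>x. 0) has_real_derivative 0) (at t)" by simp
    moreover have "eventually (\<lambda>x. expinv p x = 0) (nhds t)"
      using eventually_nhds_in_open[of "{..<0}" t] 1 by (auto elim!: eventually_mono simp: expinv_def)
    ultimately show ?thesis using 1 by (subst DERIV_cong_ev[OF refl _ refl, where g="\<lambda>x. 0"]) (auto simp: expinv_def)
  next
    case 2
    have "((\<lambda>t. poly p (1/t) * exp (-(1/t))) has_real_derivative expinv ([:0,0,1:] * (p - pderiv p)) t) (at t)"
      using 2 by (auto intro!: derivative_eq_intros poly_DERIV[THEN DERIV_chain2] simp: expinv_def field_simps power2_eq_square)
    moreover have "eventually (\<lambda>x. expinv p x = poly p (1/x) * exp (-(1/x))) (nhds t)"
      using eventually_nhds_in_open[of "{0<..}" t] 2 by (auto elim!: eventually_mono simp: expinv_def)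
    ultimately show ?thesis by (subst DERIV_cong_ev[OF refl _ refl])
  next
    case 3
    have 1: "((\<lambda>h. (expinv p h) / h) \<longlongrightarrow> 0) (at_left 0)"
      by (rule tendsto_eventually) (auto simp: expinv_def eventually_at_filter)
    have "((\<lambda>h. poly ([:0,1:]*p) (1/h) * exp (- (1/h))) \<longlongrightarrow> 0) (at_right (0::real))"
      by (rule filterlim_compose[OF poly_exp_at_top])
         (use filterlim_inverse_at_top_right in \<open>simp add: divide_inverse\<close>)
    then have 2: "((\<lambda>h. (expinv p h) / h) \<longlongrightarrow> 0) (at_right 0)"
      by (rule Lim_transform_eventually) (auto simp: expinv_def eventually_at_filter)
    have "((\<lambda>h. (expinv p h) / h) \<longlongrightarrow> 0) (at 0)" using 1 2 filterlim_split_at by blast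
    then show ?thesis using 3 by (simp add: DERIV_def expinv_def)
  qed
qed

lemma Ck_expinv: "Ck k (\<lambda>x. expinv p (r - x \<bullet> x))"
proof (induction k arbitrary: p)
  case 0
  have "isCont (expinv p) t" for t using DERIV_isCont[OF expinv_deriv] .
  then have "continuous_on UNIV (expinv p)" by (simp add: continuous_on_eq_continuous_within)
  then show ?case by (auto intro!: continuous_intros continuous_on_compose2[where g="expinv p" and t=UNIV])
next
  case (Suc k)
  let ?q = "[:0,0,1:] * (p - pderiv p)"
  have d: "((\<lambda>x. expinv p (r - x \<bullet> x)) has_derivative (\<lambda>h. expinv ?q (r - x \<bullet> x) * (- 2 * (x \<bullet> h)))) (at x)"
    for x :: "real^'a"
    by (rule DERIV_compose_FDERIV[OF expinv_deriv, THEN has_derivative_eq_rhs])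
       (auto intro!: derivative_eq_intros simp: inner_commute)
  have "pderiv_at j (\<lambda>x. expinv p (r - x \<bullet> x)) = (\<lambda>x. expinv ?q (r - x \<bullet> x) * (- 2 * (x $ j)))" for j :: 'a
    by (rule ext, rule has_derivative_imp_pderiv[OF d, THEN trans]) (simp add: inner_axis)
  then show ?case using d Suc
    by (auto intro!: Ck_mult Ck_const Ck_nth Ck_minus simp: differentiable_def)
qed

text \<open>Test functions detached from a domain: kernels are translated and reflected before it is
  known where their supports lie, and only then promoted to \<open>test_functions D\<close>.\<close>

definition smooth_c :: "(real ^ 'd \<Rightarrow> real) \<Rightarrow> bool" where
  "smooth_c \<phi> \<longleftrightarrow> (\<forall>k. Ck k \<phi>) \<and> bounded {x. \<phi> x \<noteq> 0}"

lemma pderiv_outside_support: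
  assumes "x \<notin> closure {x. \<phi> x \<noteq> 0}" shows "pderiv_at j \<phi> x = 0"
proof -
  have "(\<phi> has_derivative (\<lambda>h. 0)) (at x)"
    by (rule has_derivative_transform_within_open[of "\<lambda>x. 0" _ x UNIV "- closure {x. \<phi> x \<noteq> 0}"])
       (use assms closure_subset[of "{x. \<phi> x \<noteq> 0}"] in auto)
  from has_derivative_imp_pderiv[OF this] show ?thesis .
qed

lemma smooth_cD:
  assumes "smooth_c \<phi>"
  shows "continuous_on UNIV \<phi>" "\<phi> differentiable (at x)" "smooth_c (pderiv_at j \<phi>)"
    "isCont \<phi> x" "\<phi> \<in> borel_measurable borel"
proof -
  show c: "continuous_on UNIV \<phi>" using assms Ck_imp_continuous smooth_c_def by blast
  show "\<phi> differentiable (at x)" using assms unfolding smooth_c_def using Ck.simps(2) by blast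
  have "{x. pderiv_at j \<phi> x \<noteq> 0} \<subseteq> closure {x. \<phi> x \<noteq> 0}" using pderiv_outside_support[of _ \<phi> j] by blast
  moreover have "Ck k (pderiv_at j \<phi>)" for k
    using assms unfolding smooth_c_def using Ck.simps(2) by blast
  ultimately show "smooth_c (pderiv_at j \<phi>)"
    using assms unfolding smooth_c_def by (meson bounded_closure bounded_subset)
  show "isCont \<phi> x" using c by (simp add: continuous_on_eq_continuous_within)
  show "\<phi> \<in> borel_measurable borel" by (rule borel_measurable_continuous_onI[OF c])
qed

lemma smooth_c_bounded: assumes "smooth_c \<phi>" shows "\<exists>B\<ge>0. \<forall>x. \<bar>\<phi> x\<bar> \<le> B"
proof -
  let ?S = "closure {x. \<phi> x \<noteq> 0}"
  have "compact ?S" using assms by (simp add: smooth_c_def compact_closure)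
  then have "bounded (\<phi> ` ?S)"
    by (meson assms compact_continuous_image compact_imp_bounded continuous_on_subset smooth_cD(1) subset_UNIV)
  then obtain B where B: "\<And>y. y \<in> ?S \<Longrightarrow> \<bar>\<phi> y\<bar> \<le> B" unfolding bounded_iff by auto
  have "\<bar>\<phi> y\<bar> \<le> max B 0" for y
    using B[of y] closure_subset[of "{x. \<phi> x \<noteq> 0}"] by (cases "\<phi> y = 0") auto
  then show ?thesis by (intro exI[of _ "max B 0"]) auto
qed

lemma pderiv_expand:
  assumes "f differentiable (at x)"
  shows "frechet_derivative f (at x) h = (\<Sum>j\<in>UNIV. h $ j * pderiv_at j f x)"
proof -
  interpret linear "frechet_derivative f (at x)"
    using assms linear_frechet_derivative by blast
  have "frechet_derivative f (at x) h = frechet_derivative f (at x) (\<Sum>j\<in>UNIV. h $ j *\<^sub>R axis j 1)"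
    using basis_expansion[of h] by (simp add: scalar_mult_eq_scaleR)
  then show ?thesis by (simp add: sum scaleR pderiv_at_def)
qed

text \<open>The bounded partial derivatives bound the operator norm of the derivative. The global
  constant later dominates the difference quotients under a convolution integral.\<close>

lemma smooth_c_lipschitz:
  assumes "smooth_c \<phi>" shows "\<exists>B\<ge>0. \<forall>x y. \<bar>\<phi> x - \<phi> y\<bar> \<le> B * norm (x - y)"
proof -
  have "\<forall>j. \<exists>B. B \<ge> 0 \<and> (\<forall>x. \<bar>pderiv_at j \<phi> x\<bar> \<le> B)"
    using smooth_c_bounded[OF smooth_cD(3)[OF assms]] by blast
  then obtain B where B: "\<And>j. B j \<ge> 0" "\<And>j x. \<bar>pderiv_at j \<phi> x\<bar> \<le> B j" by metis
  have "norm (\<phi> x - \<phi> y) \<le> (\<Sum>j\<in>UNIV. B j) * norm (x - y)" for x y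
  proof (rule differentiable_bound[of UNIV])
    fix z :: "real^'a"
    show "(\<phi> has_derivative frechet_derivative \<phi> (at z)) (at z within UNIV)"
      using smooth_cD(2)[OF assms] frechet_derivative_works by blast
    show "onorm (frechet_derivative \<phi> (at z)) \<le> sum B UNIV"
    proof (rule onorm_le)
      fix h
      have "\<bar>\<Sum>j\<in>UNIV. h $ j * pderiv_at j \<phi> z\<bar> \<le> (\<Sum>j\<in>UNIV. norm h * B j)"
        by (intro sum_abs[THEN order_trans] sum_mono) (auto simp: abs_mult intro!: mult_mono component_le_norm_cart B)
      then show "norm (frechet_derivative \<phi> (at z) h) \<le> sum B UNIV * norm h"
        using pderiv_expand[OF smooth_cD(2)[OF assms]] by (simp add: sum_distrib_left mult.commute)
    qed
  qed auto
  then show ?thesis by (intro exI[of _ "sum B UNIV"]) (auto simp: B sum_nonneg)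
qed

lemma smooth_c_integrable: assumes "smooth_c \<phi>" shows "integrable lborel \<phi>"
proof -
  let ?S = "closure {x. \<phi> x \<noteq> 0}"
  have "compact ?S" using assms by (simp add: smooth_c_def compact_closure)
  then have "integrable lborel (\<lambda>x. indicator ?S x *\<^sub>R \<phi> x)"
    using borel_integrable_compact[of ?S \<phi>] continuous_on_subset[OF smooth_cD(1)[OF assms]] by auto
  also have "(\<lambda>x. indicator ?S x *\<^sub>R \<phi> x) = \<phi>"
    using closure_subset[of "{x. \<phi> x \<noteq> 0}"] by (auto simp: indicator_def fun_eq_iff)
  finally show ?thesis .
qed

section \<open>Normalised smooth bumps\<close>

definition mollifier :: "real \<Rightarrow> (real ^ 'd \<Rightarrow> real) \<Rightarrow> bool" where
  "mollifier r \<rho> \<longleftrightarrow> smooth_c \<rho> \<and> (\<forall>x. 0 \<le> \<rho> x) \<and> (\<forall>x. r \<le> norm x \<longrightarrow> \<rho> x = 0) \<and> (LINT x|lborel. \<rho> x) = 1"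

lemma mollifier_exists: assumes "r > 0" obtains \<rho> :: "real ^ 'd \<Rightarrow> real" where "mollifier r \<rho>"
proof -
  define \<beta> :: "real^'d \<Rightarrow> real" where "\<beta> x = expinv 1 (r^2 - x \<bullet> x)" for x
  have pos: "\<beta> x \<ge> 0" for x by (auto simp: \<beta>_def expinv_def)
  have nz: "\<beta> x \<noteq> 0 \<longleftrightarrow> norm x < r" for x
    using assms by (auto simp: \<beta>_def expinv_def dot_square_norm abs_le_square_iff[symmetric] not_le)

  have s: "smooth_c \<beta>"
    unfolding smooth_c_def
  proof
    show "\<forall>k. Ck k \<beta>" unfolding \<beta>_def using Ck_expinv by blast
    show "bounded {x. \<beta> x \<noteq> 0}" unfolding nz by (rule bounded_subset[of "ball 0 r"]) auto
  qed
  have i: "integrable lborel \<beta>" by (rule smooth_c_integrable[OF s])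
  define I where "I = (LINT x|lborel. \<beta> x)"
  \<comment> \<open>A zero integral of the nonnegative bump would make the set where it is nonzero,
    an open ball, a null set.\<close>
  have "I \<noteq> 0"
  proof
    assume "I = 0"
    then have "AE x in lborel. \<beta> x = 0"
      using integral_nonneg_eq_0_iff_AE[OF i] pos unfolding I_def by blast
    moreover have "{x. \<not> \<beta> x = 0} = ball 0 r" by (simp add: nz set_eq_iff)
    moreover have "{x \<in> space lborel. \<beta> x \<noteq> 0} \<in> sets lborel"
      using borel_measurable_integrable[OF i] by measurable
    ultimately have "ball (0::real^'d) r \<in> null_sets lborel"
      by (simp add: AE_iff_null)
    then have "negligible (ball (0::real^'d) r)"
      unfolding negligible_iff_null_sets by (rule null_sets_completionI)
    moreover have "\<not> negligible (ball (0::real^'d) r)"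
      using assms by (intro open_not_negligible) (simp_all add: not_le)
    ultimately show False by blast
  qed
  moreover have "I \<ge> 0" unfolding I_def using pos by simp
  ultimately have I: "I > 0" by simp
  have "mollifier r (\<lambda>x. (1 / I) * \<beta> x)"
    unfolding mollifier_def smooth_c_def
  proof (intro conjI allI impI)
    show "Ck k (\<lambda>x. (1 / I) * \<beta> x)" for k using s by (intro Ck_mult Ck_const) (auto simp: smooth_c_def)
    show "bounded {x. (1 / I) * \<beta> x \<noteq> 0}" using s I by (auto simp: smooth_c_def)
    show "(LINT x|lborel. (1 / I) * \<beta> x) = 1" using I by (simp only: Bochner_Integration.integral_mult_right_zero) (simp add: I_def)
    show "(1 / I) * \<beta> x = 0" if "r \<le> norm x" for x using nz[of x] that by simp
  qed (use pos I in auto)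
  then show thesis using that by blast
qed

section \<open>Convolution\<close>

definition conv :: "(real ^ 'd \<Rightarrow> real) \<Rightarrow> (real ^ 'd \<Rightarrow> real) \<Rightarrow> real ^ 'd \<Rightarrow> real" where
  "conv u \<phi> x = (LINT y|lborel. u y * \<phi> (x - y))"

lemma conv_integrable:
  assumes "integrable lborel u" "smooth_c \<phi>"
  shows "integrable lborel (\<lambda>y. u y * \<phi> (x - y))"
proof -
  have [measurable]: "u \<in> borel_measurable borel" "\<phi> \<in> borel_measurable borel"
    using borel_measurable_integrable[OF assms(1)] smooth_cD(5)[OF assms(2)] by auto
  obtain B where B: "\<And>x. \<bar>\<phi> x\<bar> \<le> B" using smooth_c_bounded[OF assms(2)] by blast
  show ?thesis
    by (rule Bochner_Integration.integrable_bound[of _ "\<lambda>y. B * \<bar>u y\<bar>"])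
       (use B assms(1) in \<open>auto simp: abs_mult mult.commute[of B] intro!: AE_I2 mult_left_mono order_trans[OF B abs_ge_self]\<close>)
qed

text \<open>Differentiation under the integral: the first-order remainder of the kernel divided by
  the norm of \<open>h\<close> tends to 0 pointwise and is bounded by the Lipschitz constant plus
  the bound on the derivative, so a multiple of |u| dominates.\<close>

lemma conv_has_derivative:
  assumes u: "integrable lborel u" and \<phi>: "smooth_c \<phi>"
  shows "(conv u \<phi> has_derivative (\<lambda>h. \<Sum>j\<in>UNIV. h $ j * conv u (pderiv_at j \<phi>) x)) (at x)"
proof -
  have [measurable]: "u \<in> borel_measurable borel" "\<phi> \<in> borel_measurable borel"
    "\<And>j. pderiv_at j \<phi> \<in> borel_measurable borel"
    subgoal using borel_measurable_integrable[OF u] by simp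
    subgoal by (rule smooth_cD(5)[OF \<phi>])
    subgoal by (rule smooth_cD(5)[OF smooth_cD(3)[OF \<phi>]])
    done
  obtain L where L: "\<And>x y. \<bar>\<phi> x - \<phi> y\<bar> \<le> L * norm (x - y)"
    using smooth_c_lipschitz[OF \<phi>] by blast
  have "\<forall>j. \<exists>B. B \<ge> 0 \<and> (\<forall>x. \<bar>pderiv_at j \<phi> x\<bar> \<le> B)"
    using smooth_c_bounded[OF smooth_cD(3)[OF \<phi>]] by blast
  then obtain B where B: "\<And>j. B j \<ge> 0" "\<And>j x. \<bar>pderiv_at j \<phi> x\<bar> \<le> B j" by metis
  define D where "D y h = (\<Sum>j\<in>UNIV. h $ j * pderiv_at j \<phi> y)" for y h
  have [measurable]: "(\<lambda>y. D (x - y) h) \<in> borel_measurable borel" for x h unfolding D_def by measurable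
  have Dle: "\<bar>D y h\<bar> \<le> sum B UNIV * norm h" for y h
  proof -
    have "\<bar>D y h\<bar> \<le> (\<Sum>j\<in>UNIV. norm h * B j)"
      unfolding D_def
      by (intro sum_abs[THEN order_trans] sum_mono) (auto simp: abs_mult intro!: mult_mono component_le_norm_cart B)
    then show ?thesis by (simp add: sum_distrib_left mult.commute)
  qed
  have Dd: "((\<lambda>h. (\<phi> (y + h) - \<phi> y - D y h) / norm h) \<longlongrightarrow> 0) (at 0)" for y
  proof -
    have "(\<phi> has_derivative D y) (at y)"
    proof -
      have "frechet_derivative \<phi> (at y) = D y"
        unfolding D_def by (rule ext) (rule pderiv_expand[OF smooth_cD(2)[OF \<phi>]])
      then show ?thesis using smooth_cD(2)[OF \<phi>, of y] frechet_derivative_works[of \<phi> "at y"] by simp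
    qed
    then have "((\<lambda>h. norm (\<phi> (y + h) - \<phi> y - D y h) / norm h) \<longlongrightarrow> 0) (at 0)" by (simp add: has_derivative_at)
    then show ?thesis by (subst tendsto_norm_zero_iff[symmetric]) simp
  qed
  \<comment> \<open>\<open>R h\<close> is \<open>u\<close> times the scaled remainder of the kernel;
    the next fact identifies its integral with the scaled remainder of the convolution.\<close>
  define R where "R h y = u y * ((\<phi> (x - y + h) - \<phi> (x - y) - D (x - y) h) / norm h)" for h y
  have eq: "(conv u \<phi> (x + h) - conv u \<phi> x - (\<Sum>j\<in>UNIV. h $ j * conv u (pderiv_at j \<phi>) x)) / norm h = (LINT y|lborel. R h y)" for h
  proof -
    have i: "integrable lborel (\<lambda>y. u y * \<phi> (x + h - y))" "integrable lborel (\<lambda>y. u y * \<phi> (x - y))"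
       "\<And>j. integrable lborel (\<lambda>y. u y * pderiv_at j \<phi> (x - y))"
      by (intro conv_integrable u \<phi> smooth_cD(3))+
    have "(LINT y|lborel. R h y) = (LINT y|lborel. (1 / norm h) * (u y * \<phi> (x + h - y) - u y * \<phi> (x - y) -
        (\<Sum>j\<in>UNIV. h $ j * (u y * pderiv_at j \<phi> (x - y)))))"
    proof (intro Bochner_Integration.integral_cong refl)
      fix y
      have "(\<Sum>j\<in>UNIV. h $ j * (u y * pderiv_at j \<phi> (x - y))) = u y * D (x - y) h"
        by (simp add: D_def sum_distrib_left mult.left_commute)
      moreover have "\<phi> (x - y + h) = \<phi> (x + h - y)" by (simp add: algebra_simps)
      ultimately show "R h y = (1 / norm h) * (u y * \<phi> (x + h - y) - u y * \<phi> (x - y) -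
        (\<Sum>j\<in>UNIV. h $ j * (u y * pderiv_at j \<phi> (x - y))))"
        unfolding R_def by (simp add: right_diff_distrib diff_divide_distrib)
    qed
    also have "\<dots> = (1 / norm h) * ((LINT y|lborel. u y * \<phi> (x + h - y)) - (LINT y|lborel. u y * \<phi> (x - y)) -
        (\<Sum>j\<in>UNIV. h $ j * (LINT y|lborel. u y * pderiv_at j \<phi> (x - y))))"
      using i by (subst integral_mult_right_zero)
        (simp add: Bochner_Integration.integral_diff Bochner_Integration.integral_sum)
    finally show ?thesis by (simp add: conv_def)
  qed
  have "((\<lambda>h. LINT y|lborel. R h y) \<longlongrightarrow> 0) (at 0)"
    unfolding tendsto_at_iff_sequentially comp_def
  proof (intro allI impI)
    fix X :: "nat \<Rightarrow> real^'a" assume X: "\<forall>i. X i \<in> UNIV - {0}" "X \<longlonglongrightarrow> 0"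
    then have X': "filterlim X (at 0) sequentially" by (auto simp: filterlim_at)
    have "(\<lambda>n. LINT y|lborel. R (X n) y) \<longlonglongrightarrow> (LINT y|(lborel :: (real^'a) measure). (0::real))"
    proof (rule integral_dominated_convergence[where w="\<lambda>y. (L + sum B UNIV) * \<bar>u y\<bar>"])
      show "AE y in lborel. (\<lambda>n. R (X n) y) \<longlonglongrightarrow> 0"
        unfolding R_def by (intro AE_I2 tendsto_mult_right_zero filterlim_compose[OF Dd X'])
      show "AE y in lborel. norm (R (X n) y) \<le> (L + sum B UNIV) * \<bar>u y\<bar>" for n
      proof (rule AE_I2)
        fix y
        have n: "norm (X n) > 0" using X by auto
        have "\<bar>\<phi> (x - y + X n) - \<phi> (x - y) - D (x - y) (X n)\<bar> \<le> (L + sum B UNIV) * norm (X n)"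
          using L[of "x - y + X n" "x - y"] Dle[of "x-y" "X n"] by (simp add: algebra_simps)
        then have "\<bar>(\<phi> (x - y + X n) - \<phi> (x - y) - D (x - y) (X n)) / norm (X n)\<bar> \<le> (L + sum B UNIV)"
          using n by (simp add: field_simps)
          then show "norm (R (X n) y) \<le> (L + sum B UNIV) * \<bar>u y\<bar>"
          unfolding R_def real_norm_def abs_mult[of "u y"] mult.commute[of "\<bar>u y\<bar>"] by (rule mult_right_mono) simp
      qed
      show "R (X n) \<in> borel_measurable lborel" for n unfolding R_def by measurable
    qed (use u in auto)
    then show "(\<lambda>n. LINT y|lborel. R (X n) y) \<longlonglongrightarrow> 0" by simp
  qed
  then have "((\<lambda>h. norm (conv u \<phi> (x + h) - conv u \<phi> x - (\<Sum>j\<in>UNIV. h $ j * conv u (pderiv_at j \<phi>) x)) / norm h) \<longlongrightarrow> 0) (at 0)"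
    unfolding eq[symmetric] by (drule_tac tendsto_norm_zero) simp
  moreover have "bounded_linear (\<lambda>h. \<Sum>j\<in>UNIV. h $ j * conv u (pderiv_at j \<phi>) x)"
    by (intro bounded_linear_sum bounded_linear_mult_left[THEN bounded_linear_compose] bounded_linear_vec_nth)
  ultimately show ?thesis by (simp add: has_derivative_at)
qed

lemma conv_pderiv:
  assumes "integrable lborel u" "smooth_c \<phi>"
  shows "pderiv_at j (conv u \<phi>) = conv u (pderiv_at j \<phi>)"
proof
  fix x
  have "pderiv_at j (conv u \<phi>) x = (\<Sum>i\<in>UNIV. axis j 1 $ i * conv u (pderiv_at i \<phi>) x)"
    by (rule has_derivative_imp_pderiv[OF conv_has_derivative[OF assms]])
  then show "pderiv_at j (conv u \<phi>) x = conv u (pderiv_at j \<phi>) x"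
    by (simp add: axis_def if_distrib[of "\<lambda>a. a * _"] sum.delta cong: if_cong)
qed

text \<open>All derivatives fall on the kernel, so the induction keeps \<open>u\<close> and
  generalises over \<open>\<phi>\<close>.\<close>

lemma Ck_conv:
  assumes "integrable lborel u" shows "smooth_c \<phi> \<Longrightarrow> Ck k (conv u \<phi>)"
proof (induction k arbitrary: \<phi>)
  case 0
  have "isCont (conv u \<phi>) x" for x
    using has_derivative_continuous[OF conv_has_derivative[OF assms 0]] .
  then show ?case by (simp add: continuous_on_eq_continuous_within)
next
  case (Suc k)
  then show ?case using conv_has_derivative[OF assms Suc.prems] smooth_cD(3)[OF Suc.prems]
    by (auto simp: conv_pderiv[OF assms Suc.prems] differentiable_def)
qed

section \<open>Translations and their continuity in the \<open>L1\<close> norm\<close>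

lemma lborel_shift:
  fixes f :: "real ^ 'd \<Rightarrow> real"
  shows "integrable lborel f \<Longrightarrow> integrable lborel (\<lambda>x. f (x - z))"
    and "f \<in> borel_measurable borel \<Longrightarrow> (LINT x|lborel. f (x - z)) = (LINT x|lborel. f x)"
proof -
  have m: "(+) (- z) \<in> measurable lborel borel" by simp
  show "(LINT x|lborel. f (x - z)) = (LINT x|lborel. f x)" if "f \<in> borel_measurable borel"
    using integral_distr[OF m that] lborel_distr_plus[of "-z"] by (simp add: add.commute)
  show "integrable lborel (\<lambda>x. f (x - z))" if "integrable lborel f"
    using integrable_distr_eq[OF m, of f] borel_measurable_integrable[OF that] that lborel_distr_plus[of "-z"]
    by (simp add: add.commute)
qed

definition L1_cont :: "(real ^ 'd \<Rightarrow> real) \<Rightarrow> bool" where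
  "L1_cont u \<longleftrightarrow> (\<forall>e>0. \<exists>d>0. \<forall>z. norm z < d \<longrightarrow> (LINT x|lborel. \<bar>u (x - z) - u x\<bar>) < e)"

text \<open>Continuity of translations in \<open>L1\<close> passes from bounded measurable sets to all integrable functions.\<close>

lemma L1_cont_approx:
  assumes u: "integrable lborel u"
    and ex: "\<And>e. e > 0 \<Longrightarrow> \<exists>v. integrable lborel v \<and> L1_cont v \<and> (LINT x|lborel. \<bar>v x - u x\<bar>) < e"
  shows "L1_cont u"
  unfolding L1_cont_def
proof (intro allI impI)
  fix e :: real assume "e > 0"
  then obtain v where v: "integrable lborel v" "L1_cont v" "(LINT x|lborel. \<bar>v x - u x\<bar>) < e / 3"
    using ex[of "e/3"] by auto
  then obtain d where d: "d > 0" "\<And>z. norm z < d \<Longrightarrow> (LINT x|lborel. \<bar>v (x - z) - v x\<bar>) < e / 3"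
    using \<open>e > 0\<close> unfolding L1_cont_def by (meson divide_pos_pos zero_less_numeral)
  have "(LINT x|lborel. \<bar>u (x - z) - u x\<bar>) < e" if "norm z < d" for z
  proof -
    have i: "integrable lborel (\<lambda>x. u (x - z))" "integrable lborel (\<lambda>x. v (x - z))"
      using u v by (auto intro: lborel_shift)
    have "(LINT x|lborel. \<bar>u (x - z) - u x\<bar>) \<le> (LINT x|lborel. \<bar>v (x - z) - u (x - z)\<bar> + \<bar>v (x - z) - v x\<bar> + \<bar>v x - u x\<bar>)"
      using u v i by (intro integral_mono Bochner_Integration.integrable_add Bochner_Integration.integrable_diff integrable_abs) auto
    also have "\<dots> = (LINT x|lborel. \<bar>v (x - z) - u (x - z)\<bar>) + (LINT x|lborel. \<bar>v (x - z) - v x\<bar>) + (LINT x|lborel. \<bar>v x - u x\<bar>)"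
      using u v i by (subst Bochner_Integration.integral_add | simp)+
    also have "(LINT x|lborel. \<bar>v (x - z) - u (x - z)\<bar>) = (LINT x|lborel. \<bar>v x - u x\<bar>)"
      by (rule lborel_shift(2)[of "\<lambda>x. \<bar>v x - u x\<bar>"]) (use borel_measurable_integrable[OF u] borel_measurable_integrable[OF v(1)] in simp)
    finally show ?thesis using v(3) d(2)[OF that] by linarith
  qed
  then show "\<exists>d>0. \<forall>z. norm z < d \<longrightarrow> (LINT x|lborel. \<bar>u (x - z) - u x\<bar>) < e" using d(1) by blast
qed

text \<open>Dominated convergence with 3 |u| gives convergence in \<open>L1\<close>. The bound by 2
  |u| is the one that the limit case of \<open>integrable_induct\<close> supplies.\<close>

lemma L1_cont_limit:
  assumes s: "\<And>i::nat. integrable lborel (s i)" "\<And>i. L1_cont (s i)" and u: "integrable lborel u"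
    and lim: "\<And>x. (\<lambda>i. s i x) \<longlonglongrightarrow> u x" and bd: "\<And>i x. \<bar>s i x\<bar> \<le> 2 * \<bar>u x\<bar>"
  shows "L1_cont u"
proof (rule L1_cont_approx[OF u])
  fix e :: real assume "e > 0"
  have "(\<lambda>i. LINT x|lborel. \<bar>s i x - u x\<bar>) \<longlonglongrightarrow> (LINT x|(lborel :: (real^'a) measure). (0::real))"
  proof (rule integral_dominated_convergence[where w="\<lambda>x. 3 * \<bar>u x\<bar>"])
    show "AE x in lborel. (\<lambda>i. \<bar>s i x - u x\<bar>) \<longlonglongrightarrow> 0"
      by (intro AE_I2 tendsto_rabs_zero) (use lim in \<open>simp add: LIM_zero_iff\<close>)
    show "AE x in lborel. norm \<bar>s i x - u x\<bar> \<le> 3 * \<bar>u x\<bar>" for i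
    proof (rule AE_I2)
      fix x show "norm \<bar>s i x - u x\<bar> \<le> 3 * \<bar>u x\<bar>"
        using bd[of i x] abs_triangle_ineq4[of "s i x" "u x"] by simp
    qed
  qed (use s u in auto)
  then have "eventually (\<lambda>i. (LINT x|lborel. \<bar>s i x - u x\<bar>) < e) sequentially"
    using \<open>e > 0\<close> by (simp add: order_tendstoD)
  then show "\<exists>v. integrable lborel v \<and> L1_cont v \<and> (LINT x|lborel. \<bar>v x - u x\<bar>) < e"
    using s by (auto simp: eventually_sequentially)
qed

text \<open>Regularity of the measure puts \<open>A\<close> between a compact \<open>K\<close> and
  an open \<open>U\<close> with little measure in between. For \<open>z\<close> shorter than the
  distance from \<open>K\<close> to the complement of \<open>U\<close>, the indicator can change
  only if \<open>x\<close> or \<open>x - z\<close> lies in this thin difference.\<close>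

lemma L1_cont_indicator_bounded:
  fixes A :: "(real ^ 'd) set"
  assumes A: "A \<in> sets borel" "bounded A"
  shows "L1_cont (indicator A)"
  unfolding L1_cont_def
proof (intro allI impI)
  fix e :: real assume "e > 0"
  \<comment> \<open>The final estimate is four integrals of \<open>?g\<close>, each below 2 e',
    hence 8 e', which is less than \<open>e\<close>.\<close>
  define e' where "e' = e / 9"
  have e': "e' > 0" using \<open>e > 0\<close> by (simp add: e'_def)
  have Al: "A \<in> sets lebesgue" using A by (simp add: sets_completionI_sets)
  obtain U where U: "open U" "A \<subseteq> U" "U - A \<in> lmeasurable" "emeasure lebesgue (U - A) < ennreal e'"
    using sets_lebesgue_outer_open[OF Al e'] by blast
  obtain K where K: "closed K" "K \<subseteq> A" "A - K \<in> lmeasurable" "emeasure lebesgue (A - K) < ennreal e'"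
    using sets_lebesgue_inner_closed[OF Al e'] by blast
  have cK: "compact K" using K A(2) bounded_subset compact_eq_bounded_closed by blast
  then obtain d where d: "d > 0" "\<And>x y. x \<in> K \<Longrightarrow> y \<notin> U \<Longrightarrow> d \<le> dist x y"
    using separate_compact_closed[of K "- U"] U K by (metis (no_types, lifting) ComplI closed_Compl disjoint_eq_subset_Compl dual_order.trans double_complement)
  have sb: "U - A \<in> sets borel" "A - K \<in> sets borel" using U(1) K(1) A by auto
  have i1: "integrable lborel (indicator (U - A) :: _ \<Rightarrow> real)" and i2: "integrable lborel (indicator (A - K) :: _ \<Rightarrow> real)"
    using U(3,4) K(3,4) sb by (auto intro!: integrable_real_indicator simp: emeasure_completion less_top[symmetric] dest: order_less_trans)
  have v1: "(LINT x|lborel. indicator (U - A) x :: real) < e'" "(LINT x|lborel. indicator (A - K) x :: real) < e'"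
    using U(4) K(4) sb e' i1 i2
    by (simp_all add: emeasure_completion emeasure_eq_ennreal_measure integrable_indicator_iff ennreal_less_iff top.not_eq_extremum)
  show "\<exists>d>0. \<forall>z. norm z < d \<longrightarrow> (LINT x|lborel. \<bar>indicator A (x - z) - indicator A x :: real\<bar>) < e"
  proof (intro exI conjI allI impI)
    fix z :: "real^'d" assume z: "norm z < d"
    let ?g = "\<lambda>x. indicator (U - A) x + indicator (A - K) x :: real"
    have ig: "integrable lborel ?g" using i1 i2 by auto
    have pt: "\<bar>indicator A (x - z) - indicator A x :: real\<bar> \<le> 2 * ?g x + 2 * ?g (x - z)" for x
    proof -
      have "x \<in> U" if "x - z \<in> K" using d(2)[OF that, of x] z by (force simp: dist_norm)
      moreover have "x - z \<in> U" if "x \<in> K" using d(2)[OF that, of "x - z"] z by (force simp: dist_norm)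
      ultimately show ?thesis using U(2) K(2) by (auto simp: indicator_def)
    qed
    have isf: "integrable lborel (\<lambda>x. ?g (x - z))" using lborel_shift(1)[OF ig] .
    have ig2: "integrable lborel (\<lambda>x. 2 * ?g x)" "integrable lborel (\<lambda>x. 2 * ?g (x - z))"
      by (rule integrable_mult_right[OF ig] integrable_mult_right[OF isf])+
    have "(LINT x|lborel. \<bar>indicator A (x - z) - indicator A x :: real\<bar>) \<le> (LINT x|lborel. 2 * ?g x + 2 * ?g (x - z))"
      by (rule integral_mono'[OF Bochner_Integration.integrable_add[OF ig2] pt]) simp
    also have "\<dots> = 2 * (LINT x|lborel. ?g x) + 2 * (LINT x|lborel. ?g (x - z))"
      unfolding Bochner_Integration.integral_add[OF ig2] integral_mult_right_zero ..
    also have "(LINT x|lborel. ?g (x - z)) = (LINT x|lborel. ?g x)"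
      by (rule lborel_shift(2)) (use borel_measurable_integrable[OF ig] in simp)
    also have "(LINT x|lborel. ?g x) < 2 * e'" using v1 i1 i2 by (subst Bochner_Integration.integral_add) auto
    finally show "(LINT x|lborel. \<bar>indicator A (x - z) - indicator A x :: real\<bar>) < e" using e' by (simp add: e'_def)
  qed (use d in auto)
qed

lemma L1_cont_scale: assumes "L1_cont u" shows "L1_cont (\<lambda>x. u x * c)"
  unfolding L1_cont_def
proof (intro allI impI)
  fix e :: real assume e: "e > 0"
  have e1: "e / (\<bar>c\<bar> + 1) > 0" using e by (simp add: add_nonneg_pos)
  then obtain d where d: "d > 0" "\<And>z. norm z < d \<Longrightarrow> (LINT x|lborel. \<bar>u (x - z) - u x\<bar>) < e / (\<bar>c\<bar> + 1)"
    using assms unfolding L1_cont_def by blast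
  have "(LINT x|lborel. \<bar>u (x - z) * c - u x * c\<bar>) < e" if "norm z < d" for z
  proof -
    have "\<bar>u (x - z) * c - u x * c\<bar> = \<bar>u (x - z) - u x\<bar> * \<bar>c\<bar>" for x
      unfolding abs_mult[symmetric] left_diff_distrib ..
    then have "(LINT x|lborel. \<bar>u (x - z) * c - u x * c\<bar>) = (LINT x|lborel. \<bar>u (x - z) - u x\<bar>) * \<bar>c\<bar>"
      by simp
    also have "\<dots> \<le> (e / (\<bar>c\<bar> + 1)) * \<bar>c\<bar>" using d(2)[OF that] by (intro mult_right_mono) auto
    also have "\<dots> < e" using e by (simp add: divide_less_eq)
    finally show ?thesis .
  qed
  then show "\<exists>d>0. \<forall>z. norm z < d \<longrightarrow> (LINT x|lborel. \<bar>u (x - z) * c - u x * c\<bar>) < e" using d(1) by blast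
qed

text \<open>Measure induction. The sets of the base case have finite measure but may be unbounded,
  so they are first cut off by balls of integer radius.\<close>

lemma L1_cont_integrable:
  fixes u :: "real ^ 'd \<Rightarrow> real"
  assumes "integrable lborel u" shows "L1_cont u"
  using assms
proof (induction rule: integrable_induct)
  case (base A c)
  have l: "L1_cont (\<lambda>x. indicator (A \<inter> cball 0 (real i)) x * c)" for i
    using base by (intro L1_cont_scale L1_cont_indicator_bounded) auto
  have ii: "integrable lborel (\<lambda>x. indicator (A \<inter> cball 0 (real i)) x * c)" for i
    using base by (intro integrable_mult_left integrable_real_indicator) (auto intro: le_less_trans[OF emeasure_mono])
  have "L1_cont (\<lambda>x. indicator A x * c)"
  proof (rule L1_cont_limit[where s="\<lambda>i x. indicator (A \<inter> cball 0 (real i)) x * c", OF ii l])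
    show "integrable lborel (\<lambda>x. indicator A x * c)"
      using base by (intro integrable_mult_left integrable_real_indicator) auto
    show "(\<lambda>i. indicator (A \<inter> cball 0 (real i)) x * c) \<longlonglongrightarrow> indicator A x * c" for x
    proof (rule tendsto_eventually)
      obtain n :: nat where "norm x \<le> real n" using real_arch_simple by blast
      then show "\<forall>\<^sub>F i in sequentially. indicator (A \<inter> cball 0 (real i)) x * c = indicator A x * c"
        unfolding eventually_sequentially by (intro exI[of _ n]) (auto simp: indicator_def)
    qed
  qed (auto simp: indicator_def)
  then show ?case by simp
next
  case (add f g)
  show ?case unfolding L1_cont_def
  proof (intro allI impI)
    fix e :: real assume e: "e > 0"
    obtain d1 where d1: "d1 > 0" "\<And>z. norm z < d1 \<Longrightarrow> (LINT x|lborel. \<bar>f (x - z) - f x\<bar>) < e / 2"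
      using add e unfolding L1_cont_def by (meson half_gt_zero)
    obtain d2 where d2: "d2 > 0" "\<And>z. norm z < d2 \<Longrightarrow> (LINT x|lborel. \<bar>g (x - z) - g x\<bar>) < e / 2"
      using add e unfolding L1_cont_def by (meson half_gt_zero)
    have "(LINT x|lborel. \<bar>f (x - z) + g (x - z) - (f x + g x)\<bar>) < e" if "norm z < min d1 d2" for z
    proof -
      have i: "integrable lborel (\<lambda>x. \<bar>f (x - z) - f x\<bar>)" "integrable lborel (\<lambda>x. \<bar>g (x - z) - g x\<bar>)"
        using add lborel_shift(1)[of f z] lborel_shift(1)[of g z] by auto
      have "(LINT x|lborel. \<bar>f (x - z) + g (x - z) - (f x + g x)\<bar>) \<le> (LINT x|lborel. \<bar>f (x - z) - f x\<bar> + \<bar>g (x - z) - g x\<bar>)"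
        using i by (intro integral_mono') auto
      also have "\<dots> = (LINT x|lborel. \<bar>f (x - z) - f x\<bar>) + (LINT x|lborel. \<bar>g (x - z) - g x\<bar>)"
        using i by (rule Bochner_Integration.integral_add)
      finally show ?thesis using d1(2)[of z] d2(2)[of z] that by auto
    qed
    then show "\<exists>d>0. \<forall>z. norm z < d \<longrightarrow> (LINT x|lborel. \<bar>f (x - z) + g (x - z) - (f x + g x)\<bar>) < e"
      using d1(1) d2(1) by (intro exI[of _ "min d1 d2"]) auto
  qed
next
  case (lim f s)
  then show ?case by (intro L1_cont_limit[of s f]) auto
qed

section \<open>Convergence of mollifications\<close>

lemma lborel_reflect: "distr lborel borel (\<lambda>y. x - y) = (lborel :: (real ^ 'd) measure)"
  by (subst lborel_affine[of "-1" x]) (auto simp: density_1)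

lemma mollifierD:
  assumes "mollifier r \<rho>"
  shows "smooth_c \<rho>" "0 \<le> \<rho> x" "r \<le> norm x \<Longrightarrow> \<rho> x = 0" "(LINT x|lborel. \<rho> x) = 1"
    "integrable lborel \<rho>" "(LINT y|lborel. \<rho> (x - y)) = 1" "integrable lborel (\<lambda>y. \<rho> (x - y))"
    "(\<integral>\<^sup>+x. ennreal (\<rho> x) \<partial>lborel) = 1"
proof -
  show 1: "smooth_c \<rho>" "0 \<le> \<rho> x" "r \<le> norm x \<Longrightarrow> \<rho> x = 0" "(LINT x|lborel. \<rho> x) = 1"
    using assms by (auto simp: mollifier_def)
  show i: "integrable lborel \<rho>" by (rule smooth_c_integrable[OF 1(1)])
  have m: "(\<lambda>y. x - y) \<in> measurable lborel borel" by simp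
  have \<rho>: "\<rho> \<in> borel_measurable borel" by (rule smooth_cD(5)[OF 1(1)])
  show "(LINT y|lborel. \<rho> (x - y)) = 1"
    using integral_distr[OF m \<rho>] by (simp add: lborel_reflect 1)
  show "integrable lborel (\<lambda>y. \<rho> (x - y))"
    using integrable_distr_eq[OF m \<rho>] i by (simp add: lborel_reflect)
  show "(\<integral>\<^sup>+x. ennreal (\<rho> x) \<partial>lborel) = 1"
    using nn_integral_eq_integral[OF i] assms by (simp add: mollifier_def)
qed

text \<open>The error at \<open>x\<close> is the average of u(x - z) - u(x) with respect to the
  kernel in \<open>z\<close>. Exchanging the integrals leaves the \<open>L1\<close> modulus of
  translations at shifts shorter than \<open>r\<close>. Nonnegative integrals make the exchange a
  matter of measurability alone.\<close>

lemma conv_L1_bound: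
  assumes u: "integrable lborel u" and e: "e > 0"
  obtains d where "d > 0"
    "\<And>r \<rho>. mollifier r \<rho> \<Longrightarrow> r \<le> d \<Longrightarrow> (\<integral>\<^sup>+x. ennreal \<bar>conv u \<rho> x - u x\<bar> \<partial>lborel) \<le> ennreal e"
proof -
  obtain d where d: "d > 0" "\<And>z. norm z < d \<Longrightarrow> (LINT x|lborel. \<bar>u (x - z) - u x\<bar>) < e"
    using L1_cont_integrable[OF u] e unfolding L1_cont_def by blast
  have [measurable]: "u \<in> borel_measurable borel" using borel_measurable_integrable[OF u] by simp
  have "(\<integral>\<^sup>+x. ennreal \<bar>conv u \<rho> x - u x\<bar> \<partial>lborel) \<le> ennreal e" if \<rho>: "mollifier r \<rho>" and r: "r \<le> d" for r \<rho>
  proof -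
    note m = mollifierD[OF \<rho>]
    have [measurable]: "\<rho> \<in> borel_measurable borel" by (rule smooth_cD(5)[OF m(1)])
    have "ennreal \<bar>conv u \<rho> x - u x\<bar> \<le> (\<integral>\<^sup>+z. ennreal (\<bar>u (x - z) - u x\<bar> * \<rho> z) \<partial>lborel)" for x
    proof -
      have i: "integrable lborel (\<lambda>y. (u y - u x) * \<rho> (x - y))"
        using conv_integrable[OF u m(1), of x] m(7)[of x] by (simp add: left_diff_distrib)
      have "conv u \<rho> x - u x = (LINT y|lborel. u y * \<rho> (x - y)) - (LINT y|lborel. u x * \<rho> (x - y))"
        using m(6)[of x] by (simp add: conv_def)
      also have "\<dots> = (LINT y|lborel. (u y - u x) * \<rho> (x - y))"
        using conv_integrable[OF u m(1), of x] m(7)[of x]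
        by (subst Bochner_Integration.integral_diff[symmetric]) (auto simp: left_diff_distrib)
      finally have "ennreal \<bar>conv u \<rho> x - u x\<bar> \<le> (\<integral>\<^sup>+y. ennreal \<bar>(u y - u x) * \<rho> (x - y)\<bar> \<partial>lborel)"
        using integral_norm_bound_ennreal[OF i] by simp
      also have "\<dots> = (\<integral>\<^sup>+y. ennreal \<bar>(u y - u x) * \<rho> (x - y)\<bar> \<partial>distr lborel borel (\<lambda>z. x - z))"
        by (simp add: lborel_reflect)
      also have "\<dots> = (\<integral>\<^sup>+z. ennreal (\<bar>u (x - z) - u x\<bar> * \<rho> z) \<partial>lborel)"
        by (subst nn_integral_distr) (use m(2) in \<open>auto simp: abs_mult\<close>)
      finally show ?thesis .
    qed
    then have "(\<integral>\<^sup>+x. ennreal \<bar>conv u \<rho> x - u x\<bar> \<partial>lborel) \<le> (\<integral>\<^sup>+x. (\<integral>\<^sup>+z. ennreal (\<bar>u (x - z) - u x\<bar> * \<rho> z) \<partial>lborel) \<partial>lborel)"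
      by (intro nn_integral_mono) auto
    also have "\<dots> = (\<integral>\<^sup>+z. (\<integral>\<^sup>+x. ennreal (\<bar>u (x - z) - u x\<bar> * \<rho> z) \<partial>lborel) \<partial>lborel)"
      by (rule lborel_pair.Fubini'[symmetric]) measurable
    also have "\<dots> \<le> (\<integral>\<^sup>+z. ennreal e * ennreal (\<rho> z) \<partial>lborel)"
    proof (intro nn_integral_mono)
      fix z :: "real^'a"
      show "(\<integral>\<^sup>+x. ennreal (\<bar>u (x - z) - u x\<bar> * \<rho> z) \<partial>lborel) \<le> ennreal e * ennreal (\<rho> z)"
      proof (cases "norm z < r")
        case True
        have "integrable lborel (\<lambda>x. \<bar>u (x - z) - u x\<bar>)" using u lborel_shift(1)[OF u] by auto
        then have "(\<integral>\<^sup>+x. ennreal \<bar>u (x - z) - u x\<bar> \<partial>lborel) = ennreal (LINT x|lborel. \<bar>u (x - z) - u x\<bar>)"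
          by (rule nn_integral_eq_integral) auto
        also have "\<dots> \<le> ennreal e" using d(2)[of z] True r by (intro ennreal_leI) auto
        finally have *: "(\<integral>\<^sup>+x. ennreal \<bar>u (x - z) - u x\<bar> \<partial>lborel) \<le> ennreal e" .
        have "(\<integral>\<^sup>+x. ennreal (\<bar>u (x - z) - u x\<bar> * \<rho> z) \<partial>lborel) = (\<integral>\<^sup>+x. ennreal \<bar>u (x - z) - u x\<bar> \<partial>lborel) * ennreal (\<rho> z)"
          by (subst nn_integral_multc[symmetric]) (auto simp: ennreal_mult m(2))
        then show ?thesis using * by (simp add: mult_right_mono)
      qed (use m(3)[of z] in auto)
    qed
    also have "\<dots> = ennreal e" using m(8) by (simp add: nn_integral_cmult)
    finally show ?thesis .
  qed
  then show thesis using that d(1) by blast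
qed

definition mol :: "nat \<Rightarrow> real ^ 'd \<Rightarrow> real" where
  "mol k = (SOME \<rho>. mollifier (1 / real (Suc k)) \<rho>)"

lemma mol: "mollifier (1 / real (Suc k)) (mol k :: real ^ 'a \<Rightarrow> real)"
proof -
  obtain \<rho> :: "real^'a \<Rightarrow> real" where "mollifier (1 / real (Suc k)) \<rho>"
    using mollifier_exists[of "1 / real (Suc k)"] by auto
  then show ?thesis unfolding mol_def by (rule someI[of "mollifier (1 / real (Suc k))"])
qed

lemma smooth_c_mol: "smooth_c (mol k)" using mollifierD(1)[OF mol] .

lemma conv_mol_L1:
  assumes u: "integrable lborel u"
  shows "(\<lambda>k. \<integral>\<^sup>+x. ennreal \<bar>conv u (mol k) x - u x\<bar> \<partial>lborel) \<longlonglongrightarrow> 0"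
proof (rule tendsto_zero_ennreal)
  fix e' :: real assume "e' > 0"
  define e where "e = e' / 2"
  have e: "e > 0" "ennreal e < ennreal e'" using \<open>e' > 0\<close> by (auto simp: e_def intro: ennreal_lessI)
  then obtain d where d: "d > 0"
    "\<And>r \<rho>. mollifier r \<rho> \<Longrightarrow> r \<le> d \<Longrightarrow> (\<integral>\<^sup>+x. ennreal \<bar>conv u \<rho> x - u x\<bar> \<partial>lborel) \<le> ennreal e"
    using conv_L1_bound[OF u] by metis
  obtain N where N: "1 / real (Suc N) < d" using d(1) nat_approx_posE by metis
  have "1 / real (Suc k) \<le> d" if "k \<ge> N" for k
    using N that by (meson frac_le le_trans less_imp_le of_nat_0_less_iff of_nat_le_iff order.trans Suc_le_mono zero_less_Suc zero_le_one order_refl)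
  then have "(\<integral>\<^sup>+x. ennreal \<bar>conv u (mol k) x - u x\<bar> \<partial>lborel) < ennreal e'" if "k \<ge> N" for k
    using d(2)[OF mol] e(2) that le_less_trans by blast
  then show "\<forall>\<^sub>F k in sequentially. (\<integral>\<^sup>+x. ennreal \<bar>conv u (mol k) x - u x\<bar> \<partial>lborel) < ennreal e'"
    unfolding eventually_sequentially by blast
qed

lemma conv_measurable [measurable]: "integrable lborel u \<Longrightarrow> conv u (mol k) \<in> borel_measurable borel"
  by (intro borel_measurable_continuous_onI Ck_imp_continuous[OF Ck_conv[of u "mol k" 0]] smooth_c_mol)

text \<open>One subsequence for two functions, extracted from the sum of both errors: the product
  rule mollifies a function and a component of its gradient at the same radii.\<close>

lemma conv_mol_AE_subseq:
  fixes u v :: "real ^ 'd \<Rightarrow> real"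
  assumes u: "integrable lborel u" and v: "integrable lborel v"
  obtains s :: "nat \<Rightarrow> nat" where "strict_mono s"
    "AE x in lborel. (\<lambda>k. conv u (mol (s k)) x) \<longlonglongrightarrow> u x"
    "AE x in lborel. (\<lambda>k. conv v (mol (s k)) x) \<longlonglongrightarrow> v x"
proof -
  have [measurable]: "u \<in> borel_measurable borel" "v \<in> borel_measurable borel"
    using borel_measurable_integrable[OF u] borel_measurable_integrable[OF v] by simp_all
  define g where "g k x = \<bar>conv u (mol k) x - u x\<bar> + \<bar>conv v (mol k) x - v x\<bar>" for k x
  have gm [measurable]: "g k \<in> borel_measurable lborel" for k unfolding g_def using u v by measurable
  have nn: "(\<integral>\<^sup>+x. norm (g k x) \<partial>lborel) = (\<integral>\<^sup>+x. ennreal \<bar>conv u (mol k) x - u x\<bar> \<partial>lborel) + (\<integral>\<^sup>+x. ennreal \<bar>conv v (mol k) x - v x\<bar> \<partial>lborel)" for k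
    unfolding g_def using u v by (subst nn_integral_add[symmetric]) (auto simp: ennreal_plus)
  have lim: "(\<lambda>k. \<integral>\<^sup>+x. norm (g k x) \<partial>lborel) \<longlonglongrightarrow> 0"
    unfolding nn using tendsto_add[OF conv_mol_L1[OF u] conv_mol_L1[OF v]] by simp
  have g0: "0 \<le> g k x" for k x by (simp add: g_def)
  \<comment> \<open>Extraction of the subsequence works with integrable functions; the integral of
    \<open>g k\<close> is known to be finite only from some index on, hence the shift by
    \<open>N\<close>.\<close>
  obtain N where N: "\<And>k. k \<ge> N \<Longrightarrow> (\<integral>\<^sup>+x. norm (g k x) \<partial>lborel) < 1"
    using order_tendstoD(2)[OF lim, of 1] unfolding eventually_sequentially by auto
  have gi: "integrable lborel (g (n + N))" for n
    using N[of "n + N"] gm unfolding integrable_iff_bounded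
    by (auto intro: less_trans simp: less_top)
  have "(\<lambda>n. \<integral>\<^sup>+x. norm (g (n + N) x) \<partial>lborel) \<longlonglongrightarrow> 0" using LIMSEQ_ignore_initial_segment[OF lim] .
  then have "(\<lambda>n. ennreal (LINT x|lborel. norm (g (n + N) x))) \<longlonglongrightarrow> 0"
    using nn_integral_eq_integral[OF integrable_norm[OF gi]] by simp
  then have "(\<lambda>n. (LINT x|lborel. norm (g (n + N) x))) \<longlonglongrightarrow> 0"
    by (subst (asm) ennreal_tendsto_0_iff) auto
  from tendsto_L1_AE_subseq[OF gi this] obtain q
    where q: "strict_mono q" "AE x in lborel. (\<lambda>n. g (q n + N) x) \<longlonglongrightarrow> 0" by metis
  define r where "r n = q n + N" for n
  have r: "strict_mono r" "AE x in lborel. (\<lambda>n. g (r n) x) \<longlonglongrightarrow> 0"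
    using q by (auto simp: r_def strict_mono_def)
  have *: "(\<lambda>n. conv u (mol (r n)) x) \<longlonglongrightarrow> u x" "(\<lambda>n. conv v (mol (r n)) x) \<longlonglongrightarrow> v x"
    if "(\<lambda>n. g (r n) x) \<longlonglongrightarrow> 0" for x
  proof -
    have "(\<lambda>n. conv u (mol (r n)) x - u x) \<longlonglongrightarrow> 0"
      by (rule Lim_null_comparison[OF _ that]) (simp add: g_def)
    then show "(\<lambda>n. conv u (mol (r n)) x) \<longlonglongrightarrow> u x" by (simp add: LIM_zero_iff)
    have "(\<lambda>n. conv v (mol (r n)) x - v x) \<longlonglongrightarrow> 0"
      by (rule Lim_null_comparison[OF _ that]) (simp add: g_def)
    then show "(\<lambda>n. conv v (mol (r n)) x) \<longlonglongrightarrow> v x" by (simp add: LIM_zero_iff)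
  qed
  show thesis
    by (rule that[OF r(1)]) (use r(2) * in \<open>auto elim!: eventually_mono\<close>)
qed

section \<open>Testing locally integrable functions\<close>

lemma sets_leb_open [simp]: "open S \<Longrightarrow> S \<in> sets lebesgue"
  by (simp add: sets_completionI_sets borel_open)

lemma sets_leb_compact [simp]: "compact S \<Longrightarrow> S \<in> sets lebesgue"
  by (simp add: sets_completionI_sets borel_compact)

lemma AE_leb_on: "S \<in> sets lebesgue \<Longrightarrow> (AE x in lebesgue_on S. P x) \<longleftrightarrow> (AE x in lebesgue. x \<in> S \<longrightarrow> P x)"
  by (subst AE_restrict_space_iff) auto

lemma AE_leb_on_mono:
  "AE x in lebesgue_on S. P x \<Longrightarrow> T \<subseteq> S \<Longrightarrow> S \<in> sets lebesgue \<Longrightarrow> T \<in> sets lebesgue \<Longrightarrow> AE x in lebesgue_on T. P x"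
  by (auto simp: AE_leb_on elim!: eventually_mono)

lemma measurable_leb_on_mono:
  "f \<in> borel_measurable (lebesgue_on S) \<Longrightarrow> T \<subseteq> S \<Longrightarrow> f \<in> borel_measurable (lebesgue_on T)"
  by (rule measurable_restrict_mono)

lemma measurable_leb_on_AE:
  fixes f g :: "'a::euclidean_space \<Rightarrow> 'b::euclidean_space"
  assumes "f \<in> borel_measurable (lebesgue_on S)" "AE x in lebesgue_on S. f x = g x" "S \<in> sets lebesgue"
  shows "g \<in> borel_measurable (lebesgue_on S)"
proof -
  have "(\<lambda>x. if x \<in> S then f x else 0) \<in> borel_measurable lebesgue"
    using assms borel_measurable_if by blast
  moreover have "AE x in lebesgue. (if x \<in> S then f x else 0) = (if x \<in> S then g x else 0)"
    using assms by (auto simp: AE_leb_on elim!: eventually_mono)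
  ultimately have "(\<lambda>x. if x \<in> S then g x else 0) \<in> borel_measurable lebesgue"
    by (rule borel_measurable_AE)
  then show ?thesis using assms borel_measurable_if by blast
qed

lemma integrable_leb_on_AE:
  fixes f g :: "'a::euclidean_space \<Rightarrow> 'b::euclidean_space"
  assumes "integrable (lebesgue_on S) f" "AE x in lebesgue_on S. f x = g x" "S \<in> sets lebesgue"
  shows "integrable (lebesgue_on S) g"
  using integrable_cong_AE_imp[OF assms(1) measurable_leb_on_AE[OF borel_measurable_integrable[OF assms(1)] assms(2,3)]]
    assms(2) by (simp add: eq_commute)

lemma integrable_leb_on_mono:
  fixes f :: "'a::euclidean_space \<Rightarrow> 'b::euclidean_space"
  assumes "integrable (lebesgue_on S) f" "T \<subseteq> S" "S \<in> sets lebesgue" "T \<in> sets lebesgue"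
  shows "integrable (lebesgue_on T) f"
proof -
  have "integrable lebesgue (\<lambda>x. indicator S x *\<^sub>R f x)"
    using assms by (subst integrable_restrict_space[symmetric]) auto
  then have "integrable lebesgue (\<lambda>x. indicator T x *\<^sub>R (indicator S x *\<^sub>R f x))"
    by (rule integrable_mult_indicator[OF assms(4)])
  also have "(\<lambda>x. indicator T x *\<^sub>R (indicator S x *\<^sub>R f x)) = (\<lambda>x. indicator T x *\<^sub>R f x)"
    using assms by (auto simp: indicator_def fun_eq_iff)
  finally show ?thesis using assms by (subst integrable_restrict_space) auto
qed

lemma leb_on_support:
  fixes f :: "'a::euclidean_space \<Rightarrow> 'b::euclidean_space"
  assumes "T \<subseteq> S" "S \<in> sets lebesgue" "T \<in> sets lebesgue" "\<And>x. x \<in> S \<Longrightarrow> x \<notin> T \<Longrightarrow> f x = 0"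
  shows "(LINT x|lebesgue_on S. f x) = (LINT x|lebesgue_on T. f x)"
    and "integrable (lebesgue_on S) f \<longleftrightarrow> integrable (lebesgue_on T) f"
proof -
  have *: "(\<lambda>x. indicator S x *\<^sub>R f x) = (\<lambda>x. indicator T x *\<^sub>R f x)"
    using assms by (auto simp: indicator_def fun_eq_iff)
  show "(LINT x|lebesgue_on S. f x) = (LINT x|lebesgue_on T. f x)"
    "integrable (lebesgue_on S) f \<longleftrightarrow> integrable (lebesgue_on T) f"
    using assms(2,3) by (simp_all only: integral_restrict_space integrable_restrict_space * space_completion space_lborel space_borel Int_UNIV_right)
qed

lemma open_countable_compact:
  fixes D :: "'a::euclidean_space set"
  assumes "open D" obtains C where "countable C" "\<And>K. K \<in> C \<Longrightarrow> compact K \<and> K \<subseteq> D" "\<Union>C = D"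
proof -
  obtain C where "countable C" "C \<subseteq> Pow D" "\<And>X. X \<in> C \<Longrightarrow> \<exists>a b. X = cbox a b" "\<Union>C = D"
    using open_countable_Union_open_cbox[OF assms] by metis
  then show thesis by (intro that[of C]) (auto intro: compact_cbox)
qed

text \<open>Local integrability speaks of compact subsets only; an open set is a countable union of
  closed boxes, over which measurability is glued.\<close>

lemma locally_integrable_measurable:
  assumes "open D" "locally_integrable D u"
  shows "u \<in> borel_measurable (lebesgue_on D)"
proof -
  obtain C where C: "countable C" "\<And>K. K \<in> C \<Longrightarrow> compact K \<and> K \<subseteq> D" "\<Union>C = D"
    using open_countable_compact[OF assms(1)] by metis
  show ?thesis
  proof (rule measurable_piecewise_restrict[OF C(1)])
    fix K assume "K \<in> C"
    then have K: "compact K" "K \<subseteq> D" using C(2) by auto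
    show "K \<inter> space (lebesgue_on D) \<in> sets (lebesgue_on D)"
      using K assms(1) by (simp add: sets_restrict_space_iff Int_absorb2)
    have "u \<in> borel_measurable (lebesgue_on K)"
      using K assms(2) unfolding locally_integrable_def by auto
    then show "u \<in> borel_measurable (restrict_space (lebesgue_on D) K)"
      using K assms(1) by (simp add: restrict_restrict_space Int_absorb1 Int_absorb2)
  qed (use C in auto)
qed

lemma locally_integrable_subset:
  "locally_integrable D u \<Longrightarrow> D' \<subseteq> D \<Longrightarrow> locally_integrable D' u"
  unfolding locally_integrable_def by blast

lemma locally_integrableI:
  assumes "integrable (lebesgue_on D) u" "open D" shows "locally_integrable D u"
  using assms integrable_leb_on_mono sets_leb_compact sets_leb_open unfolding locally_integrable_def by blast

lemma locally_integrable_AE: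
  fixes u :: "real ^ 'd \<Rightarrow> 'b::euclidean_space"
  assumes "locally_integrable D u" "AE x in lebesgue_on D. u x = v x" "open D"
  shows "locally_integrable D v"
  unfolding locally_integrable_def
proof (intro allI impI)
  fix K assume K: "compact K \<and> K \<subseteq> D"
  show "integrable (lebesgue_on K) v"
    by (rule integrable_leb_on_AE[of K u])
      (use K assms AE_leb_on_mono[OF assms(2), of K] in \<open>auto simp: locally_integrable_def\<close>)
qed

lemma bounded_mult_integrable:
  fixes u :: "'a \<Rightarrow> 'b::{banach, second_countable_topology}" and a :: "'a \<Rightarrow> real"
  assumes "integrable M u" "a \<in> borel_measurable M" "AE x in M. \<bar>a x\<bar> \<le> B"
  shows "integrable M (\<lambda>x. a x *\<^sub>R u x)"
proof (rule Bochner_Integration.integrable_bound[of _ "\<lambda>x. B *\<^sub>R norm (u x)"])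
  show "AE x in M. norm (a x *\<^sub>R u x) \<le> norm (B *\<^sub>R norm (u x))"
    using assms(3) by eventually_elim (auto intro!: mult_right_mono order_trans[OF _ abs_ge_self])
qed (use assms in auto)

lemma test_functionsI:
  assumes "smooth_c \<phi>" "K \<subseteq> D" "closed K" "\<And>x. \<phi> x \<noteq> 0 \<Longrightarrow> x \<in> K"
  shows "\<phi> \<in> test_functions D"
proof -
  have "closure {x. \<phi> x \<noteq> 0} \<subseteq> K" using assms by (intro closure_minimal) auto
  then show ?thesis using assms by (auto simp: test_functions_def smooth_c_def compact_closure)
qed

lemma test_functionsD:
  assumes "\<phi> \<in> test_functions D"
  shows "smooth_c \<phi>"
    and "\<exists>K. compact K \<and> K \<subseteq> D \<and> (\<forall>x. x \<notin> K \<longrightarrow> \<phi> x = 0 \<and> (\<forall>j. pderiv_at j \<phi> x = 0))"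
proof -
  show s: "smooth_c \<phi>"
    using assms compact_closure[of "{x. \<phi> x \<noteq> 0}"] unfolding test_functions_def smooth_c_def by blast
  show "\<exists>K. compact K \<and> K \<subseteq> D \<and> (\<forall>x. x \<notin> K \<longrightarrow> \<phi> x = 0 \<and> (\<forall>j. pderiv_at j \<phi> x = 0))"
  proof (intro exI conjI allI impI)
    show "compact (closure {x. \<phi> x \<noteq> 0})" "closure {x. \<phi> x \<noteq> 0} \<subseteq> D"
      using assms by (auto simp: test_functions_def)
    fix x assume x: "x \<notin> closure {x. \<phi> x \<noteq> 0}"
    then show "\<phi> x = 0" using closure_subset[of "{x. \<phi> x \<noteq> 0}"] by auto
    show "pderiv_at j \<phi> x = 0" for j
      by (rule pderiv_outside_support[OF x])
  qed
qed

lemma lint_test: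
  fixes u :: "real ^ 'd \<Rightarrow> real"
  assumes "locally_integrable D u" "open D" "smooth_c \<phi>" "compact K" "K \<subseteq> D" "\<And>x. x \<notin> K \<Longrightarrow> \<phi> x = 0"
  shows "integrable (lebesgue_on D) (\<lambda>x. u x * \<phi> x)"
    "(LINT x|lebesgue_on D. u x * \<phi> x) = (LINT x|lebesgue_on K. u x * \<phi> x)"
proof -
  obtain B where B: "\<And>x. \<bar>\<phi> x\<bar> \<le> B" using smooth_c_bounded[OF assms(3)] by blast
  have "\<phi> \<in> borel_measurable (lebesgue_on K)"
    using smooth_cD(5)[OF assms(3)] by (intro measurable_restrict_space1 measurable_completion) simp
  then have "integrable (lebesgue_on K) (\<lambda>x. \<phi> x *\<^sub>R u x)"
    using assms B by (intro bounded_mult_integrable[of _ _ _ B]) (auto simp: locally_integrable_def)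
  then have i: "integrable (lebesgue_on K) (\<lambda>x. u x * \<phi> x)" by (simp add: mult.commute)
  show "integrable (lebesgue_on D) (\<lambda>x. u x * \<phi> x)"
    "(LINT x|lebesgue_on D. u x * \<phi> x) = (LINT x|lebesgue_on K. u x * \<phi> x)"
    using leb_on_support[of K D "\<lambda>x. u x * \<phi> x"] i assms by simp_all
qed

text \<open>A bridge between two settings: convolutions are integrals over \<open>lborel\<close> of
  total functions, while Sobolev functions live on \<open>lebesgue_on S\<close>. The extension by
  zero is modified on a null set to become Borel; the last clause moves integrals against a kernel
  from one side to the other.\<close>

lemma borel_rep:
  fixes a :: "real ^ 'd \<Rightarrow> real"
  assumes a: "integrable (lebesgue_on S) a" and S: "S \<in> sets borel"
  obtains a' where "integrable lborel a'" "\<And>x. x \<notin> S \<Longrightarrow> a' x = 0" "AE x in lebesgue_on S. a x = a' x"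
    "\<And>g. g \<in> borel_measurable borel \<Longrightarrow> (LINT x|lborel. a' x * g x) = (LINT x|lebesgue_on S. a x * g x)"
proof -
  have Sl: "S \<in> sets lebesgue" using S by (simp add: sets_completionI_sets)
  have "integrable lebesgue (\<lambda>x. indicator S x *\<^sub>R a x)"
    using a Sl by (subst integrable_restrict_space[symmetric]) auto
  then have ai: "integrable lebesgue (\<lambda>x. indicator S x * a x)" by simp
  obtain a0 where a0: "a0 \<in> borel_measurable lborel" "AE x in lborel. indicator S x * a x = a0 x"
    using completion_ex_borel_measurable_real[OF borel_measurable_integrable[OF ai]] by blast
  define a' where "a' x = indicator S x * a0 x" for x
  have m: "a' \<in> borel_measurable borel" unfolding a'_def using a0 S by simp
  have ae: "AE x in lebesgue. indicator S x * a x = a' x"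
    using AE_completion[OF a0(2)] unfolding a'_def by eventually_elim (auto simp: indicator_def split: if_splits)
  have ml: "a' \<in> borel_measurable lebesgue" using m by (simp add: measurable_completion)
  have il: "integrable lebesgue a'" using integrable_cong_AE_imp[OF ai ml] ae by auto
  show thesis
  proof (rule that[of a'])
    show "integrable lborel a'" using il m integrable_completion[of a' lborel] by simp
    show "a' x = 0" if "x \<notin> S" for x using that by (simp add: a'_def)
    show "AE x in lebesgue_on S. a x = a' x"
      using ae unfolding AE_leb_on[OF Sl] by eventually_elim auto
    show "(LINT x|lborel. a' x * g x) = (LINT x|lebesgue_on S. a x * g x)" if g: "g \<in> borel_measurable borel" for g
    proof -
      have gl: "g \<in> borel_measurable lebesgue" using g by (simp add: measurable_completion)
      have "(LINT x|lborel. a' x * g x) = (LINT x|lebesgue. a' x * g x)"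
        using m g by (intro integral_completion[symmetric]) simp
      also have "\<dots> = (LINT x|lebesgue. indicator S x *\<^sub>R (a x * g x))"
      proof (rule integral_cong_AE)
        show "AE x in lebesgue. a' x * g x = indicator S x *\<^sub>R (a x * g x)"
          using ae by eventually_elim (auto simp: indicator_def split: if_splits)
        have "(\<lambda>x. (indicator S x * a x) * g x) \<in> borel_measurable lebesgue"
          by (rule borel_measurable_times[OF borel_measurable_integrable[OF ai] gl])
        then show "(\<lambda>x. indicator S x *\<^sub>R (a x * g x)) \<in> borel_measurable lebesgue" by (simp add: mult.assoc)
      qed (use ml gl in simp)
      finally show ?thesis using Sl by (simp add: integral_restrict_space)
    qed
  qed
qed

text \<open>For fixed \<open>x\<close> the kernel of a convolution is to be used as a test function
  in the integration variable \<open>y\<close>; differentiating in \<open>y\<close> costs a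
  sign.\<close>

lemma Ck_reflect: "Ck k \<phi> \<Longrightarrow> Ck k (\<lambda>y. \<phi> (x - y))"
  and pderiv_reflect: "\<phi> differentiable (at (x - y)) \<Longrightarrow> pderiv_at j (\<lambda>y. \<phi> (x - y)) y = - pderiv_at j \<phi> (x - y)"
proof -
  have d: "((\<lambda>y. \<phi> (x - y)) has_derivative (\<lambda>h. frechet_derivative \<phi> (at (x - y)) (- h))) (at y)"
    if "\<phi> differentiable (at (x - y))" for \<phi> :: "real^'a \<Rightarrow> real" and y
  proof -
    have 1: "((\<lambda>y. x - y) has_derivative (\<lambda>h. - h)) (at y)" by (auto intro!: derivative_eq_intros)
    show ?thesis
      by (rule has_derivative_compose[OF 1]) (use that in \<open>simp add: frechet_derivative_works\<close>)
  qed
  have p: "pderiv_at j (\<lambda>y. \<phi> (x - y)) y = - pderiv_at j \<phi> (x - y)"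
    if "\<phi> differentiable (at (x - y))" for \<phi> :: "real^'a \<Rightarrow> real" and y j
    using has_derivative_imp_pderiv[OF d[OF that], of j] linear_neg[OF linear_frechet_derivative[OF that]]
    by (simp add: pderiv_at_def)
  then show "\<phi> differentiable (at (x - y)) \<Longrightarrow> pderiv_at j (\<lambda>y. \<phi> (x - y)) y = - pderiv_at j \<phi> (x - y)" .
  show "Ck k \<phi> \<Longrightarrow> Ck k (\<lambda>y. \<phi> (x - y))"
  proof (induction k arbitrary: \<phi>)
    case 0 then show ?case by (auto intro!: continuous_intros continuous_on_compose2[where g=\<phi> and t=UNIV])
  next
    case (Suc k)
    then have df: "\<phi> differentiable (at z)" for z by simp
    have "pderiv_at j (\<lambda>y. \<phi> (x - y)) = (\<lambda>y. - pderiv_at j \<phi> (x - y))" for j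
      by (rule ext) (rule p[OF df])
    moreover have "Ck k (\<lambda>y. - pderiv_at j \<phi> (x - y))" for j
      using Suc by (intro Ck_minus) auto
    ultimately show ?case using d[OF df] by (auto simp: differentiable_def)
  qed
qed

lemma smooth_c_reflect: "smooth_c \<phi> \<Longrightarrow> smooth_c (\<lambda>y. \<phi> (x - y))"
  unfolding smooth_c_def
proof (intro conjI allI)
  assume a: "(\<forall>k. Ck k \<phi>) \<and> bounded {x. \<phi> x \<noteq> 0}"
  then show "Ck k (\<lambda>y. \<phi> (x - y))" for k by (intro Ck_reflect) auto
  obtain B where B: "\<And>z. \<phi> z \<noteq> 0 \<Longrightarrow> norm z \<le> B" using a unfolding bounded_iff by auto
  show "bounded {y. \<phi> (x - y) \<noteq> 0}"
    unfolding bounded_iff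
  proof (intro exI[of _ "B + norm x"] ballI)
    fix y assume "y \<in> {y. \<phi> (x - y) \<noteq> 0}"
    then have "norm (x - y) \<le> B" using B by auto
    then show "norm y \<le> B + norm x" using norm_triangle_ineq4[of x "x - y"] by simp
  qed
qed

lemma mol_test:
  assumes "cball x r \<subseteq> D" "1 / real (Suc k) \<le> r"
  shows "(\<lambda>y. mol k (x - y)) \<in> test_functions D"
proof (rule test_functionsI[where K="cball x r"])
  show "smooth_c (\<lambda>y. mol k (x - y))" by (rule smooth_c_reflect[OF smooth_c_mol])
  fix y assume "mol k (x - y) \<noteq> 0"
  then show "y \<in> cball x r" using mollifierD(3)[OF mol, of k "x - y"] assms(2) by (force simp: dist_norm)
qed (use assms in auto)

text \<open>Fundamental lemma of the calculus of variations: mollifying \<open>u\<close> at radius \<open>1/k\<close> amounts to testing it.\<close>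

lemma weak_zero:
  fixes u :: "real ^ 'd \<Rightarrow> real"
  assumes D: "open D" and u: "locally_integrable D u"
    and z: "\<And>\<phi>. \<phi> \<in> test_functions D \<Longrightarrow> (LINT x|lebesgue_on D. u x * \<phi> x) = 0"
  shows "AE x in lebesgue_on D. u x = 0"
proof -
  \<comment> \<open>On a ball whose double lies in \<open>D\<close>, every kernel of radius at most
    \<open>r\<close> with centre in the ball is supported in the double, so it is a test function
    and the mollification vanishes identically there.\<close>
  have loc: "AE x in lebesgue. x \<in> ball c r \<longrightarrow> u x = 0" if c: "cball c (2 * r) \<subseteq> D" "r > 0" for c r
  proof -
    let ?K = "cball c (2 * r)"
    have iu: "integrable (lebesgue_on ?K) u" using u c by (auto simp: locally_integrable_def)
    obtain u' where u': "integrable lborel u'" "AE x in lebesgue_on ?K. u x = u' x"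
      "\<And>g. g \<in> borel_measurable borel \<Longrightarrow> (LINT x|lborel. u' x * g x) = (LINT x|lebesgue_on ?K. u x * g x)"
      by (rule borel_rep[OF iu]) auto
    obtain s where s: "strict_mono s" "AE x in lborel. (\<lambda>k. conv u' (mol (s k)) x) \<longlonglongrightarrow> u' x"
      using conv_mol_AE_subseq[OF u'(1) u'(1)] by metis
    obtain N where N: "1 / real (Suc N) < r" using c(2) nat_approx_posE by metis
    have cz: "conv u' (mol (s k)) x = 0" if x: "x \<in> ball c r" and k: "k \<ge> N" for x k
    proof -
      have "N \<le> s k" using k seq_suble[OF s(1), of k] by simp
      then have "1 / real (Suc (s k)) \<le> 1 / real (Suc N)" by (intro frac_le) auto
      then have sk: "1 / real (Suc (s k)) \<le> r" using N by simp
      have sub: "cball x r \<subseteq> ?K"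
      proof
        fix y assume "y \<in> cball x r"
        then show "y \<in> ?K" using x dist_triangle[of c y x] by auto
      qed
      have m: "mol (s k) (x - y) = 0" if "y \<notin> ?K" for y
        using mollifierD(3)[OF mol, of "s k" "x - y"] sk sub that by (force simp: dist_norm)
      have g: "(\<lambda>y. mol (s k) (x - y)) \<in> borel_measurable borel"
        by (rule smooth_cD(5)[OF smooth_c_reflect[OF smooth_c_mol]])
      have "conv u' (mol (s k)) x = (LINT y|lebesgue_on ?K. u y * mol (s k) (x - y))"
        unfolding conv_def by (rule u'(3)[OF g])
      also have "\<dots> = (LINT y|lebesgue_on D. u y * mol (s k) (x - y))"
        using c D m by (intro leb_on_support(1)[symmetric]) auto
      also have "\<dots> = 0" using sub c(1) sk by (intro z mol_test[of x r]) auto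
      finally show ?thesis .
    qed
    have "AE x in lebesgue. x \<in> ?K \<longrightarrow> u x = u' x" using u'(2) by (simp add: AE_leb_on)
    moreover have "AE x in lebesgue. (\<lambda>k. conv u' (mol (s k)) x) \<longlonglongrightarrow> u' x" using AE_completion[OF s(2)] .
    ultimately show ?thesis
    proof eventually_elim
      fix x assume x: "x \<in> ?K \<longrightarrow> u x = u' x" "(\<lambda>k. conv u' (mol (s k)) x) \<longlonglongrightarrow> u' x"
      show "x \<in> ball c r \<longrightarrow> u x = 0"
      proof
        assume xb: "x \<in> ball c r"
        have "(\<lambda>k. conv u' (mol (s k)) x) \<longlonglongrightarrow> 0"
          using cz[OF xb] by (intro tendsto_eventually) (auto simp: eventually_sequentially)
        then have "u' x = 0" using x(2) LIMSEQ_unique by blast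
        then show "u x = 0" using x(1) xb c(2) by auto
      qed
    qed
  qed
  \<comment> \<open>Null sets survive only countable unions, so a countable subcover of these balls
    is selected.\<close>
  define F where "F = {ball c r | c r. cball c (2 * r) \<subseteq> D \<and> r > 0}"
  obtain F' where F': "F' \<subseteq> F" "countable F'" "\<Union>F' = \<Union>F"
    using Lindelof[of F] unfolding F_def by auto
  have cover: "D \<subseteq> \<Union>F"
  proof
    fix x assume "x \<in> D"
    then obtain e where e: "e > 0" "cball x e \<subseteq> D" using D open_contains_cball by blast
    then have "ball x (e / 2) \<in> F" unfolding F_def by (intro CollectI exI[of _ x] exI[of _ "e/2"]) auto
    then show "x \<in> \<Union>F" using e(1) by (intro UnionI[of "ball x (e/2)"]) auto
  qed
  have "AE x in lebesgue. \<forall>B\<in>F'. x \<in> B \<longrightarrow> u x = 0"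
    using F' loc unfolding F_def by (intro AE_ball_countable') auto
  then show ?thesis using cover F' D by (auto simp: AE_leb_on elim!: eventually_mono)
qed

section \<open>Calculus of weak gradients\<close>

lemma is_weak_gradD:
  assumes "is_weak_grad D u g"
  shows "locally_integrable D u" "locally_integrable D g"
    "\<phi> \<in> test_functions D \<Longrightarrow> (LINT x|lebesgue_on D. u x * pderiv_at j \<phi> x) = - (LINT x|lebesgue_on D. g x $ j * \<phi> x)"
  using assms by (auto simp: is_weak_grad_def)

lemma locally_integrable_nth:
  assumes "locally_integrable D g" shows "locally_integrable D (\<lambda>x. g x $ j)"
  using assms integrable_bounded_linear[OF bounded_linear_vec_nth] unfolding locally_integrable_def by blast

lemma test_integrable:
  fixes u :: "real ^ 'd \<Rightarrow> real"
  assumes "locally_integrable D u" "open D" "\<phi> \<in> test_functions D"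
  shows "integrable (lebesgue_on D) (\<lambda>x. u x * \<phi> x)" "integrable (lebesgue_on D) (\<lambda>x. u x * pderiv_at j \<phi> x)"
proof -
  note s = test_functionsD(1)[OF assms(3)]
  obtain K where K: "compact K" "K \<subseteq> D" "\<And>x. x \<notin> K \<Longrightarrow> \<phi> x = 0 \<and> (\<forall>j. pderiv_at j \<phi> x = 0)"
    using test_functionsD(2)[OF assms(3)] by blast
  show "integrable (lebesgue_on D) (\<lambda>x. u x * \<phi> x)" "integrable (lebesgue_on D) (\<lambda>x. u x * pderiv_at j \<phi> x)"
    using lint_test(1)[OF assms(1,2) s K(1,2)] lint_test(1)[OF assms(1,2) smooth_cD(3)[OF s] K(1,2)] K(3) by auto
qed

lemma is_weak_grad_unique:
  assumes D: "open D" and g: "is_weak_grad D u g" and h: "is_weak_grad D u h"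
  shows "AE x in lebesgue_on D. g x = h x"
proof -
  have "AE x in lebesgue_on D. g x $ j - h x $ j = 0" for j
  proof (rule weak_zero[OF D])
    have l: "locally_integrable D (\<lambda>x. g x $ j)" "locally_integrable D (\<lambda>x. h x $ j)"
      using is_weak_gradD(2)[OF g] is_weak_gradD(2)[OF h] by (auto intro: locally_integrable_nth)
    show "locally_integrable D (\<lambda>x. g x $ j - h x $ j)"
      using l unfolding locally_integrable_def by auto
    fix \<phi> assume t: "\<phi> \<in> test_functions D"
    have "(LINT x|lebesgue_on D. (g x $ j - h x $ j) * \<phi> x) =
       (LINT x|lebesgue_on D. g x $ j * \<phi> x) - (LINT x|lebesgue_on D. h x $ j * \<phi> x)"
      unfolding left_diff_distrib by (intro Bochner_Integration.integral_diff test_integrable[OF _ D t] l)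
    then show "(LINT x|lebesgue_on D. (g x $ j - h x $ j) * \<phi> x) = 0"
      using is_weak_gradD(3)[OF g t, of j] is_weak_gradD(3)[OF h t, of j] by simp
  qed
  then have "AE x in lebesgue_on D. \<forall>j\<in>UNIV. g x $ j - h x $ j = 0"
    by (intro AE_ball_countable') auto
  then show ?thesis by eventually_elim (auto simp: vec_eq_iff)
qed

lemma is_weak_grad_AE:
  assumes D: "open D" and g: "is_weak_grad D u g"
    and "AE x in lebesgue_on D. u x = v x" "AE x in lebesgue_on D. g x = h x"
  shows "is_weak_grad D v h"
proof -
  have l: "locally_integrable D v" "locally_integrable D h"
    using assms locally_integrable_AE is_weak_gradD by blast+
  moreover have "(LINT x|lebesgue_on D. v x * pderiv_at j \<phi> x) = - (LINT x|lebesgue_on D. h x $ j * \<phi> x)"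
    if t: "\<phi> \<in> test_functions D" for \<phi> j
  proof -
    note li = locally_integrable_nth[where j=j]
    have "(LINT x|lebesgue_on D. v x * pderiv_at j \<phi> x) = (LINT x|lebesgue_on D. u x * pderiv_at j \<phi> x)"
      using assms(3) by (intro integral_cong_AE borel_measurable_integrable[OF test_integrable(2)] is_weak_gradD(1)[OF g] l D t)
        (auto elim: eventually_mono)
    moreover have "(LINT x|lebesgue_on D. h x $ j * \<phi> x) = (LINT x|lebesgue_on D. g x $ j * \<phi> x)"
      using assms(4) by (intro integral_cong_AE borel_measurable_integrable[OF test_integrable(1)] li is_weak_gradD(2)[OF g] l D t)
        (auto elim: eventually_mono)
    ultimately show ?thesis using is_weak_gradD(3)[OF g t] by simp
  qed
  ultimately show ?thesis by (auto simp: is_weak_grad_def)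
qed

lemma is_weak_grad_subset:
  assumes D: "open D" "open D'" "D' \<subseteq> D" and g: "is_weak_grad D u g"
  shows "is_weak_grad D' u g"
proof -
  have "(LINT x|lebesgue_on D'. u x * pderiv_at j \<phi> x) = - (LINT x|lebesgue_on D'. g x $ j * \<phi> x)"
    if t: "\<phi> \<in> test_functions D'" for \<phi> j
  proof -
    have t': "\<phi> \<in> test_functions D" using t D(3) by (auto simp: test_functions_def)
    obtain K where K: "compact K" "K \<subseteq> D'" "\<And>x. x \<notin> K \<Longrightarrow> \<phi> x = 0 \<and> (\<forall>j. pderiv_at j \<phi> x = 0)"
      using test_functionsD(2)[OF t] by blast
    have "(LINT x|lebesgue_on D. u x * pderiv_at j \<phi> x) = (LINT x|lebesgue_on D'. u x * pderiv_at j \<phi> x)"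
      "(LINT x|lebesgue_on D. g x $ j * \<phi> x) = (LINT x|lebesgue_on D'. g x $ j * \<phi> x)"
      using K(2,3) D by (intro leb_on_support(1); auto)+
    then show ?thesis using is_weak_gradD(3)[OF g t'] by metis
  qed
  then show ?thesis
    using locally_integrable_subset[OF is_weak_gradD(1)[OF g] D(3)] locally_integrable_subset[OF is_weak_gradD(2)[OF g] D(3)]
    by (auto simp: is_weak_grad_def)
qed

lemma is_weak_grad_add:
  assumes D: "open D" and g: "is_weak_grad D u g" and h: "is_weak_grad D v h"
  shows "is_weak_grad D (\<lambda>x. u x + v x) (\<lambda>x. g x + h x)"
proof -
  note l = is_weak_gradD(1,2)[OF g] is_weak_gradD(1,2)[OF h]
  have "locally_integrable D (\<lambda>x. u x + v x)" "locally_integrable D (\<lambda>x. g x + h x)"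
    using l unfolding locally_integrable_def by auto
  moreover have "(LINT x|lebesgue_on D. (u x + v x) * pderiv_at j \<phi> x) = - (LINT x|lebesgue_on D. (g x + h x) $ j * \<phi> x)"
    if t: "\<phi> \<in> test_functions D" for \<phi> j
  proof -
    have "(LINT x|lebesgue_on D. (u x + v x) * pderiv_at j \<phi> x) =
        (LINT x|lebesgue_on D. u x * pderiv_at j \<phi> x) + (LINT x|lebesgue_on D. v x * pderiv_at j \<phi> x)"
      unfolding distrib_right by (intro Bochner_Integration.integral_add test_integrable[OF _ D t] l)
    moreover have "(LINT x|lebesgue_on D. (g x + h x) $ j * \<phi> x) =
        (LINT x|lebesgue_on D. g x $ j * \<phi> x) + (LINT x|lebesgue_on D. h x $ j * \<phi> x)"
      unfolding vector_add_component distrib_right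
      by (intro Bochner_Integration.integral_add test_integrable[OF _ D t] l locally_integrable_nth)
    ultimately show ?thesis using is_weak_gradD(3)[OF g t] is_weak_gradD(3)[OF h t] by simp
  qed
  ultimately show ?thesis by (auto simp: is_weak_grad_def)
qed

lemma is_weak_grad_scale:
  assumes g: "is_weak_grad D u g"
  shows "is_weak_grad D (\<lambda>x. c * u x) (\<lambda>x. c *\<^sub>R g x)"
proof -
  note l = is_weak_gradD(1,2)[OF g]
  have "locally_integrable D (\<lambda>x. c * u x)" "locally_integrable D (\<lambda>x. c *\<^sub>R g x)"
    using l unfolding locally_integrable_def by auto
  moreover have "(LINT x|lebesgue_on D. (c * u x) * pderiv_at j \<phi> x) = - (LINT x|lebesgue_on D. (c *\<^sub>R g x) $ j * \<phi> x)"
    if t: "\<phi> \<in> test_functions D" for \<phi> j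
    using is_weak_gradD(3)[OF g t] by (simp add: mult.assoc)
  ultimately show ?thesis by (auto simp: is_weak_grad_def)
qed

lemma is_weak_grad_diff:
  assumes "open D" "is_weak_grad D u g" "is_weak_grad D v h"
  shows "is_weak_grad D (\<lambda>x. u x - v x) (\<lambda>x. g x - h x)"
  using is_weak_grad_add[OF assms(1,2) is_weak_grad_scale[OF assms(3), of "-1"]] by simp

text \<open>For a fixed test function both sides pass to the limit by dominated convergence, the
  dominating functions being integrable on its compact support. The chain rule, the zero set lemma
  and the extension by zero all end with this step.\<close>

lemma is_weak_grad_limit:
  fixes u :: "real ^ 'd \<Rightarrow> real" and g :: "real ^ 'd \<Rightarrow> real ^ 'd"
  assumes D: "open D" and un: "\<And>n::nat. is_weak_grad D (un n) (gn n)"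
    and lim: "AE x in lebesgue_on D. (\<lambda>n. un n x) \<longlonglongrightarrow> u x" "AE x in lebesgue_on D. (\<lambda>n. gn n x) \<longlonglongrightarrow> g x"
    and bd: "\<And>n. AE x in lebesgue_on D. \<bar>un n x\<bar> \<le> U x" "\<And>n. AE x in lebesgue_on D. norm (gn n x) \<le> G x"
    and U: "locally_integrable D (U :: _ \<Rightarrow> real)" and G: "locally_integrable D (G :: _ \<Rightarrow> real)"
    and m: "u \<in> borel_measurable (lebesgue_on D)" "g \<in> borel_measurable (lebesgue_on D)"
  shows "is_weak_grad D u g"
proof -
  have Dl: "D \<in> sets lebesgue" using D by simp
  have li: "integrable (lebesgue_on K) u" "integrable (lebesgue_on K) g" if K: "compact K" "K \<subseteq> D" for K
  proof -
    have Kl: "K \<in> sets lebesgue" using K by simp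
    note ae = AE_leb_on_mono[OF _ K(2) Dl Kl]
    show "integrable (lebesgue_on K) u"
    proof (rule integrable_dominated_convergence[where w=U])
      show "\<And>n. un n \<in> borel_measurable (lebesgue_on K)" "integrable (lebesgue_on K) U"
        using is_weak_gradD(1)[OF un] U K unfolding locally_integrable_def by (blast intro: borel_measurable_integrable)+
      show "AE x in lebesgue_on K. norm (un n x) \<le> U x" for n using ae[OF bd(1)] by simp
    qed (use ae[OF lim(1)] measurable_leb_on_mono[OF m(1) K(2)] in auto)
    show "integrable (lebesgue_on K) g"
    proof (rule integrable_dominated_convergence[where w=G])
      show "\<And>n. gn n \<in> borel_measurable (lebesgue_on K)" "integrable (lebesgue_on K) G"
        using is_weak_gradD(2)[OF un] G K unfolding locally_integrable_def by (blast intro: borel_measurable_integrable)+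
      show "AE x in lebesgue_on K. norm (gn n x) \<le> G x" for n using ae[OF bd(2)] by simp
    qed (use ae[OF lim(2)] measurable_leb_on_mono[OF m(2) K(2)] in auto)
  qed
  then have l: "locally_integrable D u" "locally_integrable D g" unfolding locally_integrable_def by auto
  have "(LINT x|lebesgue_on D. u x * pderiv_at j \<phi> x) = - (LINT x|lebesgue_on D. g x $ j * \<phi> x)"
    if t: "\<phi> \<in> test_functions D" for \<phi> j
  proof -
    have "(\<lambda>n. LINT x|lebesgue_on D. un n x * pderiv_at j \<phi> x) \<longlonglongrightarrow> (LINT x|lebesgue_on D. u x * pderiv_at j \<phi> x)"
    proof (rule integral_dominated_convergence[where w="\<lambda>x. \<bar>U x * pderiv_at j \<phi> x\<bar>"])
      show "(\<lambda>x. u x * pderiv_at j \<phi> x) \<in> borel_measurable (lebesgue_on D)"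
        "\<And>n. (\<lambda>x. un n x * pderiv_at j \<phi> x) \<in> borel_measurable (lebesgue_on D)"
        "integrable (lebesgue_on D) (\<lambda>x. \<bar>U x * pderiv_at j \<phi> x\<bar>)"
        using test_integrable(2)[OF _ D t] l(1) is_weak_gradD(1)[OF un] U by (auto intro: borel_measurable_integrable)
      show "AE x in lebesgue_on D. (\<lambda>n. un n x * pderiv_at j \<phi> x) \<longlonglongrightarrow> u x * pderiv_at j \<phi> x"
        using lim(1) by eventually_elim (intro tendsto_intros)
      show "AE x in lebesgue_on D. norm (un n x * pderiv_at j \<phi> x) \<le> \<bar>U x * pderiv_at j \<phi> x\<bar>" for n
        using bd(1)[of n] by eventually_elim (auto simp: abs_mult intro!: mult_right_mono)
    qed
    moreover have "(\<lambda>n. LINT x|lebesgue_on D. gn n x $ j * \<phi> x) \<longlonglongrightarrow> (LINT x|lebesgue_on D. g x $ j * \<phi> x)"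
    proof (rule integral_dominated_convergence[where w="\<lambda>x. \<bar>G x * \<phi> x\<bar>"])
      show "(\<lambda>x. g x $ j * \<phi> x) \<in> borel_measurable (lebesgue_on D)"
        "\<And>n. (\<lambda>x. gn n x $ j * \<phi> x) \<in> borel_measurable (lebesgue_on D)"
        "integrable (lebesgue_on D) (\<lambda>x. \<bar>G x * \<phi> x\<bar>)"
        using test_integrable(1)[OF _ D t] locally_integrable_nth[OF l(2)] locally_integrable_nth[OF is_weak_gradD(2)[OF un]] G
        by (auto intro: borel_measurable_integrable)
      show "AE x in lebesgue_on D. (\<lambda>n. gn n x $ j * \<phi> x) \<longlonglongrightarrow> g x $ j * \<phi> x"
        using lim(2) by eventually_elim (intro tendsto_intros)
      show "AE x in lebesgue_on D. norm (gn n x $ j * \<phi> x) \<le> \<bar>G x * \<phi> x\<bar>" for n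
        using bd(2)[of n]
      proof eventually_elim
        fix x assume "norm (gn n x) \<le> G x"
        then have "\<bar>gn n x $ j\<bar> \<le> \<bar>G x\<bar>" using component_le_norm_cart[of "gn n x" j] by linarith
        then show "norm (gn n x $ j * \<phi> x) \<le> \<bar>G x * \<phi> x\<bar>" by (auto simp: abs_mult intro!: mult_right_mono)
      qed
    qed
    then have "(\<lambda>n. LINT x|lebesgue_on D. un n x * pderiv_at j \<phi> x) \<longlonglongrightarrow> - (LINT x|lebesgue_on D. g x $ j * \<phi> x)"
      unfolding is_weak_gradD(3)[OF un t] by (rule tendsto_minus)
    ultimately show ?thesis by (rule LIMSEQ_unique)
  qed
  then show ?thesis using l by (auto simp: is_weak_grad_def)
qed

section \<open>The product rule\<close>

lemma conv_bound:
  fixes a :: "real ^ 'd \<Rightarrow> real"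
  assumes a: "integrable lborel a" "AE x in lborel. \<bar>a x\<bar> \<le> B"
  shows "\<bar>conv a (mol k) x\<bar> \<le> B"
proof -
  have mk: "mollifier (1 / real (Suc k)) (mol k :: real ^ 'd \<Rightarrow> real)" by (rule mol)
  note m = mollifierD[OF mk]
  have "\<bar>conv a (mol k) x\<bar> \<le> (LINT y|lborel. B * mol k (x - y))"
    unfolding conv_def
  proof (rule order_trans[OF integral_abs_bound integral_mono_AE])
    show "integrable lborel (\<lambda>y. \<bar>a y * mol k (x - y)\<bar>)" using conv_integrable[OF a(1) m(1)] by auto
    show "integrable lborel (\<lambda>y. B * mol k (x - y))" using m(7) by auto
    show "AE y in lborel. \<bar>a y * mol k (x - y)\<bar> \<le> B * mol k (x - y)"
      using a(2) by eventually_elim (auto simp: abs_mult m(2) intro!: mult_right_mono)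
  qed
  then show ?thesis using m(6) by simp
qed

text \<open>The derivative falls on the kernel, and the kernel is a test function as long as its
  ball lies in \<open>D\<close>. The sign of the reflection cancels the sign in the definition of
  the weak gradient.\<close>

lemma conv_weak_grad:
  assumes D: "open D" and w: "is_weak_grad D a b"
    and a': "integrable lborel a'" "\<And>g. g \<in> borel_measurable borel \<Longrightarrow> (LINT x|lborel. a' x * g x) = (LINT x|lebesgue_on D. a x * g x)"
    and b': "integrable lborel b'" "\<And>g. g \<in> borel_measurable borel \<Longrightarrow> (LINT x|lborel. b' x * g x) = (LINT x|lebesgue_on D. b x $ j * g x)"
    and x: "cball x r \<subseteq> D" "1 / real (Suc k) \<le> r"
  shows "pderiv_at j (conv a' (mol k)) x = conv b' (mol k) x"
proof -
  have g: "(\<lambda>y. mol k (x - y)) \<in> borel_measurable borel" "(\<lambda>y. pderiv_at j (mol k) (x - y)) \<in> borel_measurable borel"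
    by (intro smooth_cD(5)[OF smooth_c_reflect] smooth_c_mol smooth_cD(3))+
  note t = mol_test[OF x]
  have "pderiv_at j (conv a' (mol k)) x = (LINT y|lebesgue_on D. a y * pderiv_at j (mol k) (x - y))"
    unfolding conv_pderiv[OF a'(1) smooth_c_mol] unfolding conv_def by (rule a'(2)[OF g(2)])
  also have "\<dots> = - (LINT y|lebesgue_on D. a y * pderiv_at j (\<lambda>y. mol k (x - y)) y)"
    by (simp add: pderiv_reflect[OF smooth_cD(2)[OF smooth_c_mol]])
  also have "\<dots> = (LINT y|lebesgue_on D. b y $ j * mol k (x - y))"
    using is_weak_gradD(3)[OF w t] by simp
  also have "\<dots> = conv b' (mol k) x" unfolding conv_def by (rule b'(2)[OF g(1), symmetric])
  finally show ?thesis .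
qed

lemma bounded_integrable_leb_on:
  fixes a :: "'a::euclidean_space \<Rightarrow> 'b::euclidean_space"
  assumes "S \<in> sets lebesgue" "bounded S" "a \<in> borel_measurable (lebesgue_on S)" "AE x in lebesgue_on S. norm (a x) \<le> B"
  shows "integrable (lebesgue_on S) a"
proof -
  have "S \<in> lmeasurable" using assms(1,2) bounded_set_imp_lmeasurable by blast
  then interpret finite_measure "lebesgue_on S" by (rule finite_measure_lebesgue_on)
  show ?thesis using assms(3,4) integrable_const_bound by blast
qed

text \<open>Only the bounded factor \<open>a\<close> is mollified. Its mollification times a test
  function is again a test function, with which the weak gradient of \<open>p\<close> is tested; the
  uniform bounds on the mollified \<open>a\<close> and its derivative then allow the limit with
  \<open>p\<close> and \<open>q\<close> held fixed.\<close>

lemma is_weak_grad_mult: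
  fixes p :: "real ^ 'd \<Rightarrow> real"
  assumes D: "open D" "bounded D" and a: "is_weak_grad D a b" and p: "is_weak_grad D p q"
    and bd: "AE x in lebesgue_on D. \<bar>a x\<bar> \<le> B" "AE x in lebesgue_on D. norm (b x) \<le> B"
  shows "is_weak_grad D (\<lambda>x. a x * p x) (\<lambda>x. a x *\<^sub>R q x + p x *\<^sub>R b x)"
proof -
  have Dl: "D \<in> sets lebesgue" using D by simp
  note la = is_weak_gradD(1,2)[OF a] and lp = is_weak_gradD(1,2)[OF p]
  have ma: "a \<in> borel_measurable (lebesgue_on D)" "b \<in> borel_measurable (lebesgue_on D)"
    using locally_integrable_measurable D(1) la by auto
  have ia: "integrable (lebesgue_on D) a" "integrable (lebesgue_on D) b"
    using ma bd by (auto intro!: bounded_integrable_leb_on[OF Dl D(2)])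
  have l1: "locally_integrable D (\<lambda>x. a x * p x)" and l2: "locally_integrable D (\<lambda>x. a x *\<^sub>R q x + p x *\<^sub>R b x)"
    unfolding locally_integrable_def
  proof (safe)
    fix K assume K: "compact K" "K \<subseteq> D"
    have Kl: "K \<in> sets lebesgue" using K by simp
    note ae = AE_leb_on_mono[OF _ K(2) Dl Kl]
    have i: "integrable (lebesgue_on K) p" "integrable (lebesgue_on K) q" using lp K unfolding locally_integrable_def by auto
    note mk = measurable_leb_on_mono[OF ma(1) K(2)] measurable_leb_on_mono[OF ma(2) K(2)]
    show "integrable (lebesgue_on K) (\<lambda>x. a x * p x)"
      using bounded_mult_integrable[OF i(1) mk(1) ae[OF bd(1)]] by simp
    have "integrable (lebesgue_on K) (\<lambda>x. p x *\<^sub>R b x)"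
    proof (rule Bochner_Integration.integrable_bound[of _ "\<lambda>x. B * \<bar>p x\<bar>"])
      show "AE x in lebesgue_on K. norm (p x *\<^sub>R b x) \<le> norm (B * \<bar>p x\<bar>)"
        using ae[OF bd(2)]
      proof eventually_elim
        fix x assume "norm (b x) \<le> B"
        then have "\<bar>p x\<bar> * norm (b x) \<le> \<bar>p x\<bar> * \<bar>B\<bar>" by (intro mult_left_mono) auto
        then show "norm (p x *\<^sub>R b x) \<le> norm (B * \<bar>p x\<bar>)" by (simp add: abs_mult mult.commute)
      qed
    qed (use i mk in auto)
    then show "integrable (lebesgue_on K) (\<lambda>x. a x *\<^sub>R q x + p x *\<^sub>R b x)"
      using bounded_mult_integrable[OF i(2) mk(1) ae[OF bd(1)]] by auto
  qed
  have "(LINT x|lebesgue_on D. (a x * p x) * pderiv_at j \<phi> x) = - (LINT x|lebesgue_on D. (a x *\<^sub>R q x + p x *\<^sub>R b x) $ j * \<phi> x)"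
    if t: "\<phi> \<in> test_functions D" for \<phi> j
  proof -
    have bj: "integrable (lebesgue_on D) (\<lambda>x. b x $ j)" "AE x in lebesgue_on D. \<bar>b x $ j\<bar> \<le> B"
      using integrable_bounded_linear[OF bounded_linear_vec_nth ia(2)] bd(2)
      by (auto elim!: eventually_mono intro: order_trans[OF component_le_norm_cart])
    have Db: "D \<in> sets borel" using D by auto
    obtain a' where a': "integrable lborel a'" "\<And>x. x \<notin> D \<Longrightarrow> a' x = 0" "AE x in lebesgue_on D. a x = a' x"
      "\<And>g. g \<in> borel_measurable borel \<Longrightarrow> (LINT x|lborel. a' x * g x) = (LINT x|lebesgue_on D. a x * g x)"
      by (rule borel_rep[OF ia(1) Db]) (rule that)
    obtain b' where b': "integrable lborel b'" "\<And>x. x \<notin> D \<Longrightarrow> b' x = 0" "AE x in lebesgue_on D. b x $ j = b' x"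
      "\<And>g. g \<in> borel_measurable borel \<Longrightarrow> (LINT x|lborel. b' x * g x) = (LINT x|lebesgue_on D. b x $ j * g x)"
      by (rule borel_rep[OF bj(1) Db]) (rule that)
    \<comment> \<open>The representatives are 0 outside \<open>D\<close>, so the bound must be made
      nonnegative to hold everywhere.\<close>
    define B' where "B' = max B 0"
    have bd': "AE x in lborel. \<bar>a' x\<bar> \<le> B'" "AE x in lborel. \<bar>b' x\<bar> \<le> B'"
    proof -
      have "AE x in lebesgue. x \<in> D \<longrightarrow> \<bar>a x\<bar> \<le> B" "AE x in lebesgue. x \<in> D \<longrightarrow> a x = a' x"
        "AE x in lebesgue. x \<in> D \<longrightarrow> \<bar>b x $ j\<bar> \<le> B" "AE x in lebesgue. x \<in> D \<longrightarrow> b x $ j = b' x"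
        using bd(1) a'(3) bj(2) b'(3) by (simp_all add: AE_leb_on[OF Dl])
      then have "AE x in lebesgue. \<bar>a' x\<bar> \<le> B' \<and> \<bar>b' x\<bar> \<le> B'"
      proof eventually_elim
        case (elim x)
        then show ?case using a'(2)[of x] b'(2)[of x] by (cases "x \<in> D") (auto simp: B'_def)
      qed
      then show "AE x in lborel. \<bar>a' x\<bar> \<le> B'" "AE x in lborel. \<bar>b' x\<bar> \<le> B'"
        by (auto simp: AE_completion_iff elim: eventually_mono)
    qed
    obtain s where s: "strict_mono s" "AE x in lborel. (\<lambda>k. conv a' (mol (s k)) x) \<longlonglongrightarrow> a' x"
       "AE x in lborel. (\<lambda>k. conv b' (mol (s k)) x) \<longlonglongrightarrow> b' x"
      by (rule conv_mol_AE_subseq[OF a'(1) b'(1)]) (rule that)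
    define A where "A k = conv a' (mol (s k))" for k
    define E where "E k = conv b' (mol (s k))" for k
    have AB: "\<bar>A k x\<bar> \<le> B'" "\<bar>E k x\<bar> \<le> B'" for k x
      unfolding A_def E_def using conv_bound a'(1) b'(1) bd' by auto
    have Am: "A k \<in> borel_measurable (lebesgue_on D)" "E k \<in> borel_measurable (lebesgue_on D)" for k
      unfolding A_def E_def using conv_measurable a'(1) b'(1)
      by (intro measurable_restrict_space1 measurable_completion; simp)+
    have liml: "AE x in lebesgue_on D. (\<lambda>k. A k x) \<longlonglongrightarrow> a x" "AE x in lebesgue_on D. (\<lambda>k. E k x) \<longlonglongrightarrow> b x $ j"
    proof -
      have "AE x in lebesgue_on D. (\<lambda>k. A k x) \<longlonglongrightarrow> a' x" "AE x in lebesgue_on D. (\<lambda>k. E k x) \<longlonglongrightarrow> b' x"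
        using AE_completion[OF s(2)] AE_completion[OF s(3)] unfolding A_def E_def AE_leb_on[OF Dl] by (auto elim: eventually_mono)
      with a'(3) b'(3) show "AE x in lebesgue_on D. (\<lambda>k. A k x) \<longlonglongrightarrow> a x" "AE x in lebesgue_on D. (\<lambda>k. E k x) \<longlonglongrightarrow> b x $ j"
        by (auto elim: eventually_elim2)
    qed
    note sm = test_functionsD(1)[OF t]
    obtain K where K: "compact K" "K \<subseteq> D" "\<And>x. x \<notin> K \<Longrightarrow> \<phi> x = 0 \<and> (\<forall>j. pderiv_at j \<phi> x = 0)"
      using test_functionsD(2)[OF t] by blast
    \<comment> \<open>A margin around the support of the test function: for kernels below
      \<open>r\<close> the derivative of the mollification is the mollification of the weak
      derivative at every point of \<open>K\<close>. Outside \<open>K\<close> the test function and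
      its derivatives vanish.\<close>
    obtain r where r: "r > 0" "\<And>x. x \<in> K \<Longrightarrow> cball x r \<subseteq> D"
    proof -
      have "K \<inter> - D = {}" "closed (- D)" using D(1) K(2) by auto
      then obtain d where d: "d > 0" "\<And>x y. x \<in> K \<Longrightarrow> y \<notin> D \<Longrightarrow> d \<le> dist x y"
        using separate_compact_closed[OF K(1), of "- D"] by fastforce
      show thesis by (rule that[of "d/2"]) (use d in force)+
    qed
    obtain N where N: "1 / real (Suc N) < r" using r(1) nat_approx_posE by metis
    have sk: "1 / real (Suc (s k)) \<le> r" if "k \<ge> N" for k
    proof -
      have "N \<le> s k" using that seq_suble[OF s(1), of k] by simp
      then have "1 / real (Suc (s k)) \<le> 1 / real (Suc N)" by (intro frac_le) auto
      then show ?thesis using N by simp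
    qed
    have pd: "pderiv_at j (A k) x = E k x" if "x \<in> K" "k \<ge> N" for x k
      unfolding A_def E_def
      by (rule conv_weak_grad[OF D(1) a a'(1,4) b'(1,4) r(2)[OF that(1)] sk[OF that(2)]])
    have Ck: "Ck m (A k)" for m k unfolding A_def by (rule Ck_conv[OF a'(1) smooth_c_mol])
    have Ad: "A k differentiable (at x)" for k x using Ck[of "Suc 0"] by simp
    have T: "(\<lambda>x. A k x * \<phi> x) \<in> test_functions D" for k
    proof (rule test_functionsI[of _ K])
      show "smooth_c (\<lambda>x. A k x * \<phi> x)"
        using sm Ck unfolding smooth_c_def by (auto intro: Ck_mult elim: bounded_subset)
    qed (use K compact_imp_closed in auto)
    have id: "(LINT x|lebesgue_on D. p x * (A k x * pderiv_at j \<phi> x + E k x * \<phi> x)) = - (LINT x|lebesgue_on D. q x $ j * (A k x * \<phi> x))"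
      if k: "k \<ge> N" for k
    proof -
      have "pderiv_at j (\<lambda>x. A k x * \<phi> x) x = A k x * pderiv_at j \<phi> x + E k x * \<phi> x" for x
        using pderiv_mult[OF Ad[of k x] smooth_cD(2)[OF sm, of x], of j] pd[of x k] k K(3)[of x] by (cases "x \<in> K") auto
      then show ?thesis using is_weak_gradD(3)[OF p T[of k], of j] by simp
    qed
    have ip: "integrable (lebesgue_on D) (\<lambda>x. p x * \<phi> x)" "integrable (lebesgue_on D) (\<lambda>x. p x * pderiv_at j \<phi> x)"
       "integrable (lebesgue_on D) (\<lambda>x. q x $ j * \<phi> x)"
      using test_integrable[OF _ D(1) t] lp(1) locally_integrable_nth[OF lp(2)] by auto
    have mp: "p \<in> borel_measurable (lebesgue_on D)" "q \<in> borel_measurable (lebesgue_on D)"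
      using locally_integrable_measurable D(1) lp by auto
    have mq: "(\<lambda>x. q x $ j) \<in> borel_measurable (lebesgue_on D)"
      by (rule locally_integrable_measurable[OF D(1) locally_integrable_nth[OF lp(2)]])
    have mphi: "\<phi> \<in> borel_measurable (lebesgue_on D)" "pderiv_at j \<phi> \<in> borel_measurable (lebesgue_on D)"
      using smooth_cD(5)[OF sm] smooth_cD(5)[OF smooth_cD(3)[OF sm]]
      by (intro measurable_restrict_space1 measurable_completion; simp)+
    have "(\<lambda>k. LINT x|lebesgue_on D. p x * (A k x * pderiv_at j \<phi> x + E k x * \<phi> x)) \<longlonglongrightarrow>
        (LINT x|lebesgue_on D. p x * (a x * pderiv_at j \<phi> x + b x $ j * \<phi> x))"
    proof (rule integral_dominated_convergence[where w="\<lambda>x. B' * \<bar>p x * pderiv_at j \<phi> x\<bar> + B' * \<bar>p x * \<phi> x\<bar>"])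
      show "AE x in lebesgue_on D. (\<lambda>k. p x * (A k x * pderiv_at j \<phi> x + E k x * \<phi> x)) \<longlonglongrightarrow> p x * (a x * pderiv_at j \<phi> x + b x $ j * \<phi> x)"
        using liml by eventually_elim (intro tendsto_intros)
      show "AE x in lebesgue_on D. norm (p x * (A k x * pderiv_at j \<phi> x + E k x * \<phi> x)) \<le> B' * \<bar>p x * pderiv_at j \<phi> x\<bar> + B' * \<bar>p x * \<phi> x\<bar>" for k
      proof (rule AE_I2)
        fix x
        have "\<bar>A k x\<bar> * \<bar>p x * pderiv_at j \<phi> x\<bar> \<le> B' * \<bar>p x * pderiv_at j \<phi> x\<bar>"
          "\<bar>E k x\<bar> * \<bar>p x * \<phi> x\<bar> \<le> B' * \<bar>p x * \<phi> x\<bar>" using AB by (intro mult_right_mono; simp)+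
        moreover have "p x * (A k x * pderiv_at j \<phi> x + E k x * \<phi> x) = A k x * (p x * pderiv_at j \<phi> x) + E k x * (p x * \<phi> x)"
          by (simp add: algebra_simps)
        ultimately show "norm (p x * (A k x * pderiv_at j \<phi> x + E k x * \<phi> x)) \<le> B' * \<bar>p x * pderiv_at j \<phi> x\<bar> + B' * \<bar>p x * \<phi> x\<bar>"
          using abs_triangle_ineq[of "A k x * (p x * pderiv_at j \<phi> x)" "E k x * (p x * \<phi> x)"] by (simp only: real_norm_def abs_mult)
      qed
      show "integrable (lebesgue_on D) (\<lambda>x. B' * \<bar>p x * pderiv_at j \<phi> x\<bar> + B' * \<bar>p x * \<phi> x\<bar>)" using ip by auto
    qed (auto intro!: borel_measurable_times borel_measurable_add Am mp(1) mq mphi ma(1) borel_measurable_integrable[OF bj(1)])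
    moreover have "(\<lambda>k. LINT x|lebesgue_on D. q x $ j * (A k x * \<phi> x)) \<longlonglongrightarrow> (LINT x|lebesgue_on D. q x $ j * (a x * \<phi> x))"
    proof (rule integral_dominated_convergence[where w="\<lambda>x. B' * \<bar>q x $ j * \<phi> x\<bar>"])
      show "AE x in lebesgue_on D. (\<lambda>k. q x $ j * (A k x * \<phi> x)) \<longlonglongrightarrow> q x $ j * (a x * \<phi> x)"
        using liml(1) by eventually_elim (intro tendsto_intros)
      show "AE x in lebesgue_on D. norm (q x $ j * (A k x * \<phi> x)) \<le> B' * \<bar>q x $ j * \<phi> x\<bar>" for k
      proof (rule AE_I2)
        fix x
        have "\<bar>A k x\<bar> * \<bar>q x $ j * \<phi> x\<bar> \<le> B' * \<bar>q x $ j * \<phi> x\<bar>" using AB by (intro mult_right_mono) auto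
        then show "norm (q x $ j * (A k x * \<phi> x)) \<le> B' * \<bar>q x $ j * \<phi> x\<bar>" by (simp add: abs_mult mult_ac)
      qed
      show "integrable (lebesgue_on D) (\<lambda>x. B' * \<bar>q x $ j * \<phi> x\<bar>)" using ip by auto
    qed (auto intro!: borel_measurable_times borel_measurable_add Am mp(1) mq mphi ma(1) borel_measurable_integrable[OF bj(1)])
    then have "(\<lambda>k. - (LINT x|lebesgue_on D. q x $ j * (A k x * \<phi> x))) \<longlonglongrightarrow> - (LINT x|lebesgue_on D. q x $ j * (a x * \<phi> x))"
      by (rule tendsto_minus)
    then have "(\<lambda>k. LINT x|lebesgue_on D. p x * (A k x * pderiv_at j \<phi> x + E k x * \<phi> x)) \<longlonglongrightarrow> - (LINT x|lebesgue_on D. q x $ j * (a x * \<phi> x))"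
      by (rule Lim_transform_eventually) (use id in \<open>auto simp: eventually_sequentially intro!: exI[of _ N]\<close>)
    ultimately have eq: "(LINT x|lebesgue_on D. p x * (a x * pderiv_at j \<phi> x + b x $ j * \<phi> x)) = - (LINT x|lebesgue_on D. q x $ j * (a x * \<phi> x))"
      by (rule LIMSEQ_unique)
    have j1: "integrable (lebesgue_on D) (\<lambda>x. (a x * p x) * pderiv_at j \<phi> x)"
      using test_integrable(2)[OF l1 D(1) t] .
    have j2: "integrable (lebesgue_on D) (\<lambda>x. q x $ j * (a x * \<phi> x))"
      using bounded_mult_integrable[OF ip(3) ma(1) bd(1)] by (simp add: mult_ac)
    have j3: "integrable (lebesgue_on D) (\<lambda>x. p x * (b x $ j * \<phi> x))"
      using bounded_mult_integrable[OF ip(1) borel_measurable_integrable[OF bj(1)] bj(2)] by (simp add: mult_ac)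
    have "(LINT x|lebesgue_on D. p x * (a x * pderiv_at j \<phi> x + b x $ j * \<phi> x)) =
       (LINT x|lebesgue_on D. (a x * p x) * pderiv_at j \<phi> x) + (LINT x|lebesgue_on D. p x * (b x $ j * \<phi> x))"
      using j1 j3 by (subst Bochner_Integration.integral_add[symmetric]) (simp_all add: algebra_simps)
    moreover have "(LINT x|lebesgue_on D. (a x *\<^sub>R q x + p x *\<^sub>R b x) $ j * \<phi> x) =
       (LINT x|lebesgue_on D. q x $ j * (a x * \<phi> x)) + (LINT x|lebesgue_on D. p x * (b x $ j * \<phi> x))"
      using j2 j3 by (subst Bochner_Integration.integral_add[symmetric]) (simp_all add: algebra_simps)
    ultimately show ?thesis using eq by simp
  qed
  then show ?thesis using l1 l2 by (auto simp: is_weak_grad_def)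
qed

section \<open>Classical gradients are weak gradients\<close>

lemma integral_pderiv_zero:
  fixes F :: "real ^ 'd \<Rightarrow> real" and G :: "real ^ 'd \<Rightarrow> real ^ 'd"
  assumes d: "\<And>x. (F has_derivative (\<lambda>h. G x \<bullet> h)) (at x)" and G: "continuous_on UNIV G"
    and R: "\<And>x. norm x \<ge> R \<Longrightarrow> F x = 0"
  shows "(LINT x|lborel. G x $ j) = 0"
proof -
  let ?e = "axis j 1 :: real^'d"
  have Fc: "continuous_on UNIV F"
    using has_derivative_continuous[OF d] by (simp add: continuous_on_eq_continuous_within)
  have [measurable]: "F \<in> borel_measurable borel" "G \<in> borel_measurable borel"
    using Fc G by (auto intro: borel_measurable_continuous_onI)
  have G0: "G x = 0" if "norm x > R" for x
  proof -
    have "(F has_derivative (\<lambda>h. 0)) (at x)"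
      by (rule has_derivative_transform_within_open[of "\<lambda>x. 0" _ x UNIV "- cball 0 R"]) (use that R in \<open>auto simp: less_imp_le\<close>)
    then have "(\<lambda>h. G x \<bullet> h) = (\<lambda>h. 0)" using has_derivative_unique[OF d] by blast
    then have "G x \<bullet> G x = 0" by (rule fun_cong)
    then show ?thesis by simp
  qed
  have "bounded (G ` cball 0 R)"
    by (intro compact_imp_bounded compact_continuous_image continuous_on_subset[OF G]) auto
  then obtain M0 where M0: "\<And>x. norm x \<le> R \<Longrightarrow> norm (G x) \<le> M0"
    unfolding bounded_iff by (metis dist_0_norm image_eqI mem_cball)
  define M where "M = max M0 0"
  have M: "norm (G x) \<le> M" for x using M0[of x] G0[of x] by (cases "norm x \<le> R") (auto simp: M_def)
  have L: "\<bar>F x - F y\<bar> \<le> M * norm (x - y)" for x y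
  proof -
    have "norm (F x - F y) \<le> M * norm (x - y)"
    proof (rule differentiable_bound[of UNIV])
      show "(F has_derivative (\<lambda>h. G z \<bullet> h)) (at z within UNIV)" for z using d by simp
      show "onorm (\<lambda>h. G z \<bullet> h) \<le> M" for z
      proof (rule onorm_le)
        fix h
        have "\<bar>G z \<bullet> h\<bar> \<le> norm (G z) * norm h" by (rule Cauchy_Schwarz_ineq2)
        also have "\<dots> \<le> M * norm h" using M by (intro mult_right_mono) auto
        finally show "norm (G z \<bullet> h) \<le> M * norm h" by simp
      qed
    qed auto
    then show ?thesis by simp
  qed
  have iF: "integrable lborel F"
  proof -
    have "integrable lborel (\<lambda>x. indicator (cball 0 R) x *\<^sub>R F x)"
      by (intro borel_integrable_compact continuous_on_subset[OF Fc]) auto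
    also have "(\<lambda>x. indicator (cball 0 R) x *\<^sub>R F x) = F" using R by (auto simp: indicator_def fun_eq_iff)
    finally show ?thesis .
  qed
  define c where "c n = real (Suc n)" for n
  have c: "c n \<ge> 1" for n by (simp add: c_def)
  have c0: "(\<lambda>n. 1 / c n) \<longlonglongrightarrow> 0" unfolding c_def using LIMSEQ_inverse_real_of_nat by (simp add: inverse_eq_divide)
  \<comment> \<open>The difference quotient with step \<open>1 / c n\<close>. By translation
    invariance its integral is 0 for every \<open>n\<close>, so the claim is an exchange of limit
    and integral. Steps of length at most 1 keep all quotients supported in the ball of radius
    \<open>R + 1\<close>, where the Lipschitz constant \<open>M\<close> bounds them.\<close>
  define q where "q n x = c n * (F (x - (- (1 / c n) *\<^sub>R ?e)) - F x)" for n x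
  have "(\<lambda>n. LINT x|lborel. q n x) \<longlonglongrightarrow> (LINT x|lborel. G x $ j)"
  proof (rule integral_dominated_convergence[where w="\<lambda>x. M * indicator (cball 0 (R + 1)) x"])
    show "AE x in lborel. (\<lambda>n. q n x) \<longlonglongrightarrow> G x $ j"
    proof (rule AE_I2)
      fix x
      have 1: "((\<lambda>t. x + t *\<^sub>R ?e) has_vector_derivative ?e) (at 0)" by (auto intro!: derivative_eq_intros)
      have "((\<lambda>t. F (x + t *\<^sub>R ?e)) has_derivative (\<lambda>t. G x \<bullet> (t *\<^sub>R ?e))) (at 0)"
        using has_derivative_compose[OF 1[unfolded has_vector_derivative_def], of F "\<lambda>h. G x \<bullet> h"] d[of x] by simp
      then have "((\<lambda>t. F (x + t *\<^sub>R ?e)) has_real_derivative (G x $ j)) (at 0)"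
        by (simp add: has_field_derivative_def inner_axis mult_commute_abs)
      then have l: "((\<lambda>t. (F (x + t *\<^sub>R ?e) - F x) / t) \<longlongrightarrow> G x $ j) (at 0)" by (simp add: DERIV_def)
      have "filterlim (\<lambda>n. 1 / c n) (at 0) sequentially" using c0 by (auto simp: filterlim_at c_def)
      from filterlim_compose[OF l this] show "(\<lambda>n. q n x) \<longlonglongrightarrow> G x $ j"
        by (simp add: q_def mult.commute)
    qed
    show "AE x in lborel. norm (q n x) \<le> M * indicator (cball 0 (R + 1)) x" for n
    proof (rule AE_I2)
      fix x
      show "norm (q n x) \<le> M * indicator (cball 0 (R + 1)) x"
      proof (cases "norm x \<le> R + 1")
        case True
        have "\<bar>q n x\<bar> \<le> c n * (M * norm ((1 / c n) *\<^sub>R ?e))"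
          using L[of "x - (- (1 / c n) *\<^sub>R ?e)" x] c[of n] unfolding q_def abs_mult
          by (simp add: field_simps)
        also have "\<dots> = M" using c[of n] by (simp add: norm_axis_1)
        finally show ?thesis using True by simp
      next
        case False
        have "norm x \<le> norm (x + (1 / c n) *\<^sub>R ?e) + norm ((1 / c n) *\<^sub>R ?e)" using norm_triangle_ineq4[of "x + (1 / c n) *\<^sub>R ?e" "(1 / c n) *\<^sub>R ?e"] by simp
        moreover have "norm ((1 / c n) *\<^sub>R ?e) \<le> 1" using c[of n] by (simp add: norm_axis_1)
        ultimately have "norm (x + (1 / c n) *\<^sub>R ?e) \<ge> R" using False by linarith
        then show ?thesis using False R by (simp add: q_def)
      qed
    qed
    show "integrable lborel (\<lambda>x. M * indicator (cball 0 (R + 1)) x :: real)"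
      by (intro integrable_mult_right integrable_real_indicator) (use emeasure_bounded_finite[OF bounded_cball] in auto)
    show "(\<lambda>x. G x $ j) \<in> borel_measurable lborel"
      using borel_measurable_continuous_onI[OF continuous_on_component[OF G]] by simp
  qed (auto simp: q_def)
  moreover have "(LINT x|lborel. q n x) = 0" for n
  proof -
    have "(LINT x|lborel. q n x) = c n * ((LINT x|lborel. F (x - (- (1 / c n) *\<^sub>R ?e))) - (LINT x|lborel. F x))"
      unfolding q_def by (simp only: integral_mult_right_zero Bochner_Integration.integral_diff[OF lborel_shift(1)[OF iF] iF])
    then show ?thesis using lborel_shift(2)[of F "- (1 / c n) *\<^sub>R ?e"] by simp
  qed
  ultimately have "(\<lambda>n. 0) \<longlonglongrightarrow> (LINT x|lborel. G x $ j)" by simp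
  then show ?thesis using LIMSEQ_unique[OF _ tendsto_const] by metis
qed

lemma continuous_locally_integrable:
  fixes u :: "real ^ 'd \<Rightarrow> 'b::euclidean_space"
  assumes "continuous_on D u" shows "locally_integrable D u"
  unfolding locally_integrable_def
proof (intro allI impI)
  fix K assume K: "compact K \<and> K \<subseteq> D"
  have c: "continuous_on K u" using assms K continuous_on_subset by blast
  then have "bounded (u ` K)" using K compact_continuous_image compact_imp_bounded by blast
  then obtain B where "\<And>x. x \<in> K \<Longrightarrow> norm (u x) \<le> B" unfolding bounded_iff by auto
  moreover have "u \<in> borel_measurable (lebesgue_on K)"
    using c K by (intro continuous_imp_measurable_on_sets_lebesgue) auto
  ultimately show "integrable (lebesgue_on K) u"
    using K by (intro bounded_integrable_leb_on[where B=B]) (auto intro: compact_imp_bounded)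
qed

text \<open>The product of \<open>W\<close> with a test function, extended by zero, is continuously
  differentiable on the whole space, since \<open>D\<close> and the complement of the compact
  support are two open sets covering it. The integral of its partial derivative is 0, and the
  product rule splits this integral into the two sides.\<close>

lemma C1_is_weak_grad:
  fixes W :: "real ^ 'd \<Rightarrow> real"
  assumes D: "open D" and d: "\<And>x. x \<in> D \<Longrightarrow> (W has_derivative (\<lambda>h. g x \<bullet> h)) (at x)" and g: "continuous_on D g"
  shows "is_weak_grad D W g"
proof -
  have Wc: "continuous_on D W" using d has_derivative_continuous by (metis D continuous_on_eq_continuous_at)
  have l: "locally_integrable D W" "locally_integrable D g" using Wc g continuous_locally_integrable by auto
  have "(LINT x|lebesgue_on D. W x * pderiv_at j \<phi> x) = - (LINT x|lebesgue_on D. g x $ j * \<phi> x)"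
    if t: "\<phi> \<in> test_functions D" for \<phi> j
  proof -
    note sm = test_functionsD(1)[OF t]
    obtain K where K: "compact K" "K \<subseteq> D" "\<And>x. x \<notin> K \<Longrightarrow> \<phi> x = 0 \<and> (\<forall>j. pderiv_at j \<phi> x = 0)"
      using test_functionsD(2)[OF t] by blast
    define P where "P x = (\<chi> j. pderiv_at j \<phi> x)" for x
    have Pd: "(\<phi> has_derivative (\<lambda>h. P x \<bullet> h)) (at x)" for x
    proof -
      have "frechet_derivative \<phi> (at x) = (\<lambda>h. P x \<bullet> h)"
        using pderiv_expand[OF smooth_cD(2)[OF sm]] by (auto simp: P_def inner_vec_def mult.commute)
      then show ?thesis using smooth_cD(2)[OF sm, of x] frechet_derivative_works by metis
    qed
    have Pc: "continuous_on S P" for S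
      unfolding P_def by (intro continuous_on_vec_lambda continuous_on_subset[OF smooth_cD(1)[OF smooth_cD(3)[OF sm]]]) auto
    define F where "F x = (if x \<in> D then W x * \<phi> x else 0)" for x
    define G where "G x = (if x \<in> D then \<phi> x *\<^sub>R g x + W x *\<^sub>R P x else 0)" for x
    have P0: "P x = 0" if "x \<notin> K" for x using K(3)[OF that] by (simp add: P_def vec_eq_iff)
    have oK: "open (- K)" using compact_imp_closed[OF K(1)] by (rule open_Compl)
    have DK: "D \<union> - K = UNIV" using K(2) by auto
    have "(F has_derivative (\<lambda>h. G x \<bullet> h)) (at x)" for x
    proof (cases "x \<in> D")
      case True
      have "((\<lambda>x. W x * \<phi> x) has_derivative (\<lambda>h. W x * (P x \<bullet> h) + (g x \<bullet> h) * \<phi> x)) (at x)"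
        by (rule has_derivative_mult[OF d[OF True] Pd])
      also have "(\<lambda>h. W x * (P x \<bullet> h) + (g x \<bullet> h) * \<phi> x) = (\<lambda>h. G x \<bullet> h)"
        using True by (auto simp: G_def inner_add_left)
      finally show ?thesis
        by (rule has_derivative_transform_within_open[OF _ D True]) (auto simp: F_def)
    next
      case False
      then have x: "x \<in> - K" using K(2) by auto
      have "(F has_derivative (\<lambda>h. 0)) (at x)"
        by (rule has_derivative_transform_within_open[of "\<lambda>x. 0", OF _ oK x]) (use K(3) in \<open>auto simp: F_def\<close>)
      then show ?thesis using False by (simp add: G_def)
    qed
    moreover have "continuous_on UNIV G"
      unfolding DK[symmetric]
    proof (rule continuous_on_open_Un[OF D oK])
      have "continuous_on D (\<lambda>x. \<phi> x *\<^sub>R g x + W x *\<^sub>R P x)"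
        using Wc g Pc continuous_on_subset[OF smooth_cD(1)[OF sm]] by (intro continuous_intros) auto
      then show "continuous_on D G" by (rule continuous_on_eq) (auto simp: G_def)
      show "continuous_on (- K) G" by (rule continuous_on_eq[of _ "\<lambda>x. 0"]) (use K(3) P0 in \<open>auto simp: G_def\<close>)
    qed
    moreover obtain R where "\<And>x. x \<in> K \<Longrightarrow> norm x < R"
      using compact_imp_bounded[OF K(1)] unfolding bounded_pos_less by auto
    then have "F x = 0" if "norm x \<ge> R" for x using K(3)[of x] that by (force simp: F_def)
    ultimately have "(LINT x|lborel. G x $ j) = 0" by (rule integral_pderiv_zero)
    moreover have "(\<lambda>x. G x $ j) \<in> borel_measurable borel"
      using \<open>continuous_on UNIV G\<close> by (intro borel_measurable_continuous_onI continuous_on_component)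
    then have "(LINT x|lborel. G x $ j) = (LINT x|lebesgue. G x $ j)"
      by (intro integral_completion[symmetric]) simp
    also have "\<dots> = (LINT x|lebesgue_on D. g x $ j * \<phi> x + W x * pderiv_at j \<phi> x)"
      using D by (subst integral_restrict_space) (auto intro!: Bochner_Integration.integral_cong simp: G_def P_def indicator_def)
    also have "\<dots> = (LINT x|lebesgue_on D. g x $ j * \<phi> x) + (LINT x|lebesgue_on D. W x * pderiv_at j \<phi> x)"
      by (intro Bochner_Integration.integral_add test_integrable[OF _ D t] l locally_integrable_nth)
    ultimately show ?thesis by simp
  qed
  then show ?thesis using l by (auto simp: is_weak_grad_def)
qed

section \<open>The chain rule\<close>

lemma is_weak_grad_const: "open D \<Longrightarrow> is_weak_grad D (\<lambda>x. c) (\<lambda>x. 0)"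
  by (rule C1_is_weak_grad) auto

lemma is_weak_grad_power:
  assumes D: "open D" "bounded D" and a: "is_weak_grad D a b"
    and bd: "AE x in lebesgue_on D. \<bar>a x\<bar> \<le> B" "AE x in lebesgue_on D. norm (b x) \<le> B"
  shows "is_weak_grad D (\<lambda>x. a x ^ Suc n) (\<lambda>x. (real (Suc n) * a x ^ n) *\<^sub>R b x)"
proof (induction n)
  case 0 show ?case using a by simp
next
  case (Suc n)
  have "is_weak_grad D (\<lambda>x. a x * a x ^ Suc n) (\<lambda>x. a x *\<^sub>R (real (Suc n) * a x ^ n) *\<^sub>R b x + a x ^ Suc n *\<^sub>R b x)"
    by (rule is_weak_grad_mult[OF D a Suc bd])
  also have "(\<lambda>x. a x *\<^sub>R (real (Suc n) * a x ^ n) *\<^sub>R b x + a x ^ Suc n *\<^sub>R b x) = (\<lambda>x. (real (Suc (Suc n)) * a x ^ Suc n) *\<^sub>R b x)"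
    by (rule ext) (simp add: scaleR_add_left[symmetric] algebra_simps del: scaleR_add_left)
  finally show ?case by simp
qed

lemma is_weak_grad_sum:
  assumes "finite I" "open D" "\<And>i. i \<in> I \<Longrightarrow> is_weak_grad D (u i) (g i)"
  shows "is_weak_grad D (\<lambda>x. \<Sum>i\<in>I. u i x) (\<lambda>x. \<Sum>i\<in>I. g i x)"
  using assms
proof (induction I rule: finite_induct)
  case empty then show ?case using is_weak_grad_const[of D 0] by simp
next
  case (insert i I) then show ?case using is_weak_grad_add[of D "u i" "g i"] by simp
qed

text \<open>Polynomials follow from the product rule. The Weierstrass theorem is applied to the
  derivative \<open>G'\<close> and the polynomials are integrated, so that values and derivatives
  converge uniformly on the range of \<open>a\<close> together.\<close>

lemma is_weak_grad_chain:
  fixes G G' :: "real \<Rightarrow> real"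
  assumes D: "open D" "bounded D" and a: "is_weak_grad D a b"
    and bd: "AE x in lebesgue_on D. norm (b x) \<le> B" and lu: "AE x in lebesgue_on D. a x \<in> {l..u}" "l \<le> u"
    and G: "\<And>t. t \<in> {l..u} \<Longrightarrow> (G has_real_derivative G' t) (at t within {l..u})" and G': "continuous_on {l..u} G'"
  shows "is_weak_grad D (\<lambda>x. G (a x)) (\<lambda>x. G' (a x) *\<^sub>R b x)"
proof -
  have Dl: "D \<in> sets lebesgue" using D by simp
  define B0 where "B0 = max (max \<bar>l\<bar> \<bar>u\<bar>) B"
  have bd0: "AE x in lebesgue_on D. \<bar>a x\<bar> \<le> B0" "AE x in lebesgue_on D. norm (b x) \<le> B0"
    subgoal using lu(1) by eventually_elim (auto simp: B0_def)
    subgoal using bd by eventually_elim (auto simp: B0_def)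
    done
  have Gc: "continuous_on {l..u} G" using G DERIV_continuous continuous_on_eq_continuous_within by metis
  have "\<exists>c m. \<forall>t\<in>{l..u}. \<bar>G' t - (\<Sum>i\<le>m. c i * t ^ i)\<bar> < 1 / real (Suc n)" for n
  proof -
    obtain g where "real_polynomial_function g" "\<And>x. x \<in> {l..u} \<Longrightarrow> \<bar>G' x - g x\<bar> < 1 / real (Suc n)"
      using Stone_Weierstrass_real_polynomial_function[OF compact_Icc G', of "1 / real (Suc n)"] by auto
    moreover from this(1) obtain a k where "g = (\<lambda>x. \<Sum>i\<le>k. a i * x ^ i)"
      unfolding real_polynomial_function_iff_sum by auto
    ultimately show ?thesis by (intro exI[of _ a] exI[of _ k]) blast
  qed
  then obtain c m where cm: "\<And>n t. t \<in> {l..u} \<Longrightarrow> \<bar>G' t - (\<Sum>i\<le>m n. c n i * t ^ i)\<bar> < 1 / real (Suc n)"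
    by metis
  define P where "P n t = (\<Sum>i\<le>m n. c n i * t ^ i)" for n :: nat and t
  define Q0 where "Q0 n t = (\<Sum>i\<le>m n. (c n i / real (Suc i)) * t ^ Suc i)" for n :: nat and t
  \<comment> \<open>The integration constant makes \<open>Q n\<close> agree with \<open>G\<close> at
    \<open>l\<close>; the mean value inequality then turns the error of the derivative into an error
    of the values.\<close>
  define Q where "Q n t = Q0 n t + (G l - Q0 n l)" for n t
  have "(Q0 n has_real_derivative P n t) (at t within {l..u})" for n t
    unfolding Q0_def P_def by (auto intro!: derivative_eq_intros sum.cong simp del: power_Suc of_nat_Suc)
  then have Qd: "(Q n has_real_derivative P n t) (at t within {l..u})" for n t
    unfolding Q_def by (auto intro!: derivative_eq_intros)
  have QG: "\<bar>Q n t - G t\<bar> \<le> (1 / real (Suc n)) * (u - l)" if t: "t \<in> {l..u}" for n t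
  proof -
    have "norm ((Q n t - G t) - (Q n l - G l)) \<le> (1 / real (Suc n)) * norm (t - l)"
    proof (rule field_differentiable_bound[of "{l..u}"])
      show "((\<lambda>t. Q n t - G t) has_field_derivative (P n z - G' z)) (at z within {l..u})" if "z \<in> {l..u}" for z
        by (intro derivative_intros Qd G that)
      show "norm (P n z - G' z) \<le> 1 / real (Suc n)" if "z \<in> {l..u}" for z
        using cm[OF that, of n] by (simp add: P_def)
    qed (use t lu(2) in auto)
    also have "\<dots> \<le> (1 / real (Suc n)) * (u - l)" using t by (intro mult_left_mono) auto
    finally show ?thesis by (simp add: Q_def)
  qed
  have w: "is_weak_grad D (\<lambda>x. Q n (a x)) (\<lambda>x. P n (a x) *\<^sub>R b x)" for n
  proof -
    have "is_weak_grad D (\<lambda>x. (\<Sum>i\<le>m n. (c n i / real (Suc i)) * a x ^ Suc i) + (G l - Q0 n l))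
       (\<lambda>x. (\<Sum>i\<le>m n. (c n i / real (Suc i)) *\<^sub>R (real (Suc i) * a x ^ i) *\<^sub>R b x) + 0)"
      by (intro is_weak_grad_add is_weak_grad_sum is_weak_grad_scale is_weak_grad_power[OF D a bd0] is_weak_grad_const D) auto
    moreover have "(\<Sum>i\<le>m n. (c n i / real (Suc i)) *\<^sub>R (real (Suc i) * a x ^ i) *\<^sub>R b x) + 0 = P n (a x) *\<^sub>R b x" for x
      by (simp add: P_def scaleR_sum_left del: of_nat_Suc)
    ultimately show ?thesis by (simp add: Q_def Q0_def)
  qed
  have inv0: "(\<lambda>n. 1 / real (Suc n)) \<longlonglongrightarrow> 0" using LIMSEQ_inverse_real_of_nat by (simp add: inverse_eq_divide)
  have limQ: "(\<lambda>n. Q n t) \<longlonglongrightarrow> G t" if t: "t \<in> {l..u}" for t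
  proof (rule LIM_zero_cancel, rule Lim_null_comparison)
    show "\<forall>\<^sub>F n in sequentially. norm (Q n t - G t) \<le> (1 / real (Suc n)) * (u - l)" using QG[OF t] by simp
    show "(\<lambda>n. (1 / real (Suc n)) * (u - l)) \<longlonglongrightarrow> 0" using tendsto_mult_left_zero[OF inv0] .
  qed
  have limP: "(\<lambda>n. P n t) \<longlonglongrightarrow> G' t" if t: "t \<in> {l..u}" for t
  proof (rule LIM_zero_cancel, rule Lim_null_comparison[OF _ inv0])
    show "\<forall>\<^sub>F n in sequentially. norm (P n t - G' t) \<le> 1 / real (Suc n)"
      using cm[OF t] by (auto simp: P_def abs_minus_commute less_imp_le)
  qed
  obtain M where M: "\<And>t. t \<in> {l..u} \<Longrightarrow> \<bar>G t\<bar> \<le> M" "\<And>t. t \<in> {l..u} \<Longrightarrow> \<bar>G' t\<bar> \<le> M" "M \<ge> 0"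
  proof -
    have "bounded (G ` {l..u})" "bounded (G' ` {l..u})"
      using Gc G' by (auto intro: compact_imp_bounded compact_continuous_image)
    then obtain M1 M2 where "\<And>t. t \<in> {l..u} \<Longrightarrow> \<bar>G t\<bar> \<le> M1" "\<And>t. t \<in> {l..u} \<Longrightarrow> \<bar>G' t\<bar> \<le> M2"
      unfolding bounded_iff by fastforce
    then show thesis by (intro that[of "max (max M1 M2) 0"]) fastforce+
  qed
  have inv1: "1 / real (Suc n) \<le> 1" for n by simp
  have la: "a \<in> borel_measurable (lebesgue_on D)" "b \<in> borel_measurable (lebesgue_on D)"
    using locally_integrable_measurable[OF D(1)] is_weak_gradD(1,2)[OF a] by auto
  \<comment> \<open>\<open>G\<close> and \<open>G'\<close> are controlled only on the interval.
    Clamping the argument gives continuous functions on the line, hence Borel ones, which agree with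
    the originals almost everywhere after composition with \<open>a\<close>.\<close>
  define cl where "cl t = max l (min u t)" for t
  have clc: "continuous_on UNIV cl" unfolding cl_def by (intro continuous_intros)
  have clr: "cl t \<in> {l..u}" for t using lu(2) by (auto simp: cl_def)
  have cle: "cl t = t" if "t \<in> {l..u}" for t using that by (auto simp: cl_def)
  have "(\<lambda>t. G (cl t)) \<in> borel_measurable borel" "(\<lambda>t. G' (cl t)) \<in> borel_measurable borel"
    using clr by (auto intro!: borel_measurable_continuous_onI continuous_on_compose2[OF Gc clc] continuous_on_compose2[OF G' clc])
  then have mcl: "(\<lambda>x. G (cl (a x))) \<in> borel_measurable (lebesgue_on D)" "(\<lambda>x. G' (cl (a x))) \<in> borel_measurable (lebesgue_on D)"
    using la(1) measurable_compose by blast+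
  have mG: "(\<lambda>x. G (a x)) \<in> borel_measurable (lebesgue_on D)" "(\<lambda>x. G' (a x)) \<in> borel_measurable (lebesgue_on D)"
    subgoal by (rule measurable_leb_on_AE[OF mcl(1) _ Dl]) (use lu(1) in eventually_elim, simp add: cle)
    subgoal by (rule measurable_leb_on_AE[OF mcl(2) _ Dl]) (use lu(1) in eventually_elim, simp add: cle)
    done
  show ?thesis
  proof (rule is_weak_grad_limit[OF D(1) w, where U="\<lambda>x. M + (u - l)" and G="\<lambda>x. (M + 1) * B0"])
    show "AE x in lebesgue_on D. (\<lambda>n. Q n (a x)) \<longlonglongrightarrow> G (a x)" using lu(1) by eventually_elim (rule limQ)
    show "AE x in lebesgue_on D. (\<lambda>n. P n (a x) *\<^sub>R b x) \<longlonglongrightarrow> G' (a x) *\<^sub>R b x"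
      using lu(1) by eventually_elim (intro tendsto_intros limP)
    show "AE x in lebesgue_on D. \<bar>Q n (a x)\<bar> \<le> M + (u - l)" for n
      using lu(1)
    proof eventually_elim
      fix x assume x: "a x \<in> {l..u}"
      have "\<bar>Q n (a x) - G (a x)\<bar> \<le> 1 * (u - l)"
        by (rule order_trans[OF QG[OF x] mult_right_mono[OF inv1]]) (use lu in auto)
      then show "\<bar>Q n (a x)\<bar> \<le> M + (u - l)"
        using M(1)[OF x] abs_triangle_ineq2[of "Q n (a x)" "G (a x)"] by simp
    qed
    show "AE x in lebesgue_on D. norm (P n (a x) *\<^sub>R b x) \<le> (M + 1) * B0" for n
      using lu(1) bd0(2)
    proof eventually_elim
      fix x assume x: "a x \<in> {l..u}" "norm (b x) \<le> B0"
      have "\<bar>P n (a x)\<bar> \<le> M + 1" using cm[OF x(1), of n] M(2)[OF x(1)] inv1[of n] unfolding P_def by linarith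
      then show "norm (P n (a x) *\<^sub>R b x) \<le> (M + 1) * B0" using x(2) by (auto intro!: mult_mono)
    qed
    show "locally_integrable D (\<lambda>x. M + (u - l))" "locally_integrable D (\<lambda>x. (M + 1) * B0)"
      by (auto intro: continuous_locally_integrable)
    show "(\<lambda>x. G' (a x) *\<^sub>R b x) \<in> borel_measurable (lebesgue_on D)" using mG la by simp
  qed (use mG in auto)
qed

text \<open>
  The functions \<open>d a / (a + d)\<close> tend to \<open>0\<close> as \<open>d\<close> does, and their gradients tend to \<open>b\<close> on the zero set of \<open>a\<close>
  and to \<open>0\<close> elsewhere.
\<close>

lemma weak_grad_zero_set:
  assumes D: "open D" "bounded D" and a: "is_weak_grad D a b"
    and bd: "AE x in lebesgue_on D. norm (b x) \<le> B" and lu: "AE x in lebesgue_on D. a x \<in> {0..u}" "0 \<le> u"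
  shows "AE x in lebesgue_on D. a x = 0 \<longrightarrow> b x = 0"
proof -
  define d where "d n = 1 / real (Suc n)" for n
  have d: "d n > 0" for n by (simp add: d_def)
  have d0: "d \<longlonglongrightarrow> 0" unfolding d_def using LIMSEQ_inverse_real_of_nat by (simp add: inverse_eq_divide)
  have m: "a \<in> borel_measurable (lebesgue_on D)" "b \<in> borel_measurable (lebesgue_on D)"
    using locally_integrable_measurable[OF D(1)] is_weak_gradD(1,2)[OF a] by auto
  have w: "is_weak_grad D (\<lambda>x. d n * a x / (a x + d n)) (\<lambda>x. ((d n)\<^sup>2 / (a x + d n)\<^sup>2) *\<^sub>R b x)" for n
  proof (rule is_weak_grad_chain[OF D a bd lu, where G="\<lambda>s. d n * s / (s + d n)" and G'="\<lambda>s. (d n)\<^sup>2 / (s + d n)\<^sup>2"])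
    have pos: "t + d n > 0" if "t \<in> {0..u}" for t using that d[of n] by auto
    show "((\<lambda>s. d n * s / (s + d n)) has_real_derivative (d n)\<^sup>2 / (t + d n)\<^sup>2) (at t within {0..u})" if "t \<in> {0..u}" for t
      using pos[OF that] by (auto intro!: derivative_eq_intros simp: field_simps power2_eq_square)
    show "continuous_on {0..u} (\<lambda>s. (d n)\<^sup>2 / (s + d n)\<^sup>2)"
      using pos by (intro continuous_intros) force
  qed
  have "is_weak_grad D (\<lambda>x. 0) (\<lambda>x. (if a x = 0 then 1 else 0) *\<^sub>R b x)"
  proof (rule is_weak_grad_limit[OF D(1) w, where U="\<lambda>x. 1" and G="\<lambda>x. B"])
    show "AE x in lebesgue_on D. (\<lambda>n. d n * a x / (a x + d n)) \<longlonglongrightarrow> 0"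
      using lu(1)
    proof eventually_elim
      fix x assume x: "a x \<in> {0..u}"
      show "(\<lambda>n. d n * a x / (a x + d n)) \<longlonglongrightarrow> 0"
      proof (rule Lim_null_comparison[OF _ d0], rule always_eventually, rule allI)
        fix n
        have "d n * a x \<le> d n * (a x + d n)" using d[of n] by (intro mult_left_mono) auto
        then show "norm (d n * a x / (a x + d n)) \<le> d n" using x d[of n] by (simp add: divide_le_eq add_nonneg_pos)
      qed
    qed
    show "AE x in lebesgue_on D. (\<lambda>n. ((d n)\<^sup>2 / (a x + d n)\<^sup>2) *\<^sub>R b x) \<longlonglongrightarrow> (if a x = 0 then 1 else 0) *\<^sub>R b x"
      using lu(1)
    proof eventually_elim
      fix x assume x: "a x \<in> {0..u}"
      have "(\<lambda>n. (d n)\<^sup>2 / (a x + d n)\<^sup>2) \<longlonglongrightarrow> (if a x = 0 then 1 else 0)"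
      proof (cases "a x = 0")
        case True
        then show ?thesis using d by (simp add: less_imp_neq[symmetric])
      next
        case False
        have "(\<lambda>n. (d n)\<^sup>2 / (a x + d n)\<^sup>2) \<longlonglongrightarrow> 0\<^sup>2 / (a x + 0)\<^sup>2"
          using False by (intro tendsto_intros d0) auto
        then show ?thesis using False by simp
      qed
      then show "(\<lambda>n. ((d n)\<^sup>2 / (a x + d n)\<^sup>2) *\<^sub>R b x) \<longlonglongrightarrow> (if a x = 0 then 1 else 0) *\<^sub>R b x"
        by (intro tendsto_intros)
    qed
    show "AE x in lebesgue_on D. \<bar>d n * a x / (a x + d n)\<bar> \<le> 1" for n
      using lu(1)
    proof eventually_elim
      fix x assume x: "a x \<in> {0..u}"
      have d1: "d n \<le> 1" by (simp add: d_def)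
      have "d n * a x \<le> 1 * a x" using d1 x by (intro mult_right_mono) auto
      then show "\<bar>d n * a x / (a x + d n)\<bar> \<le> 1" using x d[of n] by (simp add: divide_le_eq add_nonneg_pos)
    qed
    show "AE x in lebesgue_on D. norm (((d n)\<^sup>2 / (a x + d n)\<^sup>2) *\<^sub>R b x) \<le> B" for n
      using lu(1) bd
    proof eventually_elim
      fix x assume x: "a x \<in> {0..u}" "norm (b x) \<le> B"
      have "(d n)\<^sup>2 \<le> (a x + d n)\<^sup>2" using x d[of n] by (intro power_mono) auto
      then have "(d n)\<^sup>2 / (a x + d n)\<^sup>2 \<le> 1" using x d[of n] by (simp add: divide_le_eq)
      then have "(d n)\<^sup>2 / (a x + d n)\<^sup>2 * norm (b x) \<le> 1 * norm (b x)" by (intro mult_right_mono) auto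
      then show "norm (((d n)\<^sup>2 / (a x + d n)\<^sup>2) *\<^sub>R b x) \<le> B" using x(2) by simp
    qed
    show "(\<lambda>x. (if a x = 0 then 1 else 0) *\<^sub>R b x) \<in> borel_measurable (lebesgue_on D)" using m by measurable
  qed (auto intro: continuous_locally_integrable)
  \<comment> \<open>The limit function is 0, so its weak gradient is also 0, and uniqueness makes
    \<open>b\<close> vanish wherever the indicator of the zero set is 1.\<close>
  from is_weak_grad_unique[OF D(1) this is_weak_grad_const[OF D(1)]]
  show ?thesis by eventually_elim auto
qed

text \<open>The indicator of the neighbourhood of radius 2 r is mollified at a radius below
  \<open>r\<close>: the result is 1 up to distance \<open>r\<close> from \<open>K\<close> and 0
  beyond 3 r, which is less than the distance \<open>d = 4 r\<close> to the complement of
  \<open>D\<close>. Being 1 near each point of \<open>K\<close>, it has zero derivatives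
  there.\<close>

lemma test_cutoff:
  fixes K :: "(real ^ 'd) set"
  assumes K: "compact K" "K \<subseteq> D" and D: "open D"
  obtains \<zeta> where "\<zeta> \<in> test_functions D" "\<And>x. x \<in> K \<Longrightarrow> \<zeta> x = 1" "\<And>x j. x \<in> K \<Longrightarrow> pderiv_at j \<zeta> x = 0"
proof -
  have "K \<inter> - D = {}" "closed (- D)" using D K(2) by auto
  then obtain d where d: "d > 0" "\<And>x y. x \<in> K \<Longrightarrow> y \<notin> D \<Longrightarrow> d \<le> dist x y"
    using separate_compact_closed[OF K(1), of "- D"] by fastforce
  define r where "r = d / 4"
  have r: "r > 0" using d(1) by (simp add: r_def)
  define S where "S s = {x + y | x y. x \<in> K \<and> y \<in> cball (0::real^'d) s}" for s
  have Sc: "compact (S s)" for s unfolding S_def using K(1) by (intro compact_sums) auto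
  have Sm: "x + y \<in> S s" if "x \<in> K" "norm y \<le> s" for x y s using that by (auto simp: S_def)
  have SD: "S (3 * r) \<subseteq> D"
  proof
    fix z assume "z \<in> S (3 * r)"
    then obtain x y where "z = x + y" "x \<in> K" "norm y \<le> 3 * r" by (auto simp: S_def)
    then show "z \<in> D" using d(2)[of x z] r by (force simp: r_def dist_norm)
  qed
  define u :: "real^'d \<Rightarrow> real" where "u = indicator (S (2 * r))"
  have ui: "integrable lborel u" unfolding u_def
    using Sc[of "2 * r"] emeasure_bounded_finite[OF compact_imp_bounded[OF Sc[of "2 * r"]]]
    by (intro integrable_real_indicator) (auto intro: borel_compact)
  obtain N where N: "1 / real (Suc N) < r" using r nat_approx_posE by metis
  have mz: "mol N z = 0" if "norm z \<ge> r" for z :: "real^'d"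
    using mollifierD(3)[OF mol[of N], of z] N that by auto
  have mk: "mollifier (1 / real (Suc N)) (mol N :: real ^ 'd \<Rightarrow> real)" by (rule mol)
  define \<zeta> where "\<zeta> = conv u (mol N)"
  have one: "\<zeta> z = 1" if z: "z \<in> ball x r" "x \<in> K" for x z
  proof -
    have eq: "u y * mol N (z - y) = mol N (z - y)" for y
    proof (cases "norm (z - y) < r")
      case True
      have "norm (y - x) \<le> norm (z - x) + norm (z - y)" using norm_triangle_ineq4[of "z - x" "z - y"] by simp
      then have "norm (y - x) \<le> 2 * r" using True z(1) by (simp add: dist_norm norm_minus_commute)
      then have "y \<in> S (2 * r)" using Sm[OF z(2), of "y - x" "2 * r"] by simp
      then show ?thesis by (simp add: u_def)
    qed (use mz in auto)
    show ?thesis unfolding \<zeta>_def conv_def eq by (rule mollifierD(6)[OF mk])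
  qed
  have zero: "z \<in> S (3 * r)" if z: "\<zeta> z \<noteq> 0" for z
  proof (rule ccontr)
    assume n: "z \<notin> S (3 * r)"
    have eq: "u y * mol N (z - y) = 0" for y
    proof (cases "norm (z - y) < r \<and> y \<in> S (2 * r)")
      case True
      then obtain x w where "y = x + w" "x \<in> K" "norm w \<le> 2 * r" by (auto simp: S_def)
      then have "z \<in> S (3 * r)" using Sm[of x "w + (z - y)" "3 * r"] norm_triangle_ineq[of w "z - y"] True by auto
      then show ?thesis using n by simp
    qed (use mz in \<open>auto simp: u_def\<close>)
    show False using z unfolding \<zeta>_def conv_def eq by simp
  qed
  have t: "\<zeta> \<in> test_functions D"
  proof (rule test_functionsI[OF _ SD])
    show "smooth_c \<zeta>" unfolding smooth_c_def
    proof (intro conjI allI)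
      show "Ck k \<zeta>" for k unfolding \<zeta>_def by (rule Ck_conv[OF ui smooth_c_mol])
      show "bounded {x. \<zeta> x \<noteq> 0}" by (rule bounded_subset[OF compact_imp_bounded[OF Sc[of "3 * r"]]]) (use zero in auto)
    qed
  qed (use zero Sc compact_imp_closed in auto)
  show thesis
  proof (rule that[OF t])
    show "\<zeta> x = 1" if "x \<in> K" for x using one[of x x] that r by simp
    show "pderiv_at j \<zeta> x = 0" if x: "x \<in> K" for x j
    proof -
      have "(\<zeta> has_derivative (\<lambda>h. 0)) (at x)"
        by (rule has_derivative_transform_within_open[of "\<lambda>x. 1" _ x UNIV "ball x r"]) (use one x r in auto)
      from has_derivative_imp_pderiv[OF this] show ?thesis .
    qed
  qed
qed

section \<open>Zero extension\<close>

text \<open>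
  A \<open>C\<^sup>1\<close> truncation of the identity: \<open>trunc d (a\<^sup>2)\<close> vanishes near the zeros of \<open>a\<close>, and it tends to \<open>a\<^sup>2\<close>
  together with its gradient as \<open>d\<close> tends to \<open>0\<close>.
\<close>

definition trunc :: "real \<Rightarrow> real \<Rightarrow> real" where "trunc d s = (max d s - d)\<^sup>2 / max d s"
definition trunc' :: "real \<Rightarrow> real \<Rightarrow> real" where "trunc' d s = 1 - d\<^sup>2 / (max d s)\<^sup>2"

text \<open>At \<open>s = d\<close> the branch (s - d)^2 / s vanishes to second order, so it meets
  the zero branch with equal value and slope.\<close>

lemma trunc_deriv:
  assumes d: "d > 0" shows "(trunc d has_real_derivative trunc' d s) (at s)"
proof -
  consider "s < d" | "s > d" | "s = d" by linarith
  then show ?thesis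
  proof cases
    case 1
    have "eventually (\<lambda>t. trunc d t = 0) (nhds s)"
      using eventually_nhds_in_open[of "{..<d}" s] 1 by (auto elim!: eventually_mono simp: trunc_def max_def)
    then show ?thesis using 1 d
      by (subst DERIV_cong_ev[OF refl _ refl, where g="\<lambda>x. 0"]) (auto simp: trunc'_def max_def)
  next
    case 2
    have ev: "eventually (\<lambda>t. trunc d t = (t - d)\<^sup>2 / t) (nhds s)"
      using eventually_nhds_in_open[of "{d<..}" s] 2 by (auto elim!: eventually_mono simp: trunc_def max_def)
    have "((\<lambda>t. (t - d)\<^sup>2 / t) has_real_derivative trunc' d s) (at s)"
      using 2 d by (auto intro!: derivative_eq_intros simp: trunc'_def max_def field_simps power2_eq_square)
    then show ?thesis using DERIV_cong_ev[OF refl ev refl] by simp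
  next
    case 3
    have "((\<lambda>h. (trunc d (d + h) - trunc d d) / h) \<longlongrightarrow> 0) (at 0)"
    proof (rule Lim_null_comparison)
      show "\<forall>\<^sub>F h in at 0. norm ((trunc d (d + h) - trunc d d) / h) \<le> \<bar>h\<bar> / d"
      proof (rule always_eventually, rule allI)
        fix h :: real
        show "norm ((trunc d (d + h) - trunc d d) / h) \<le> \<bar>h\<bar> / d"
        proof (cases "h > 0")
          case True
          have "h\<^sup>2 / (d + h) / h = h / (d + h)" using True by (simp add: power2_eq_square)
          also have "\<dots> \<le> h / d" using True d by (intro divide_left_mono) auto
          finally show ?thesis using True d by (simp add: trunc_def max_def)
        qed (use d in \<open>auto simp: trunc_def max_def divide_nonpos_pos\<close>)
      qed
      show "((\<lambda>h. \<bar>h\<bar> / d) \<longlongrightarrow> 0) (at 0)" using d by (auto intro!: tendsto_eq_intros)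
    qed
    then show ?thesis using 3 d by (simp add: DERIV_def trunc'_def max_def)
  qed
qed

lemma trunc'_cont: "d > 0 \<Longrightarrow> continuous_on S (trunc' d)"
  unfolding trunc'_def by (intro continuous_intros) (auto simp: max_def)

lemma trunc_bounds:
  assumes "d > 0"
  shows "0 \<le> trunc d s" "0 \<le> s \<Longrightarrow> trunc d s \<le> s" "0 \<le> trunc' d s" "trunc' d s \<le> 1"
    "0 \<le> s \<Longrightarrow> \<bar>trunc d s - s\<bar> \<le> 2 * d" "s \<le> d \<Longrightarrow> trunc d s = 0" "s \<le> d \<Longrightarrow> trunc' d s = 0"
proof -
  show "0 \<le> trunc d s" using assms by (auto simp: trunc_def max_def)
  have le: "d\<^sup>2 \<le> (max d s)\<^sup>2" using assms by (intro power_mono) auto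
  then show "0 \<le> trunc' d s" using assms by (simp add: trunc'_def divide_le_eq zero_less_power max_def)
  show "trunc' d s \<le> 1" by (simp add: trunc'_def)
  show z: "s \<le> d \<Longrightarrow> trunc d s = 0" "s \<le> d \<Longrightarrow> trunc' d s = 0" using assms by (auto simp: trunc_def trunc'_def max_def)
  assume s: "0 \<le> s"
  have e: "trunc d s = s - 2 * d + d\<^sup>2 / s" "0 \<le> d\<^sup>2 / s" "d\<^sup>2 / s \<le> d" if "s > d"
  proof -
    show "trunc d s = s - 2 * d + d\<^sup>2 / s" using that assms by (simp add: trunc_def max_def field_simps power2_eq_square)
    show "0 \<le> d\<^sup>2 / s" using that assms by simp
    have "d\<^sup>2 \<le> d * s" using that assms by (simp add: power2_eq_square)
    then show "d\<^sup>2 / s \<le> d" using that assms by (simp add: divide_le_eq)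
  qed
  show "trunc d s \<le> s" using e z s assms by (cases "s > d") auto
  show "\<bar>trunc d s - s\<bar> \<le> 2 * d" using e z s assms by (cases "s > d") auto
qed

lemma leb_on_zero_ext:
  fixes f :: "'a::euclidean_space \<Rightarrow> 'b::euclidean_space"
  assumes "T \<subseteq> S" "S \<in> sets lebesgue" "T \<in> sets lebesgue"
  shows "(LINT x|lebesgue_on S. (if x \<in> T then f x else 0)) = (LINT x|lebesgue_on T. f x)"
    and "integrable (lebesgue_on S) (\<lambda>x. if x \<in> T then f x else 0) \<longleftrightarrow> integrable (lebesgue_on T) f"
proof -
  show "(LINT x|lebesgue_on S. (if x \<in> T then f x else 0)) = (LINT x|lebesgue_on T. f x)"
    by (rule integral_restrict[OF assms(1,3,2)])
  have "(\<lambda>x. indicator S x *\<^sub>R (if x \<in> T then f x else 0)) = (\<lambda>x. indicator T x *\<^sub>R f x)"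
    using assms(1) by (auto simp: indicator_def fun_eq_iff)
  then show "integrable (lebesgue_on S) (\<lambda>x. if x \<in> T then f x else 0) \<longleftrightarrow> integrable (lebesgue_on T) f"
    using assms(2,3) by (simp only: integrable_restrict_space space_completion space_lborel space_borel Int_UNIV_right)
qed

text \<open>The support of a test function on \<open>Om\<close> meets \<open>S\<close> in a compact
  subset of \<open>D\<close>. A cutoff equal to 1 there turns the test function into one on
  \<open>D\<close> and leaves both integrals unchanged, since \<open>v\<close> and \<open>g\<close>
  vanish off \<open>S\<close>.\<close>

lemma is_weak_grad_ext_trunc:
  fixes v :: "real ^ 'd \<Rightarrow> real"
  assumes Om: "open Om" and D: "open D" "D \<subseteq> Om"
    and w: "is_weak_grad D v g" and i: "integrable (lebesgue_on D) v" "integrable (lebesgue_on D) g"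
    and S: "closed S" "S \<inter> Om \<subseteq> D" and z: "\<And>x. x \<in> D \<Longrightarrow> x \<notin> S \<Longrightarrow> v x = 0 \<and> g x = 0"
  shows "is_weak_grad Om (\<lambda>x. if x \<in> D then v x else 0) (\<lambda>x. if x \<in> D then g x else 0)"
proof -
  have ie: "integrable (lebesgue_on Om) (\<lambda>x. if x \<in> D then v x else 0)" "integrable (lebesgue_on Om) (\<lambda>x. if x \<in> D then g x else 0)"
    using leb_on_zero_ext(2)[OF D(2), of v] leb_on_zero_ext(2)[OF D(2), of g] i D Om by simp_all
  have "(LINT x|lebesgue_on Om. (if x \<in> D then v x else 0) * pderiv_at j \<phi> x) = - (LINT x|lebesgue_on Om. (if x \<in> D then g x else 0) $ j * \<phi> x)"
    if t: "\<phi> \<in> test_functions Om" for \<phi> j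
  proof -
    note sm = test_functionsD(1)[OF t]
    obtain K where K: "compact K" "K \<subseteq> Om" "\<And>x. x \<notin> K \<Longrightarrow> \<phi> x = 0 \<and> (\<forall>j. pderiv_at j \<phi> x = 0)"
      using test_functionsD(2)[OF t] by blast
    have K': "compact (K \<inter> S)" "K \<inter> S \<subseteq> D" using K S by auto
    obtain \<zeta> where \<zeta>: "\<zeta> \<in> test_functions D" "\<And>x. x \<in> K \<inter> S \<Longrightarrow> \<zeta> x = 1" "\<And>x j. x \<in> K \<inter> S \<Longrightarrow> pderiv_at j \<zeta> x = 0"
      by (rule test_cutoff[OF K' D(1)]) (rule that)
    note sz = test_functionsD(1)[OF \<zeta>(1)]
    obtain L where L: "compact L" "L \<subseteq> D" "\<And>x. x \<notin> L \<Longrightarrow> \<zeta> x = 0 \<and> (\<forall>j. pderiv_at j \<zeta> x = 0)"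
      using test_functionsD(2)[OF \<zeta>(1)] by blast
    have t': "(\<lambda>x. \<zeta> x * \<phi> x) \<in> test_functions D"
    proof (rule test_functionsI[OF _ L(2) compact_imp_closed[OF L(1)]])
      show "smooth_c (\<lambda>x. \<zeta> x * \<phi> x)"
        using sm sz unfolding smooth_c_def by (auto intro: Ck_mult elim: bounded_subset)
    qed (use L(3) in force)
    have pd: "v x * pderiv_at j (\<lambda>x. \<zeta> x * \<phi> x) x = v x * pderiv_at j \<phi> x" "g x $ j * (\<zeta> x * \<phi> x) = g x $ j * \<phi> x" if "x \<in> D" for x
    proof -
      have "pderiv_at j (\<lambda>x. \<zeta> x * \<phi> x) x = \<zeta> x * pderiv_at j \<phi> x + pderiv_at j \<zeta> x * \<phi> x"
        by (rule pderiv_mult[OF smooth_cD(2)[OF sz] smooth_cD(2)[OF sm]])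
      then show "v x * pderiv_at j (\<lambda>x. \<zeta> x * \<phi> x) x = v x * pderiv_at j \<phi> x" "g x $ j * (\<zeta> x * \<phi> x) = g x $ j * \<phi> x"
        using z[OF that] K(3)[of x] \<zeta>(2,3)[of x] by (cases "x \<in> S"; cases "x \<in> K"; simp)+
    qed
    have "(LINT x|lebesgue_on Om. (if x \<in> D then v x else 0) * pderiv_at j \<phi> x) = (LINT x|lebesgue_on D. (if x \<in> D then v x else 0) * pderiv_at j \<phi> x)"
      using D Om by (intro leb_on_support(1)) auto
    also have "\<dots> = (LINT x|lebesgue_on D. v x * pderiv_at j (\<lambda>x. \<zeta> x * \<phi> x) x)"
      by (intro Bochner_Integration.integral_cong refl) (simp add: pd)
    also have "\<dots> = - (LINT x|lebesgue_on D. g x $ j * (\<zeta> x * \<phi> x))" by (rule is_weak_gradD(3)[OF w t'])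
    also have "(LINT x|lebesgue_on D. g x $ j * (\<zeta> x * \<phi> x)) = (LINT x|lebesgue_on D. (if x \<in> D then g x else 0) $ j * \<phi> x)"
      by (intro Bochner_Integration.integral_cong refl) (simp add: pd)
    also have "\<dots> = (LINT x|lebesgue_on Om. (if x \<in> D then g x else 0) $ j * \<phi> x)"
      using D Om by (intro leb_on_support(1)[symmetric]) auto
    finally show ?thesis .
  qed
  then show ?thesis using locally_integrableI[OF ie(1) Om] locally_integrableI[OF ie(2) Om] by (auto simp: is_weak_grad_def)
qed

text \<open>By continuity of \<open>a\<close> and its vanishing on the part of the frontier inside
  \<open>Om\<close>, the set where the squared weight is at least \<open>d\<close> reaches no
  frontier point in \<open>Om\<close>. The truncated weight times \<open>p\<close> thus extends by
  zero, and \<open>d\<close> tends to 0 with domination by multiples of \<open>p\<close> and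
  \<open>q\<close>: smallness of the weight takes the place of boundary values of
  \<open>p\<close>.\<close>

lemma is_weak_grad_zero_ext:
  fixes a p :: "real ^ 'd \<Rightarrow> real"
  assumes Om: "open Om" and D: "open D" "bounded D" "D \<subseteq> Om"
    and a: "is_weak_grad D a b"
    and bd: "AE x in lebesgue_on D. \<bar>a x\<bar> \<le> B" "AE x in lebesgue_on D. norm (b x) \<le> B"
    and ac: "continuous_on (closure D) a" and a0: "\<And>x. x \<in> frontier D \<Longrightarrow> x \<in> Om \<Longrightarrow> a x = 0"
    and p: "is_weak_grad D p q" and ip: "integrable (lebesgue_on D) p" "integrable (lebesgue_on D) q"
  shows "is_weak_grad Om (\<lambda>x. if x \<in> D then (a x)\<^sup>2 * p x else 0)
           (\<lambda>x. if x \<in> D then (a x)\<^sup>2 *\<^sub>R q x + (2 * a x * p x) *\<^sub>R b x else 0)"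
proof -
  have Dl: "D \<in> sets lebesgue" using D by simp
  define d where "d n = 1 / real (Suc n)" for n
  have d: "d n > 0" for n by (simp add: d_def)
  have d0: "d \<longlonglongrightarrow> 0" unfolding d_def using LIMSEQ_inverse_real_of_nat by (simp add: inverse_eq_divide)
  \<comment> \<open>One constant for both bounds: the squared weight is at most
    \<open>B\<^sup>2\<close>, and its gradient has norm at most
    \<open>2 * B\<^sup>2\<close>.\<close>
  define C where "C = 2 * B\<^sup>2"
  have C0: "0 \<le> C" by (simp add: C_def)
  have sq: "AE x in lebesgue_on D. (a x)\<^sup>2 \<in> {0..C}"
    using bd(1)
  proof eventually_elim
    fix x assume "\<bar>a x\<bar> \<le> B"
    then have "(a x)\<^sup>2 \<le> B\<^sup>2" using power_mono[of "\<bar>a x\<bar>" B 2] by simp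
    moreover have "B\<^sup>2 \<le> C" by (simp add: C_def)
    ultimately show "(a x)\<^sup>2 \<in> {0..C}" by auto
  qed
  have bsq: "AE x in lebesgue_on D. norm ((2 * a x) *\<^sub>R b x) \<le> C"
    using bd
  proof eventually_elim
    fix x assume x: "\<bar>a x\<bar> \<le> B" "norm (b x) \<le> B"
    have "\<bar>a x\<bar> * norm (b x) \<le> B * B" using x by (intro mult_mono) auto
    then show "norm ((2 * a x) *\<^sub>R b x) \<le> C" by (simp add: C_def power2_eq_square abs_mult)
  qed
  have wsq: "is_weak_grad D (\<lambda>x. (a x)\<^sup>2) (\<lambda>x. (2 * a x) *\<^sub>R b x)"
    using is_weak_grad_power[OF D(1,2) a bd, of 1] by (simp add: numeral_2_eq_2)
  define v where "v n x = trunc (d n) ((a x)\<^sup>2) * p x" for n x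
  define g where "g n x = trunc (d n) ((a x)\<^sup>2) *\<^sub>R q x + p x *\<^sub>R trunc' (d n) ((a x)\<^sup>2) *\<^sub>R (2 * a x) *\<^sub>R b x" for n x
  have wm: "is_weak_grad D (\<lambda>x. trunc (d n) ((a x)\<^sup>2)) (\<lambda>x. trunc' (d n) ((a x)\<^sup>2) *\<^sub>R (2 * a x) *\<^sub>R b x)" for n
    by (rule is_weak_grad_chain[OF D(1,2) wsq bsq sq C0 has_field_derivative_at_within[OF trunc_deriv[OF d]] trunc'_cont[OF d]])
  have bm: "AE x in lebesgue_on D. \<bar>trunc (d n) ((a x)\<^sup>2)\<bar> \<le> C" for n
    using sq
  proof eventually_elim
    fix x assume "(a x)\<^sup>2 \<in> {0..C}"
    then show "\<bar>trunc (d n) ((a x)\<^sup>2)\<bar> \<le> C"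
      using trunc_bounds(1,2)[OF d[of n], of "(a x)\<^sup>2"] by simp
  qed
  have bm': "AE x in lebesgue_on D. norm (trunc' (d n) ((a x)\<^sup>2) *\<^sub>R (2 * a x) *\<^sub>R b x) \<le> C" for n
    using bsq
  proof eventually_elim
    fix x assume x: "norm ((2 * a x) *\<^sub>R b x) \<le> C"
    have "\<bar>trunc' (d n) ((a x)\<^sup>2)\<bar> * norm ((2 * a x) *\<^sub>R b x) \<le> 1 * norm ((2 * a x) *\<^sub>R b x)"
      using trunc_bounds(3,4)[OF d[of n], of "(a x)\<^sup>2"] by (intro mult_right_mono) auto
    then show "norm (trunc' (d n) ((a x)\<^sup>2) *\<^sub>R (2 * a x) *\<^sub>R b x) \<le> C"
      unfolding norm_scaleR[of "trunc' (d n) ((a x)\<^sup>2)"] using x by linarith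
  qed
  have wv: "is_weak_grad D (v n) (g n)" for n
    unfolding v_def g_def by (rule is_weak_grad_mult[OF D(1,2) wm p bm bm'])
  have mv: "v n \<in> borel_measurable (lebesgue_on D)" "g n \<in> borel_measurable (lebesgue_on D)" for n
    using locally_integrable_measurable[OF D(1)] is_weak_gradD(1,2)[OF wv] by auto
  have bv: "AE x in lebesgue_on D. \<bar>v n x\<bar> \<le> C * \<bar>p x\<bar>" for n
    using bm[of n] by eventually_elim (auto simp: v_def abs_mult intro: mult_right_mono)
  have bg: "AE x in lebesgue_on D. norm (g n x) \<le> C * norm (q x) + C * \<bar>p x\<bar>" for n
    using bm[of n] bm'[of n]
  proof eventually_elim
    fix x assume x: "\<bar>trunc (d n) ((a x)\<^sup>2)\<bar> \<le> C" "norm (trunc' (d n) ((a x)\<^sup>2) *\<^sub>R (2 * a x) *\<^sub>R b x) \<le> C"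
    have "norm (trunc (d n) ((a x)\<^sup>2) *\<^sub>R q x) \<le> C * norm (q x)" using x(1) by (auto intro: mult_right_mono)
    moreover have "norm (p x *\<^sub>R trunc' (d n) ((a x)\<^sup>2) *\<^sub>R (2 * a x) *\<^sub>R b x) \<le> \<bar>p x\<bar> * C"
      unfolding norm_scaleR[of "p x"] real_norm_def using x(2) by (intro mult_left_mono) auto
    ultimately show "norm (g n x) \<le> C * norm (q x) + C * \<bar>p x\<bar>"
      unfolding g_def by (intro order_trans[OF norm_triangle_ineq]) (simp add: mult.commute)
  qed
  have iv: "integrable (lebesgue_on D) (v n)" for n
  proof (rule Bochner_Integration.integrable_bound[of _ "\<lambda>x. C * \<bar>p x\<bar>"])
    show "AE x in lebesgue_on D. norm (v n x) \<le> norm (C * \<bar>p x\<bar>)"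
      using bv[of n] by eventually_elim (simp add: order_trans[OF _ abs_ge_self])
  qed (use ip mv in auto)
  have ig: "integrable (lebesgue_on D) (g n)" for n
  proof (rule Bochner_Integration.integrable_bound[of _ "\<lambda>x. C * norm (q x) + C * \<bar>p x\<bar>"])
    show "AE x in lebesgue_on D. norm (g n x) \<le> norm (C * norm (q x) + C * \<bar>p x\<bar>)"
      using bg[of n] by eventually_elim (simp add: order_trans[OF _ abs_ge_self])
  qed (use ip mv in auto)
  have we: "is_weak_grad Om (\<lambda>x. if x \<in> D then v n x else 0) (\<lambda>x. if x \<in> D then g n x else 0)" for n
  proof (rule is_weak_grad_ext_trunc[OF Om D(1,3) wv iv ig])
    let ?S = "closure D \<inter> (\<lambda>x. (a x)\<^sup>2) -` {d n..}"
    show "closed ?S"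
      by (rule continuous_on_closed_vimage[THEN iffD1, rule_format, of "closure D" "\<lambda>x. (a x)\<^sup>2", simplified Int_commute])
         (auto intro!: continuous_intros ac)
    show "?S \<inter> Om \<subseteq> D"
    proof
      fix x assume x: "x \<in> ?S \<inter> Om"
      show "x \<in> D"
      proof (rule ccontr)
        assume "x \<notin> D"
        then have "a x = 0" using x a0 D(1) by (auto simp: frontier_def interior_open)
        then show False using x d[of n] by auto
      qed
    qed
    show "v n x = 0 \<and> g n x = 0" if "x \<in> D" "x \<notin> ?S" for x
      using that closure_subset[of D] trunc_bounds(6,7)[OF d[of n], of "(a x)\<^sup>2"] by (auto simp: v_def g_def)
  qed
  have ext: "AE x in lebesgue_on D. P x \<Longrightarrow> AE x in lebesgue_on Om. x \<in> D \<longrightarrow> P x" for P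
    using Om D by (auto simp: AE_leb_on elim: eventually_mono)
  have iext: "integrable (lebesgue_on Om) (\<lambda>x. if x \<in> D then f x else 0)" if "integrable (lebesgue_on D) f" for f :: "real^'d \<Rightarrow> real"
    using leb_on_zero_ext(2)[OF D(3), of f] that D Om by simp
  have mext: "(\<lambda>x. if x \<in> D then f x else 0) \<in> borel_measurable (lebesgue_on Om)" if "f \<in> borel_measurable (lebesgue_on D)"
    for f :: "real^'d \<Rightarrow> 'c::euclidean_space"
    using borel_measurable_if_lebesgue_on[of D Om f] that D Om by simp
  have ma: "a \<in> borel_measurable (lebesgue_on D)" "b \<in> borel_measurable (lebesgue_on D)"
    using locally_integrable_measurable[OF D(1)] is_weak_gradD(1,2)[OF a] by auto
  show ?thesis
  proof (rule is_weak_grad_limit[OF Om we, where U="\<lambda>x. if x \<in> D then C * \<bar>p x\<bar> else 0" and G="\<lambda>x. if x \<in> D then C * norm (q x) + C * \<bar>p x\<bar> else 0"])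
    show "AE x in lebesgue_on Om. \<bar>if x \<in> D then v n x else 0\<bar> \<le> (if x \<in> D then C * \<bar>p x\<bar> else 0)" for n
      using ext[OF bv[of n]] by eventually_elim auto
    show "AE x in lebesgue_on Om. norm (if x \<in> D then g n x else 0) \<le> (if x \<in> D then C * norm (q x) + C * \<bar>p x\<bar> else 0)" for n
      using ext[OF bg[of n]] by eventually_elim auto
    show "locally_integrable Om (\<lambda>x. if x \<in> D then C * \<bar>p x\<bar> else 0)"
      by (intro locally_integrableI[OF iext Om]) (use ip in auto)
    show "locally_integrable Om (\<lambda>x. if x \<in> D then C * norm (q x) + C * \<bar>p x\<bar> else 0)"
      by (intro locally_integrableI[OF iext Om]) (use ip in auto)
    show "(\<lambda>x. if x \<in> D then (a x)\<^sup>2 * p x else 0) \<in> borel_measurable (lebesgue_on Om)"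
      by (rule mext) (use ma ip in measurable)
    show "(\<lambda>x. if x \<in> D then (a x)\<^sup>2 *\<^sub>R q x + (2 * a x * p x) *\<^sub>R b x else 0) \<in> borel_measurable (lebesgue_on Om)"
      by (rule mext) (use ma ip in measurable)
    have lt: "(\<lambda>n. trunc (d n) s) \<longlonglongrightarrow> s" if "0 \<le> s" for s
    proof (rule LIM_zero_cancel, rule Lim_null_comparison)
      show "\<forall>\<^sub>F n in sequentially. norm (trunc (d n) s - s) \<le> 2 * d n" using trunc_bounds(5)[OF d that] by simp
      show "(\<lambda>n. 2 * d n) \<longlonglongrightarrow> 0" using d0 by (rule tendsto_mult_right_zero)
    qed
    \<comment> \<open>Pointwise convergence of the truncated gradient also on the zero set: there
      \<open>trunc'\<close> stays 0, but so does the factor \<open>2 * s\<close> in the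
      limit.\<close>
    have lt': "(\<lambda>n. trunc' (d n) (s\<^sup>2) *\<^sub>R (2 * s) *\<^sub>R y) \<longlonglongrightarrow> (2 * s) *\<^sub>R y" for s and y :: "real^'d"
    proof (cases "s = 0")
      case False
      then have s: "s\<^sup>2 > 0" by simp
      have "(\<lambda>n. max (d n) (s\<^sup>2)) \<longlonglongrightarrow> max 0 (s\<^sup>2)" by (intro tendsto_intros d0)
      then have m: "(\<lambda>n. max (d n) (s\<^sup>2)) \<longlonglongrightarrow> s\<^sup>2" using s by simp
      have "(\<lambda>n. trunc' (d n) (s\<^sup>2)) \<longlonglongrightarrow> 1 - 0\<^sup>2 / (s\<^sup>2)\<^sup>2"
        unfolding trunc'_def by (intro tendsto_intros d0 m) (use s in simp)
      then have "(\<lambda>n. trunc' (d n) (s\<^sup>2)) \<longlonglongrightarrow> 1" by simp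
      from tendsto_scaleR[OF this tendsto_const[of "(2 * s) *\<^sub>R y"]] show ?thesis unfolding scaleR_one .
    qed auto
    show "AE x in lebesgue_on Om. (\<lambda>n. if x \<in> D then v n x else 0) \<longlonglongrightarrow> (if x \<in> D then (a x)\<^sup>2 * p x else 0)"
      by (rule AE_I2) (auto simp: v_def intro!: tendsto_intros lt)
    have "(\<lambda>n. g n x) \<longlonglongrightarrow> (a x)\<^sup>2 *\<^sub>R q x + p x *\<^sub>R (2 * a x) *\<^sub>R b x" for x
      unfolding g_def by (intro tendsto_intros lt lt') simp
    then show "AE x in lebesgue_on Om. (\<lambda>n. if x \<in> D then g n x else 0) \<longlonglongrightarrow>
       (if x \<in> D then (a x)\<^sup>2 *\<^sub>R q x + (2 * a x * p x) *\<^sub>R b x else 0)"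
      by (intro AE_I2) (simp add: mult_ac)
  qed
qed

section \<open>Lipschitz domains\<close>

lemma lipschitz_domainD:
  assumes "lipschitz_domain D" shows "open D" "connected D" "bounded D" "D \<noteq> {}"
  using assms by (auto simp: lipschitz_domain_def)

lemma lipschitz_domain_epigraph:
  fixes D :: "(real ^ 'd) set"
  assumes "lipschitz_domain D" "x \<in> frontier D"
  obtains \<nu> r L and g :: "real ^ 'd \<Rightarrow> real" where "norm \<nu> = 1" "0 < r" "0 \<le> L"
    "\<And>y z. \<bar>g y - g z\<bar> \<le> L * norm (y - z)"
    "\<And>y. y \<in> ball x r \<Longrightarrow> y \<in> D \<longleftrightarrow> g (y - (y \<bullet> \<nu>) *\<^sub>R \<nu>) < y \<bullet> \<nu>"
proof -
  obtain \<nu> r L g where *: "norm \<nu> = 1" "0 < r" "L-lipschitz_on UNIV (g :: real ^ 'd \<Rightarrow> real)"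
    "\<forall>y\<in>ball x r. y \<in> D \<longleftrightarrow> g (y - (y \<bullet> \<nu>) *\<^sub>R \<nu>) < y \<bullet> \<nu>"
    using assms unfolding lipschitz_domain_def by blast
  show thesis
    by (rule that[of \<nu> r L g])
       (use * lipschitz_onD[OF *(3)] lipschitz_on_nonneg[OF *(3)] in \<open>auto simp: dist_norm\<close>)
qed

definition ortho :: "real ^ 'd \<Rightarrow> real ^ 'd \<Rightarrow> real ^ 'd" where "ortho \<nu> y = y - (y \<bullet> \<nu>) *\<^sub>R \<nu>"

lemma ortho_simps:
  assumes "norm \<nu> = 1"
  shows "ortho \<nu> (y + t *\<^sub>R \<nu>) = ortho \<nu> y" "(y + t *\<^sub>R \<nu>) \<bullet> \<nu> = y \<bullet> \<nu> + t"
    "norm (ortho \<nu> y - ortho \<nu> z) \<le> norm (y - z)" "\<bar>y \<bullet> \<nu> - z \<bullet> \<nu>\<bar> \<le> norm (y - z)"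
proof -
  have n: "\<nu> \<bullet> \<nu> = 1" using assms by (simp add: dot_square_norm)
  show 1: "(y + t *\<^sub>R \<nu>) \<bullet> \<nu> = y \<bullet> \<nu> + t" by (simp add: inner_add_left n)
  show "ortho \<nu> (y + t *\<^sub>R \<nu>) = ortho \<nu> y" unfolding ortho_def 1 by (simp add: algebra_simps)
  have "(norm (ortho \<nu> y - ortho \<nu> z))\<^sup>2 = (norm (y - z))\<^sup>2 - ((y - z) \<bullet> \<nu>)\<^sup>2"
    unfolding power2_norm_eq_inner ortho_def
    by (simp add: inner_diff_left inner_diff_right n inner_commute power2_eq_square algebra_simps)
  then have "(norm (ortho \<nu> y - ortho \<nu> z))\<^sup>2 \<le> (norm (y - z))\<^sup>2" by simp
  then show "norm (ortho \<nu> y - ortho \<nu> z) \<le> norm (y - z)" by (rule power2_le_imp_le) simp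
  show "\<bar>y \<bullet> \<nu> - z \<bullet> \<nu>\<bar> \<le> norm (y - z)"
    using Cauchy_Schwarz_ineq2[of "y - z" \<nu>] assms by (simp add: inner_diff_left)
qed

text \<open>A quantitative substitute for convexity: the straight segment between two nearby points
  of a Lipschitz domain may leave it, but a polygon of comparable length does not.\<close>

definition three_segments :: "(real ^ 'd) set \<Rightarrow> real \<Rightarrow> real ^ 'd \<Rightarrow> real ^ 'd \<Rightarrow> bool" where
  "three_segments S K y z \<longleftrightarrow> (\<exists>p q. closed_segment y p \<subseteq> S \<and> closed_segment p q \<subseteq> S \<and> closed_segment q z \<subseteq> S \<and>
     norm (y - p) \<le> K * norm (y - z) \<and> norm (p - q) \<le> K * norm (y - z) \<and> norm (q - z) \<le> K * norm (y - z))"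

text \<open>Near a boundary point, two points of the epigraph are joined by lifting both of them in the direction
  \<open>\<nu>\<close> by a multiple of their distance.\<close>

lemma lipschitz_domain_three_segments:
  fixes D :: "(real ^ 'd) set"
  assumes D: "lipschitz_domain D" and x: "x \<in> closure D"
  shows "\<exists>r K. 0 < r \<and> 0 \<le> K \<and> (\<forall>y\<in>D \<inter> ball x r. \<forall>z\<in>D \<inter> ball x r. three_segments D K y z)"
proof (cases "x \<in> D")
  case True
  then obtain r where r: "r > 0" "ball x r \<subseteq> D" using lipschitz_domainD(1)[OF D] open_contains_ball by blast
  have "three_segments D 1 y z" if "y \<in> D \<inter> ball x r" "z \<in> D \<inter> ball x r" for y z
  proof -
    have "closed_segment y z \<subseteq> ball x r" using that by (intro closed_segment_subset) auto
    then show ?thesis unfolding three_segments_def using r that by (intro exI[of _ y] exI[of _ z]) auto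
  qed
  then show ?thesis using r(1) by (intro exI[of _ r] exI[of _ 1]) auto
next
  case False
  then have xf: "x \<in> frontier D" using x lipschitz_domainD(1)[OF D] by (simp add: frontier_def interior_open)
  obtain \<nu> r L and g :: "real ^ 'd \<Rightarrow> real" where \<nu>: "norm \<nu> = 1" and r: "0 < r" and L: "0 \<le> L"
    and gL: "\<And>y z. \<bar>g y - g z\<bar> \<le> L * norm (y - z)"
    and ep: "\<And>y. y \<in> ball x r \<Longrightarrow> y \<in> D \<longleftrightarrow> g (y - (y \<bullet> \<nu>) *\<^sub>R \<nu>) < y \<bullet> \<nu>"
    by (rule lipschitz_domain_epigraph[OF D xf]) (rule that)
  note o = ortho_simps[OF \<nu>]
  have ep': "y \<in> D \<longleftrightarrow> g (ortho \<nu> y) < y \<bullet> \<nu>" if "y \<in> ball x r" for y using ep[OF that] by (simp add: ortho_def)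
  \<comment> \<open>Points of the smaller ball are at most 2 r' apart, so the lift is at most 2 (L +
    1) r'; together with r' this is (2 L + 3) r', which is less than \<open>r\<close>. All lifted
    points stay where the graph description is valid.\<close>
  define r' where "r' = r / (2 * L + 4)"
  have r': "0 < r'" "r' * (2 * L + 4) = r" using r L by (auto simp: r'_def)
  have "three_segments D (L + 1) y z" if y: "y \<in> D" "y \<in> ball x r'" and z: "z \<in> D" "z \<in> ball x r'" for y z
  proof -
    define d where "d = norm (y - z)"
    \<comment> \<open>Between \<open>y\<close> and a point of the segment the graph rises by at most
      L d and the height drops by at most \<open>d\<close>; the lift (L + 1) d compensates
      both.\<close>
    define s where "s = (L + 1) * d"
    have d: "0 \<le> d" "d \<le> 2 * r'"
      using norm_triangle_ineq4[of "y - x" "z - x"] y z by (auto simp: d_def dist_norm norm_minus_commute)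
    have s: "0 \<le> s" "s \<le> (L + 1) * (2 * r')" using d L by (auto simp: s_def intro!: mult_left_mono)
    have rs: "r' + s < r"
    proof -
      have "r' + s \<le> r' * (2 * L + 3)" using s by (simp add: algebra_simps)
      also have "\<dots> < r" using r' by (simp add: algebra_simps)
      finally show ?thesis .
    qed
    have inb: "w + t *\<^sub>R \<nu> \<in> ball x r" if "w \<in> ball x r'" "0 \<le> t" "t \<le> s" for w t
    proof -
      have "dist x (w + t *\<^sub>R \<nu>) \<le> dist x w + norm (t *\<^sub>R \<nu>)"
        using dist_triangle[of x "w + t *\<^sub>R \<nu>" w] by (simp add: dist_norm)
      also have "\<dots> < r" using that rs \<nu> by simp
      finally show ?thesis by simp
    qed
    have vert: "closed_segment w (w + s *\<^sub>R \<nu>) \<subseteq> D" if w: "w \<in> D" "w \<in> ball x r'" for w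
    proof
      fix v assume "v \<in> closed_segment w (w + s *\<^sub>R \<nu>)"
      then obtain t where t: "0 \<le> t" "t \<le> 1" "v = (1 - t) *\<^sub>R w + t *\<^sub>R (w + s *\<^sub>R \<nu>)" by (auto simp: in_segment)
      then have v: "v = w + (t * s) *\<^sub>R \<nu>" by (simp add: algebra_simps)
      have ts: "0 \<le> t * s" "t * s \<le> s" using t s by (auto simp: mult_left_le_one_le)
      have "w \<in> ball x r" using w(2) r' L s rs by auto
      then have "g (ortho \<nu> w) < w \<bullet> \<nu>" using ep' w(1) by blast
      then show "v \<in> D" using ep'[OF inb[OF w(2) ts]] ts unfolding v o by linarith
    qed
    have hor: "closed_segment (y + s *\<^sub>R \<nu>) (z + s *\<^sub>R \<nu>) \<subseteq> D"
    proof
      fix v assume "v \<in> closed_segment (y + s *\<^sub>R \<nu>) (z + s *\<^sub>R \<nu>)"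
      then obtain t where t: "0 \<le> t" "t \<le> 1" "v = (1 - t) *\<^sub>R (y + s *\<^sub>R \<nu>) + t *\<^sub>R (z + s *\<^sub>R \<nu>)" by (auto simp: in_segment)
      define w where "w = (1 - t) *\<^sub>R y + t *\<^sub>R z"
      have v: "v = w + s *\<^sub>R \<nu>" using t(3) by (simp add: w_def algebra_simps)
      have wb: "w \<in> ball x r'" using convexD_alt[OF convex_ball, of y x r' z t] y z t by (simp add: w_def)
      have "w - y = t *\<^sub>R (z - y)" by (simp add: w_def algebra_simps)
      then have wy: "norm (w - y) \<le> d" using t d by (simp add: d_def norm_minus_commute mult_left_le_one_le)
      have "y \<in> ball x r" using y(2) s rs by auto
      then have "g (ortho \<nu> y) < y \<bullet> \<nu>" using ep' y(1) by blast
      moreover have "g (ortho \<nu> w) \<le> g (ortho \<nu> y) + L * d"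
      proof -
        have "L * norm (ortho \<nu> w - ortho \<nu> y) \<le> L * d" using o(3)[of w y] wy L by (intro mult_left_mono) auto
        then show ?thesis using gL[of "ortho \<nu> w" "ortho \<nu> y"] by linarith
      qed
      moreover have "y \<bullet> \<nu> - d \<le> w \<bullet> \<nu>" using o(4)[of w y] wy by linarith
      ultimately have "g (ortho \<nu> w) < w \<bullet> \<nu> + s" by (simp add: s_def algebra_simps)
      then show "v \<in> D" using ep'[OF inb[OF wb s(1)]] unfolding v o by auto
    qed
    have "s = (L + 1) * norm (y - z)" "norm (y - z) \<le> (L + 1) * norm (y - z)"
      using L by (auto simp: s_def d_def distrib_right)
    then show ?thesis
      unfolding three_segments_def
      using vert[OF y] vert[OF z] hor \<nu> s(1)
      by (intro exI[of _ "y + s *\<^sub>R \<nu>"] exI[of _ "z + s *\<^sub>R \<nu>"]) (auto simp: closed_segment_commute)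
  qed
  then show ?thesis using r'(1) L by (intro exI[of _ r'] exI[of _ "L + 1"]) auto
qed

text \<open>Moving from \<open>x\<close> against \<open>\<nu>\<close> leads strictly below the
  graph, where a whole ball misses \<open>D\<close>. This excludes slits: a frontier point is a
  limit of points outside the closure, not only outside \<open>D\<close>.\<close>

lemma lipschitz_domain_exterior:
  fixes D :: "(real ^ 'd) set"
  assumes D: "lipschitz_domain D" and x: "x \<in> frontier D" and e: "e > 0"
  shows "\<exists>y\<in>ball x e. y \<notin> closure D"
proof -
  obtain \<nu> r L and g :: "real ^ 'd \<Rightarrow> real" where \<nu>: "norm \<nu> = 1" and r: "0 < r" and L: "0 \<le> L"
    and gL: "\<And>y z. \<bar>g y - g z\<bar> \<le> L * norm (y - z)"
    and ep: "\<And>y. y \<in> ball x r \<Longrightarrow> y \<in> D \<longleftrightarrow> g (y - (y \<bullet> \<nu>) *\<^sub>R \<nu>) < y \<bullet> \<nu>"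
    by (rule lipschitz_domain_epigraph[OF D x]) (rule that)
  note o = ortho_simps[OF \<nu>]
  have ep': "y \<in> D \<longleftrightarrow> g (ortho \<nu> y) < y \<bullet> \<nu>" if "y \<in> ball x r" for y using ep[OF that] by (simp add: ortho_def)
  have "x \<notin> D" using x lipschitz_domainD(1)[OF D] by (simp add: frontier_def interior_open)
  then have xg: "x \<bullet> \<nu> \<le> g (ortho \<nu> x)" using ep'[of x] r by auto
  define t where "t = min e r / 2"
  have t: "0 < t" "t < e" "2 * t \<le> r" using e r by (auto simp: t_def)
  \<comment> \<open>The descent by \<open>t\<close> pays exactly for the tilt L d of the graph and
    the height change \<open>d\<close> within the ball.\<close>
  define d where "d = t / (L + 1)"
  have d: "0 < d" "d \<le> t" "(L + 1) * d = t" using t L by (auto simp: d_def divide_le_eq distrib_left mult_nonneg_nonneg)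
  define y where "y = x + (- t) *\<^sub>R \<nu>"
  have oy: "ortho \<nu> y = ortho \<nu> x" unfolding y_def by (rule o(1))
  have yn: "y \<bullet> \<nu> = x \<bullet> \<nu> - t" using o(2)[of x "- t"] by (simp add: y_def)
  have "ball y d \<inter> D = {}"
  proof -
    have False if m: "m \<in> ball y d" "m \<in> D" for m
    proof -
      have my: "norm (m - y) < d" using m(1) by (simp add: dist_norm norm_minus_commute)
      have "dist x m \<le> dist x y + dist y m" by (rule dist_triangle)
      also have "dist x y = t" using t \<nu> by (simp add: y_def dist_norm)
      also have "dist y m < d" using m(1) by simp
      finally have "m \<in> ball x r" using d t by simp
      then have g: "g (ortho \<nu> m) < m \<bullet> \<nu>" using ep' m(2) by blast
      have "L * norm (ortho \<nu> m - ortho \<nu> y) \<le> L * d" using o(3)[of m y] my L by (intro mult_left_mono) auto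
      then have 1: "g (ortho \<nu> x) - L * d \<le> g (ortho \<nu> m)"
        using gL[of "ortho \<nu> m" "ortho \<nu> y"] unfolding oy by linarith
      have 2: "m \<bullet> \<nu> < x \<bullet> \<nu> - t + d" using o(4)[of m y] my yn by linarith
      have "L * d + d = t" using d(3) by (simp add: algebra_simps)
      then show False using 1 2 g xg by linarith
    qed
    then show ?thesis by auto
  qed
  then have "y \<notin> closure D" using d(1) by (metis centre_in_ball closure_iff_nhds_not_empty disjoint_iff inf_commute open_ball order_refl)
  moreover have "y \<in> ball x e" using t \<nu> by (simp add: y_def dist_norm)
  ultimately show ?thesis by blast
qed

text \<open>The polygon as a connected set, in the form used to force a crossing of a frontier. The
  bound is the sum of the three lengths.\<close>

lemma three_segments_subset:
  assumes "three_segments S K y z"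
  obtains P where "connected P" "P \<subseteq> S" "y \<in> P" "z \<in> P" "\<And>w. w \<in> P \<Longrightarrow> norm (w - y) \<le> 3 * (K * norm (y - z))"
proof -
  obtain p q where pq: "closed_segment y p \<subseteq> S" "closed_segment p q \<subseteq> S" "closed_segment q z \<subseteq> S"
     "norm (y - p) \<le> K * norm (y - z)" "norm (p - q) \<le> K * norm (y - z)" "norm (q - z) \<le> K * norm (y - z)"
    using assms unfolding three_segments_def by blast
  show thesis
  proof (rule that[of "closed_segment y p \<union> (closed_segment p q \<union> closed_segment q z)"])
    show "connected (closed_segment y p \<union> (closed_segment p q \<union> closed_segment q z))"
      by (intro connected_Un connected_segment) (auto intro: ends_in_segment)
    fix w assume w: "w \<in> closed_segment y p \<union> (closed_segment p q \<union> closed_segment q z)"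
    have a: "norm (w - y) \<le> norm (w - c) + norm (c - y)" for c using norm_triangle_ineq[of "w - c" "c - y"] by simp
    have pq': "norm (q - y) \<le> norm (y - p) + norm (p - q)"
      using norm_triangle_ineq[of "p - y" "q - p"] by (simp add: norm_minus_commute)
    from w consider "w \<in> closed_segment y p" | "w \<in> closed_segment p q" | "w \<in> closed_segment q z" by blast
    then show "norm (w - y) \<le> 3 * (K * norm (y - z))"
    proof cases
      case 1
      then have "norm (w - y) \<le> norm (p - y)" using segment_bound(1)[of w y p] by simp
      moreover have "norm (p - y) = norm (y - p)" "0 \<le> K * norm (y - z)"
        using order_trans[OF norm_ge_zero pq(4)] by (auto simp: norm_minus_commute)
      ultimately show ?thesis using pq(4) by linarith
    next
      case 2
      then have "norm (w - p) \<le> norm (q - p)" using segment_bound(1)[of w p q] by simp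
      moreover have "norm (p - y) = norm (y - p)" "norm (q - p) = norm (p - q)" "0 \<le> K * norm (y - z)"
        using order_trans[OF norm_ge_zero pq(4)] by (auto simp: norm_minus_commute)
      ultimately show ?thesis using pq(4,5) a[of p] by linarith
    next
      case 3
      then have "norm (w - q) \<le> norm (z - q)" using segment_bound(1)[of w q z] by simp
      moreover have "norm (z - q) = norm (q - z)" by (simp add: norm_minus_commute)
      ultimately show ?thesis using pq(4,5,6) pq' a[of q] by linarith
    qed
  qed (use pq in auto)
qed

section \<open>Continuous representatives of functions with bounded weak gradient\<close>

lemma onorm_pderiv_le:
  fixes f :: "real ^ 'd \<Rightarrow> real"
  assumes d: "f differentiable (at x)" and B: "\<And>j. \<bar>pderiv_at j f x\<bar> \<le> B"
  shows "onorm (frechet_derivative f (at x)) \<le> real CARD('d) * B"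
proof (rule onorm_le)
  fix h :: "real ^ 'd"
  have "\<bar>\<Sum>j\<in>UNIV. h $ j * pderiv_at j f x\<bar> \<le> (\<Sum>j\<in>(UNIV :: 'd set). norm h * B)"
    by (intro sum_abs[THEN order_trans] sum_mono) (auto simp: abs_mult intro!: mult_mono component_le_norm_cart B)
  then show "norm (frechet_derivative f (at x) h) \<le> real CARD('d) * B * norm h"
    using pderiv_expand[OF d] by (simp add: mult_ac)
qed

lemma AE_borel_rep_bound:
  assumes "D \<in> sets lebesgue" "AE x in lebesgue_on D. \<bar>a x\<bar> \<le> (B::real)" "AE x in lebesgue_on D. a x = a' x" "\<And>x. x \<notin> D \<Longrightarrow> a' x = 0" "0 \<le> B"
  shows "AE x in lborel. \<bar>a' x\<bar> \<le> B"
proof -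
  have "AE x in lebesgue. x \<in> D \<longrightarrow> \<bar>a x\<bar> \<le> B" "AE x in lebesgue. x \<in> D \<longrightarrow> a x = a' x"
    using assms by (simp_all add: AE_leb_on)
  then have "AE x in lebesgue. \<bar>a' x\<bar> \<le> B"
  proof eventually_elim
    case (elim x)
    then show ?case using assms(4)[of x] assms(5) by (cases "x \<in> D") auto
  qed
  then show ?thesis by (simp add: AE_completion_iff)
qed

text \<open>A nonempty open set is not negligible, so a property holding almost everywhere holds at
  points arbitrarily close to any given one.\<close>

lemma AE_dense:
  assumes D: "open D" and ae: "AE x in lebesgue_on D. P x" and x: "x \<in> D" and e: "e > 0"
  shows "\<exists>y. y \<in> D \<inter> ball x e \<and> P (y :: 'a::euclidean_space)"
proof (rule ccontr)
  assume n: "\<not> ?thesis"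
  have "AE y in lebesgue. y \<notin> D \<inter> ball x e"
    using ae D by (simp add: AE_leb_on) (use n in \<open>auto elim!: eventually_mono\<close>)
  moreover have o: "open (D \<inter> ball x e)" using D by auto
  ultimately have "D \<inter> ball x e \<in> null_sets lebesgue"
    using AE_iff_null_sets[of "D \<inter> ball x e" lebesgue] sets_leb_open[OF o] by simp
  then have "negligible (D \<inter> ball x e)" by (simp add: negligible_iff_null_sets)
  moreover have "D \<inter> ball x e \<noteq> {}" using x e by auto
  ultimately show False using open_not_negligible[OF o] by blast
qed

text \<open>Mollifications of a function with bounded weak gradient are uniformly Lipschitz on segments inside the domain.\<close>

lemma bounded_weak_grad_segments:
  fixes a :: "real ^ 'd \<Rightarrow> real"
  assumes D: "open D" "bounded D" and a: "is_weak_grad D a b"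
    and bd: "AE x in lebesgue_on D. \<bar>a x\<bar> \<le> B" "AE x in lebesgue_on D. norm (b x) \<le> B" "0 \<le> B"
  obtains f M where "0 \<le> M" "AE x in lebesgue_on D. a x = f x"
    "\<And>y z. closed_segment y z \<subseteq> D \<Longrightarrow> \<bar>f y - f z\<bar> \<le> M * norm (y - z)"
proof -
  have Dl: "D \<in> sets lebesgue" and Db: "D \<in> sets borel" using D by simp_all
  note la = is_weak_gradD(1,2)[OF a]
  have ma: "a \<in> borel_measurable (lebesgue_on D)" "b \<in> borel_measurable (lebesgue_on D)"
    using locally_integrable_measurable D(1) la by auto
  have ia: "integrable (lebesgue_on D) a" "integrable (lebesgue_on D) b"
    using ma bd by (auto intro!: bounded_integrable_leb_on[OF Dl D(2)])
  have bj: "integrable (lebesgue_on D) (\<lambda>x. b x $ j)" "AE x in lebesgue_on D. \<bar>b x $ j\<bar> \<le> B" for j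
    using integrable_bounded_linear[OF bounded_linear_vec_nth ia(2)] bd(2)
    by (auto elim!: eventually_mono intro: order_trans[OF component_le_norm_cart])
  obtain a' where a': "integrable lborel a'" "\<And>x. x \<notin> D \<Longrightarrow> a' x = 0" "AE x in lebesgue_on D. a x = a' x"
    "\<And>g. g \<in> borel_measurable borel \<Longrightarrow> (LINT x|lborel. a' x * g x) = (LINT x|lebesgue_on D. a x * g x)"
    by (rule borel_rep[OF ia(1) Db]) (rule that)
  have "\<exists>b'. integrable lborel b' \<and> (AE x in lborel. \<bar>b' x\<bar> \<le> B) \<and>
    (\<forall>g. g \<in> borel_measurable borel \<longrightarrow> (LINT x|lborel. b' x * g x) = (LINT x|lebesgue_on D. b x $ j * g x))" for j
  proof -
    obtain b' where b': "integrable lborel b'" "\<And>x. x \<notin> D \<Longrightarrow> b' x = 0" "AE x in lebesgue_on D. b x $ j = b' x"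
      "\<And>g. g \<in> borel_measurable borel \<Longrightarrow> (LINT x|lborel. b' x * g x) = (LINT x|lebesgue_on D. b x $ j * g x)"
      by (rule borel_rep[OF bj(1)[of j] Db]) (rule that)
    show ?thesis
      by (intro exI[of _ b'] conjI allI impI b'(1) AE_borel_rep_bound[OF Dl bj(2)[of j] b'(3,2) bd(3)] b'(4))
  qed
  then have "\<forall>j. \<exists>b'. integrable lborel b' \<and> (AE x in lborel. \<bar>b' x\<bar> \<le> B) \<and>
    (\<forall>g. g \<in> borel_measurable borel \<longrightarrow> (LINT x|lborel. b' x * g x) = (LINT x|lebesgue_on D. b x $ j * g x))" ..
  from choice[OF this] obtain b' where b': "\<And>j. integrable lborel (b' j)" "\<And>j. AE x in lborel. \<bar>b' j x\<bar> \<le> B"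
    "\<And>j g. g \<in> borel_measurable borel \<Longrightarrow> (LINT x|lborel. b' j x * g x) = (LINT x|lebesgue_on D. b x $ j * g x)"
    by auto
  obtain s where s: "strict_mono s" "AE x in lborel. (\<lambda>k. conv a' (mol (s k)) x) \<longlonglongrightarrow> a' x"
    "AE x in lborel. (\<lambda>k. conv a' (mol (s k)) x) \<longlonglongrightarrow> a' x"
    by (rule conv_mol_AE_subseq[OF a'(1) a'(1)]) (rule that)
  define A where "A k = conv a' (mol (s k))" for k
  define M where "M = real CARD('d) * B"
  have M: "0 \<le> M" using bd(3) by (simp add: M_def)
  have lim: "AE x in lebesgue_on D. (\<lambda>k. A k x) \<longlonglongrightarrow> a x"
    using AE_completion[OF s(2)] a'(3) unfolding A_def AE_leb_on[OF Dl] by (auto elim: eventually_elim2)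
  have Ad: "A k differentiable (at x)" for k x
    using Ck_conv[OF a'(1) smooth_c_mol, of "Suc 0"] unfolding A_def by simp
  \<comment> \<open>The index \<open>N\<close> depends on the segment, because the kernels must be
    smaller than its distance to the complement of \<open>D\<close>; the constant \<open>M\<close>
    does not.\<close>
  have seg: "\<exists>N. \<forall>k\<ge>N. \<bar>A k y - A k z\<bar> \<le> M * norm (y - z)" if yz: "closed_segment y z \<subseteq> D" for y z
  proof -
    have "closed_segment y z \<inter> - D = {}" "closed (- D)" using D(1) yz by auto
    then obtain d where d: "d > 0" "\<And>x w. x \<in> closed_segment y z \<Longrightarrow> w \<notin> D \<Longrightarrow> d \<le> dist x w"
      using separate_compact_closed[OF compact_segment[of y z], of "- D"] by fastforce
    define r where "r = d / 2"
    have r: "r > 0" "\<And>x. x \<in> closed_segment y z \<Longrightarrow> cball x r \<subseteq> D" using d by (force simp: r_def)+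
    obtain N where N: "1 / real (Suc N) < r" using r(1) nat_approx_posE by metis
    have "\<bar>A k y - A k z\<bar> \<le> M * norm (y - z)" if k: "k \<ge> N" for k
    proof -
      have "N \<le> s k" using k seq_suble[OF s(1), of k] by simp
      then have "1 / real (Suc (s k)) \<le> 1 / real (Suc N)" by (intro frac_le) auto
      then have sk: "1 / real (Suc (s k)) \<le> r" using N by simp
      have "norm (A k y - A k z) \<le> M * norm (y - z)"
      proof (rule differentiable_bound[of "closed_segment y z"])
        fix x assume x: "x \<in> closed_segment y z"
        show "(A k has_derivative frechet_derivative (A k) (at x)) (at x within closed_segment y z)"
          using Ad[of k x] frechet_derivative_works has_derivative_at_withinI by blast
        have "\<bar>pderiv_at j (A k) x\<bar> \<le> B" for j
        proof -
          have "pderiv_at j (A k) x = conv (b' j) (mol (s k)) x"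
            unfolding A_def by (rule conv_weak_grad[OF D(1) a a'(1,4) b'(1)[of j] b'(3)[where j=j] r(2)[OF x] sk])
          then show ?thesis using conv_bound[OF b'(1,2)[of j]] by simp
        qed
        then show "onorm (frechet_derivative (A k) (at x)) \<le> M"
          unfolding M_def by (rule onorm_pderiv_le[OF Ad])
      qed auto
      then show ?thesis by simp
    qed
    then show ?thesis by blast
  qed
  \<comment> \<open>Convergence holds at every point and not only almost everywhere: near
    \<open>x\<close> there is a point \<open>y\<close> where the mollifications converge, and the
    uniform Lipschitz bound on the segment transfers the Cauchy property with an error of
    \<open>e / 3\<close> at each end.\<close>
  have conv: "convergent (\<lambda>k. A k x)" if x: "x \<in> D" for x
  proof (rule Cauchy_convergent, rule CauchyI)
    fix e :: real assume e: "e > 0"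
    obtain r where r: "r > 0" "ball x r \<subseteq> D" using x D(1) open_contains_ball by blast
    define r' where "r' = min r (e / (3 * (M + 1)))"
    have r': "r' > 0" using r e M by (auto simp: r'_def intro!: divide_pos_pos)
    obtain y where y: "y \<in> D \<inter> ball x r'" "(\<lambda>k. A k y) \<longlonglongrightarrow> a y" using AE_dense[OF D(1) lim x r'] by blast
    have "closed_segment x y \<subseteq> ball x r" using y(1) r(1) r' by (intro closed_segment_subset) (auto simp: r'_def)
    then obtain N where N: "\<And>k. k \<ge> N \<Longrightarrow> \<bar>A k x - A k y\<bar> \<le> M * norm (x - y)" using seg r(2) by blast
    have "Cauchy (\<lambda>k. A k y)" using y(2) convergent_Cauchy convergent_def by blast
    then obtain N' where N': "\<And>k l. k \<ge> N' \<Longrightarrow> l \<ge> N' \<Longrightarrow> norm (A k y - A l y) < e / 3"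
      using CauchyD[of "\<lambda>k. A k y" "e/3"] e by auto
    have "M * norm (x - y) \<le> e / 3"
    proof -
      have "M * norm (x - y) \<le> (M + 1) * (e / (3 * (M + 1)))"
        using y(1) M by (intro mult_mono) (auto simp: r'_def dist_norm)
      also have "\<dots> = e / 3" using M by (simp add: field_simps)
      finally show ?thesis .
    qed
    then have "norm (A k x - A l x) < e" if "k \<ge> max N N'" "l \<ge> max N N'" for k l
      using N[of k] N[of l] N'[of k l] that unfolding real_norm_def by linarith
    then show "\<exists>N. \<forall>m\<ge>N. \<forall>n\<ge>N. norm (A m x - A n x) < e" by blast
  qed
  define f where "f x = lim (\<lambda>k. A k x)" for x
  have fl: "(\<lambda>k. A k x) \<longlonglongrightarrow> f x" if "x \<in> D" for x
    using conv[OF that] unfolding f_def by (simp add: convergent_LIMSEQ_iff)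
  show thesis
  proof (rule that[OF M])
    have "AE x in lebesgue_on D. x \<in> D" by (rule AE_I2) simp
    with lim show "AE x in lebesgue_on D. a x = f x"
      by eventually_elim (use fl LIMSEQ_unique in blast)
    show "\<bar>f y - f z\<bar> \<le> M * norm (y - z)" if yz: "closed_segment y z \<subseteq> D" for y z
    proof -
      have "(\<lambda>k. \<bar>A k y - A k z\<bar>) \<longlonglongrightarrow> \<bar>f y - f z\<bar>" using yz ends_in_segment by (intro tendsto_intros fl) auto
      then show ?thesis using seg[OF yz] by (rule LIMSEQ_le_const2)
    qed
  qed
qed

text \<open>Three segments inside \<open>D\<close> turn the bound on segments into a Lipschitz bound
  near every point of the closure. Compactness of the closure makes this uniform continuity on
  \<open>D\<close>, which is what extends a function to the closure.\<close>

lemma lipschitz_domain_continuous_rep: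
  fixes a :: "real ^ 'd \<Rightarrow> real"
  assumes D: "lipschitz_domain D" and a: "is_weak_grad D a b"
    and bd: "AE x in lebesgue_on D. \<bar>a x\<bar> \<le> B" "AE x in lebesgue_on D. norm (b x) \<le> B" "0 \<le> B"
  obtains f where "continuous_on (closure D) f" "AE x in lebesgue_on D. a x = f x"
proof -
  note DD = lipschitz_domainD[OF D]
  obtain f M where M: "0 \<le> M" and f: "AE x in lebesgue_on D. a x = f x"
    "\<And>y z. closed_segment y z \<subseteq> D \<Longrightarrow> \<bar>f y - f z\<bar> \<le> M * norm (y - z)"
    by (rule bounded_weak_grad_segments[OF DD(1,3) a bd]) (rule that)
  have loc: "\<exists>r L. 0 < r \<and> (\<forall>y\<in>D \<inter> ball x r. \<forall>z\<in>D \<inter> ball x r. \<bar>f y - f z\<bar> \<le> L * norm (y - z))"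
    if x: "x \<in> closure D" for x
  proof -
    obtain r K where r: "0 < r" and ts: "\<And>y z. y \<in> D \<inter> ball x r \<Longrightarrow> z \<in> D \<inter> ball x r \<Longrightarrow> three_segments D K y z"
      using lipschitz_domain_three_segments[OF D x] by blast
    have "\<bar>f y - f z\<bar> \<le> (3 * (M * K)) * norm (y - z)" if yz: "y \<in> D \<inter> ball x r" "z \<in> D \<inter> ball x r" for y z
    proof -
      obtain p q where pq: "closed_segment y p \<subseteq> D" "closed_segment p q \<subseteq> D" "closed_segment q z \<subseteq> D"
        "norm (y - p) \<le> K * norm (y - z)" "norm (p - q) \<le> K * norm (y - z)" "norm (q - z) \<le> K * norm (y - z)"
        using ts[OF yz] unfolding three_segments_def by blast
      have "\<bar>f y - f p\<bar> \<le> M * (K * norm (y - z))" "\<bar>f p - f q\<bar> \<le> M * (K * norm (y - z))" "\<bar>f q - f z\<bar> \<le> M * (K * norm (y - z))"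
        by (rule order_trans[OF f(2) mult_left_mono[OF _ M]]; fact pq)+
      then have "\<bar>f y - f z\<bar> \<le> 3 * (M * (K * norm (y - z)))" by linarith
      then show ?thesis by (simp add: mult.assoc)
    qed
    then show ?thesis using r by blast
  qed
  have "uniformly_continuous_on D f"
  \<comment> \<open>Two sequences approaching each other with values at least \<open>e\<close> apart
    would accumulate at a point of the closure, where the local Lipschitz bound contradicts the
    gap.\<close>
  proof (rule ccontr)
    assume "\<not> ?thesis"
    then obtain e where e: "e > 0" "\<And>d. d > 0 \<Longrightarrow> \<exists>x\<in>D. \<exists>y\<in>D. dist y x < d \<and> \<not> dist (f y) (f x) < e"
      unfolding uniformly_continuous_on_def by blast
    have "\<exists>x\<in>D. \<exists>y\<in>D. dist y x < 1 / real (Suc n) \<and> \<not> dist (f y) (f x) < e" for n by (rule e(2)) simp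
    then obtain X Y where XY: "\<And>n. X n \<in> D" "\<And>n. Y n \<in> D" "\<And>n. dist (Y n) (X n) < 1 / real (Suc n)" "\<And>n. \<not> dist (f (Y n)) (f (X n)) < e"
      by metis
    have "compact (closure D)" using DD(3) by (simp add: compact_closure)
    moreover have "X n \<in> closure D" for n using XY(1) closure_subset by blast
    ultimately obtain l q where l: "l \<in> closure D" "strict_mono q" "(X \<circ> q) \<longlonglongrightarrow> l" unfolding compact_def by metis
    obtain r L where r: "0 < r" and L: "\<And>y z. y \<in> D \<inter> ball l r \<Longrightarrow> z \<in> D \<inter> ball l r \<Longrightarrow> \<bar>f y - f z\<bar> \<le> L * norm (y - z)"
      using loc[OF l(1)] by blast
    have inv0: "(\<lambda>n. 1 / real (Suc n)) \<longlonglongrightarrow> 0" using LIMSEQ_inverse_real_of_nat by (simp add: inverse_eq_divide)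
    have "(\<lambda>n. dist (Y n) (X n)) \<longlonglongrightarrow> 0"
      by (rule Lim_null_comparison[OF _ inv0]) (use XY(3) in \<open>auto simp: less_imp_le\<close>)
    then have d0: "(\<lambda>n. dist (Y (q n)) (X (q n))) \<longlonglongrightarrow> 0" using LIMSEQ_subseq_LIMSEQ[OF _ l(2)] by (simp add: comp_def)
    then have L0: "(\<lambda>n. L * dist (Y (q n)) (X (q n))) \<longlonglongrightarrow> 0" by (rule tendsto_mult_right_zero)
    have "\<forall>\<^sub>F n in sequentially. dist (X (q n)) l < r / 2" using l(3) r by (auto simp: comp_def dest: tendstoD[of _ _ _ "r/2"])
    moreover have "\<forall>\<^sub>F n in sequentially. dist (Y (q n)) (X (q n)) < r / 2" using d0 r by (auto dest: order_tendstoD(2)[of _ _ _ "r/2"])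
    moreover have "\<forall>\<^sub>F n in sequentially. L * dist (Y (q n)) (X (q n)) < e" using L0 e(1) by (rule order_tendstoD(2))
    ultimately have "\<forall>\<^sub>F n in sequentially. False"
    proof eventually_elim
      fix n assume n: "dist (X (q n)) l < r / 2" "dist (Y (q n)) (X (q n)) < r / 2" "L * dist (Y (q n)) (X (q n)) < e"
      have "dist (Y (q n)) l < r" using dist_triangle[of "Y (q n)" l "X (q n)"] n by linarith
      then have "\<bar>f (Y (q n)) - f (X (q n))\<bar> \<le> L * norm (Y (q n) - X (q n))"
        using n(1) r XY(1,2) by (intro L) (auto simp: dist_commute)
      then show False using XY(4)[of "q n"] n(3) by (simp add: dist_norm)
    qed
    then show False by simp
  qed
  then obtain g where g: "uniformly_continuous_on (closure D) g" "\<And>x. x \<in> D \<Longrightarrow> f x = g x"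
    by (rule uniformly_continuous_on_extension_on_closure) (rule that)
  show thesis
  proof (rule that[of g])
    show "continuous_on (closure D) g" using g(1) by (rule uniformly_continuous_imp_continuous)
    have "AE x in lebesgue_on D. x \<in> D" by (rule AE_I2) simp
    with f(1) show "AE x in lebesgue_on D. a x = g x" by eventually_elim (use g(2) in simp)
  qed
qed

section \<open>The spaces L2 and H1\<close>

lemma L2D:
  assumes "u \<in> L2 D" shows "u \<in> borel_measurable (lebesgue_on D)" "integrable (lebesgue_on D) (\<lambda>x. (norm (u x))\<^sup>2)"
  using assms by (auto simp: L2_def)

lemma L2_norm_sq: "(L2_norm D u)\<^sup>2 = (LINT x|lebesgue_on D. (norm (u x))\<^sup>2)"
  unfolding L2_norm_def by (rule real_sqrt_pow2) simp

lemma L2_norm_nonneg: "0 \<le> L2_norm D u"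
  unfolding L2_norm_def by simp

lemma L2_AE:
  fixes u v :: "real ^ 'd \<Rightarrow> 'b::euclidean_space"
  assumes "u \<in> L2 D" "AE x in lebesgue_on D. u x = v x" "D \<in> sets lebesgue"
  shows "v \<in> L2 D"
proof -
  have "v \<in> borel_measurable (lebesgue_on D)" by (rule measurable_leb_on_AE[OF L2D(1)[OF assms(1)] assms(2,3)])
  moreover have "integrable (lebesgue_on D) (\<lambda>x. (norm (v x))\<^sup>2)"
    by (rule integrable_leb_on_AE[OF L2D(2)[OF assms(1)] _ assms(3)]) (use assms(2) in eventually_elim, simp)
  ultimately show ?thesis by (simp add: L2_def)
qed

lemma L2_norm_AE:
  fixes u v :: "real ^ 'd \<Rightarrow> 'b::euclidean_space"
  assumes "u \<in> L2 D" "AE x in lebesgue_on D. u x = v x" "D \<in> sets lebesgue"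
  shows "L2_norm D u = L2_norm D v"
proof -
  have "(LINT x|lebesgue_on D. (norm (u x))\<^sup>2) = (LINT x|lebesgue_on D. (norm (v x))\<^sup>2)"
    by (rule integral_cong_AE) (use assms L2D(1)[OF assms(1)] L2D(1)[OF L2_AE[OF assms]] in \<open>auto elim: eventually_mono\<close>)
  then show ?thesis by (simp add: L2_norm_def)
qed

lemma norm_add_sq_le: "(norm (x + y))\<^sup>2 \<le> 2 * (norm x)\<^sup>2 + 2 * (norm (y :: 'a::real_inner))\<^sup>2"
proof -
  have "(norm (x + y))\<^sup>2 + (norm (x - y))\<^sup>2 = 2 * (norm x)\<^sup>2 + 2 * (norm y)\<^sup>2"
    by (simp add: power2_norm_eq_inner inner_simps inner_commute)
  then show ?thesis using zero_le_power2[of "norm (x - y)"] by linarith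
qed

lemma L2_add:
  fixes u v :: "real ^ 'd \<Rightarrow> 'b::euclidean_space"
  assumes u: "u \<in> L2 D" and v: "v \<in> L2 D"
  shows "(\<lambda>x. u x + v x) \<in> L2 D"
    and "(L2_norm D (\<lambda>x. u x + v x))\<^sup>2 \<le> 2 * (L2_norm D u)\<^sup>2 + 2 * (L2_norm D v)\<^sup>2"
proof -
  have i: "integrable (lebesgue_on D) (\<lambda>x. 2 * (norm (u x))\<^sup>2 + 2 * (norm (v x))\<^sup>2)"
    using L2D(2)[OF u] L2D(2)[OF v] by auto
  have m: "(\<lambda>x. u x + v x) \<in> borel_measurable (lebesgue_on D)" using L2D(1)[OF u] L2D(1)[OF v] by simp
  have i2: "integrable (lebesgue_on D) (\<lambda>x. (norm (u x + v x))\<^sup>2)"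
    by (rule Bochner_Integration.integrable_bound[OF i]) (use m in \<open>auto intro!: AE_I2 norm_add_sq_le\<close>)
  show "(\<lambda>x. u x + v x) \<in> L2 D" using m i2 by (simp add: L2_def)
  have "(LINT x|lebesgue_on D. (norm (u x + v x))\<^sup>2) \<le> (LINT x|lebesgue_on D. 2 * (norm (u x))\<^sup>2 + 2 * (norm (v x))\<^sup>2)"
    by (rule integral_mono[OF i2 i]) (rule norm_add_sq_le)
  then show "(L2_norm D (\<lambda>x. u x + v x))\<^sup>2 \<le> 2 * (L2_norm D u)\<^sup>2 + 2 * (L2_norm D v)\<^sup>2"
    using L2D(2)[OF u] L2D(2)[OF v] by (simp add: L2_norm_sq)
qed

lemma L2_mult:
  fixes u :: "real ^ 'd \<Rightarrow> 'b::euclidean_space"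
  assumes u: "u \<in> L2 D" and a: "a \<in> borel_measurable (lebesgue_on D)" "AE x in lebesgue_on D. \<bar>a x\<bar> \<le> B"
  shows "(\<lambda>x. a x *\<^sub>R u x) \<in> L2 D"
    and "(L2_norm D (\<lambda>x. a x *\<^sub>R u x))\<^sup>2 \<le> B\<^sup>2 * (L2_norm D u)\<^sup>2"
proof -
  have i: "integrable (lebesgue_on D) (\<lambda>x. B\<^sup>2 * (norm (u x))\<^sup>2)" using L2D(2)[OF u] by auto
  have m: "(\<lambda>x. a x *\<^sub>R u x) \<in> borel_measurable (lebesgue_on D)" using L2D(1)[OF u] a(1) by simp
  have le: "AE x in lebesgue_on D. (norm (a x *\<^sub>R u x))\<^sup>2 \<le> B\<^sup>2 * (norm (u x))\<^sup>2"
    using a(2)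
  proof eventually_elim
    fix x assume "\<bar>a x\<bar> \<le> B"
    then have "(a x)\<^sup>2 \<le> B\<^sup>2" using power_mono[of "\<bar>a x\<bar>" B 2] by simp
    then show "(norm (a x *\<^sub>R u x))\<^sup>2 \<le> B\<^sup>2 * (norm (u x))\<^sup>2" by (auto simp: power_mult_distrib intro!: mult_right_mono)
  qed
  have i2: "integrable (lebesgue_on D) (\<lambda>x. (norm (a x *\<^sub>R u x))\<^sup>2)"
  proof (rule Bochner_Integration.integrable_bound[OF i])
    show "(\<lambda>x. (norm (a x *\<^sub>R u x))\<^sup>2) \<in> borel_measurable (lebesgue_on D)"
      by (intro borel_measurable_power measurable_compose[OF m borel_measurable_norm])
    show "AE x in lebesgue_on D. norm ((norm (a x *\<^sub>R u x))\<^sup>2) \<le> norm (B\<^sup>2 * (norm (u x))\<^sup>2)"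
      using le by eventually_elim simp
  qed
  show "(\<lambda>x. a x *\<^sub>R u x) \<in> L2 D" using m i2 by (simp add: L2_def)
  have "(LINT x|lebesgue_on D. (norm (a x *\<^sub>R u x))\<^sup>2) \<le> (LINT x|lebesgue_on D. B\<^sup>2 * (norm (u x))\<^sup>2)"
    by (rule integral_mono_AE[OF i2 i le])
  then show "(L2_norm D (\<lambda>x. a x *\<^sub>R u x))\<^sup>2 \<le> B\<^sup>2 * (L2_norm D u)\<^sup>2"
    unfolding L2_norm_sq by simp
qed

lemma L2_scale:
  fixes u :: "real ^ 'd \<Rightarrow> 'b::euclidean_space"
  assumes "u \<in> L2 D" shows "(\<lambda>x. c *\<^sub>R u x) \<in> L2 D"
  by (rule L2_mult(1)[OF assms, where a="\<lambda>x. c" and B="\<bar>c\<bar>"]) auto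

lemma L2_norm_minus: "L2_norm D (\<lambda>x. - u x) = L2_norm D u"
  by (simp add: L2_norm_def)

lemma L2_diff:
  fixes u v :: "real ^ 'd \<Rightarrow> 'b::euclidean_space"
  assumes "u \<in> L2 D" "v \<in> L2 D"
  shows "(\<lambda>x. u x - v x) \<in> L2 D"
    and "(L2_norm D (\<lambda>x. u x - v x))\<^sup>2 \<le> 2 * (L2_norm D u)\<^sup>2 + 2 * (L2_norm D v)\<^sup>2"
  using L2_add[OF assms(1) L2_scale[OF assms(2), of "-1"]] L2_norm_minus[of D v] by simp_all

lemma L2_subset:
  fixes u :: "real ^ 'd \<Rightarrow> 'b::euclidean_space"
  assumes u: "u \<in> L2 D" and S: "T \<subseteq> D" "D \<in> sets lebesgue" "T \<in> sets lebesgue"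
  shows "u \<in> L2 T" "L2_norm T u \<le> L2_norm D u"
proof -
  note i = L2D(2)[OF u]
  have iT: "integrable (lebesgue_on T) (\<lambda>x. (norm (u x))\<^sup>2)" by (rule integrable_leb_on_mono[OF i S])
  show "u \<in> L2 T" using measurable_leb_on_mono[OF L2D(1)[OF u] S(1)] iT by (simp add: L2_def)
  have "(LINT x|lebesgue_on T. (norm (u x))\<^sup>2) = (LINT x|lebesgue_on D. (if x \<in> T then (norm (u x))\<^sup>2 else 0))"
    by (rule leb_on_zero_ext(1)[OF S, symmetric])
  also have "\<dots> \<le> (LINT x|lebesgue_on D. (norm (u x))\<^sup>2)"
    by (rule integral_mono) (use i iT leb_on_zero_ext(2)[OF S, of "\<lambda>x. (norm (u x))\<^sup>2"] in auto)
  finally show "L2_norm T u \<le> L2_norm D u" by (simp add: L2_norm_def)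
qed

lemma L2_zero_ext:
  fixes u :: "real ^ 'd \<Rightarrow> 'b::euclidean_space"
  assumes u: "u \<in> L2 T" and S: "T \<subseteq> D" "D \<in> sets lebesgue" "T \<in> sets lebesgue"
  shows "(\<lambda>x. if x \<in> T then u x else 0) \<in> L2 D" "L2_norm D (\<lambda>x. if x \<in> T then u x else 0) = L2_norm T u"
proof -
  have eq: "(norm (if x \<in> T then u x else 0))\<^sup>2 = (if x \<in> T then (norm (u x))\<^sup>2 else 0)" for x by simp
  have "(\<lambda>x. if x \<in> T then u x else 0) \<in> borel_measurable (lebesgue_on D)"
    using borel_measurable_if_lebesgue_on[of T D u] S L2D(1)[OF u] by simp
  then show "(\<lambda>x. if x \<in> T then u x else 0) \<in> L2 D"
    unfolding L2_def mem_Collect_eq eq using leb_on_zero_ext(2)[OF S, of "\<lambda>x. (norm (u x))\<^sup>2"] L2D(2)[OF u] by blast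
  show "L2_norm D (\<lambda>x. if x \<in> T then u x else 0) = L2_norm T u"
    unfolding L2_norm_def eq leb_on_zero_ext(1)[OF S, of "\<lambda>x. (norm (u x))\<^sup>2"] ..
qed

lemma L2_integrable:
  fixes u :: "real ^ 'd \<Rightarrow> 'b::euclidean_space"
  assumes u: "u \<in> L2 D" and D: "D \<in> sets lebesgue" "bounded D"
  shows "integrable (lebesgue_on D) u"
proof (rule Bochner_Integration.integrable_bound)
  have "integrable (lebesgue_on D) (\<lambda>x. 1 :: real)"
    using D by (intro bounded_integrable_leb_on[where B=1]) auto
  then show "integrable (lebesgue_on D) (\<lambda>x. 1 + (norm (u x))\<^sup>2)" using L2D(2)[OF u] by auto
  show "AE x in lebesgue_on D. norm (u x) \<le> norm (1 + (norm (u x))\<^sup>2)"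
  proof (rule AE_I2)
    fix x
    have "0 \<le> (norm (u x) - 1)\<^sup>2" by simp
    then have "2 * norm (u x) \<le> 1 + (norm (u x))\<^sup>2" by (simp add: power2_diff)
    then have "norm (u x) \<le> 1 + (norm (u x))\<^sup>2" using norm_ge_zero[of "u x"] by linarith
    then show "norm (u x) \<le> norm (1 + (norm (u x))\<^sup>2)" by simp
  qed
qed (use L2D(1)[OF u] in simp)

lemma L2_inner_integrable:
  fixes u v :: "real ^ 'd \<Rightarrow> 'b::euclidean_space"
  assumes u: "u \<in> L2 D" and v: "v \<in> L2 D"
  shows "integrable (lebesgue_on D) (\<lambda>x. u x \<bullet> v x)"
proof (rule Bochner_Integration.integrable_bound)
  show "integrable (lebesgue_on D) (\<lambda>x. (norm (u x))\<^sup>2 + (norm (v x))\<^sup>2)" using L2D(2)[OF u] L2D(2)[OF v] by auto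
  show "AE x in lebesgue_on D. norm (u x \<bullet> v x) \<le> norm ((norm (u x))\<^sup>2 + (norm (v x))\<^sup>2)"
  proof (rule AE_I2)
    fix x
    have "\<bar>u x \<bullet> v x\<bar> \<le> norm (u x) * norm (v x)" by (rule Cauchy_Schwarz_ineq2)
    also have "\<dots> \<le> (norm (u x))\<^sup>2 + (norm (v x))\<^sup>2"
      using sum_squares_bound[of "norm (u x)" "norm (v x)"] mult_nonneg_nonneg[OF norm_ge_zero[of "u x"] norm_ge_zero[of "v x"]] by linarith
    finally show "norm (u x \<bullet> v x) \<le> norm ((norm (u x))\<^sup>2 + (norm (v x))\<^sup>2)" by simp
  qed
qed (use L2D(1)[OF u] L2D(1)[OF v] in simp)

text \<open>The squared norm of \<open>u + t v\<close> is a nonnegative quadratic polynomial in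
  \<open>t\<close>; for \<open>V = 0\<close> it degenerates to an affine one, which must then be
  constant.\<close>

lemma L2_Cauchy_Schwarz:
  fixes u v :: "real ^ 'd \<Rightarrow> real"
  assumes u: "u \<in> L2 D" and v: "v \<in> L2 D"
  shows "(LINT x|lebesgue_on D. u x * v x) \<le> L2_norm D u * L2_norm D v"
proof -
  let ?I = "LINT x|lebesgue_on D. u x * v x"
  have iuv: "integrable (lebesgue_on D) (\<lambda>x. u x * v x)" using L2_inner_integrable[OF u v] by simp
  have i: "integrable (lebesgue_on D) (\<lambda>x. (u x)\<^sup>2)" "integrable (lebesgue_on D) (\<lambda>x. (v x)\<^sup>2)" using L2D(2)[OF u] L2D(2)[OF v] by simp_all
  define U where "U = (L2_norm D u)\<^sup>2"
  define V where "V = (L2_norm D v)\<^sup>2"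
  have q: "0 \<le> U + 2 * t * ?I + t\<^sup>2 * V" for t
  proof -
    have "0 \<le> (LINT x|lebesgue_on D. (u x + t * v x)\<^sup>2)" by simp
    also have "(\<lambda>x. (u x + t * v x)\<^sup>2) = (\<lambda>x. (u x)\<^sup>2 + (2 * t) * (u x * v x) + t\<^sup>2 * (v x)\<^sup>2)"
      by (rule ext) (simp add: power2_eq_square algebra_simps)
    also have "(LINT x|lebesgue_on D. (u x)\<^sup>2 + (2 * t) * (u x * v x) + t\<^sup>2 * (v x)\<^sup>2) = U + (2 * t) * ?I + t\<^sup>2 * V"
      using iuv i by (simp add: U_def V_def L2_norm_sq)
    finally show ?thesis .
  qed
  have "?I\<^sup>2 \<le> U * V"
  proof (cases "V = 0")
    case True
    have "?I = 0"
    proof (rule ccontr)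
      assume n: "?I \<noteq> 0"
      \<comment> \<open>This \<open>t\<close> gives the affine function the value -1.\<close>
      show False using q[of "- (U + 1) / (2 * ?I)"] n True by (simp add: field_simps)
    qed
    then show ?thesis using True by simp
  next
    case False
    then have V: "V > 0" by (simp add: V_def)
    have "0 \<le> V * (U + 2 * (- ?I / V) * ?I + (- ?I / V)\<^sup>2 * V)" by (intro mult_nonneg_nonneg q less_imp_le[OF V])
    also have "\<dots> = U * V - ?I\<^sup>2" using V by (simp add: field_simps power2_eq_square)
    finally show ?thesis by simp
  qed
  then have "?I\<^sup>2 \<le> (L2_norm D u * L2_norm D v)\<^sup>2" by (simp add: U_def V_def power_mult_distrib)
  then show ?thesis by (rule power2_le_imp_le) (simp add: L2_norm_nonneg)
qed

lemma L2_norm_triangle: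
  fixes u v :: "real ^ 'd \<Rightarrow> real"
  assumes u: "u \<in> L2 D" and v: "v \<in> L2 D"
  shows "L2_norm D (\<lambda>x. u x + v x) \<le> L2_norm D u + L2_norm D v"
proof (rule power2_le_imp_le)
  have iuv: "integrable (lebesgue_on D) (\<lambda>x. u x * v x)" using L2_inner_integrable[OF u v] by simp
  have i: "integrable (lebesgue_on D) (\<lambda>x. (u x)\<^sup>2)" "integrable (lebesgue_on D) (\<lambda>x. (v x)\<^sup>2)" using L2D(2)[OF u] L2D(2)[OF v] by simp_all
  have "(\<lambda>x. (u x + v x)\<^sup>2) = (\<lambda>x. (u x)\<^sup>2 + 2 * (u x * v x) + (v x)\<^sup>2)"
    by (rule ext) (simp add: power2_eq_square algebra_simps)
  then have "(L2_norm D (\<lambda>x. u x + v x))\<^sup>2 = (L2_norm D u)\<^sup>2 + 2 * (LINT x|lebesgue_on D. u x * v x) + (L2_norm D v)\<^sup>2"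
    using iuv i by (simp add: L2_norm_sq)
  also have "\<dots> \<le> (L2_norm D u)\<^sup>2 + 2 * (L2_norm D u * L2_norm D v) + (L2_norm D v)\<^sup>2"
    using L2_Cauchy_Schwarz[OF u v] by simp
  finally show "(L2_norm D (\<lambda>x. u x + v x))\<^sup>2 \<le> (L2_norm D u + L2_norm D v)\<^sup>2" by (simp add: power2_sum)
qed (simp add: L2_norm_nonneg)

section \<open>The chosen weak gradient and the space \<open>H1\<close>\<close>

lemma wgrad_weak_grad: "is_weak_grad D u g \<Longrightarrow> is_weak_grad D u (wgrad D u)"
  unfolding wgrad_def by (rule someI[of "is_weak_grad D u"])

lemma wgrad_AE: "open D \<Longrightarrow> is_weak_grad D u g \<Longrightarrow> AE x in lebesgue_on D. wgrad D u x = g x"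
  using is_weak_grad_unique wgrad_weak_grad by blast

lemma H1D:
  assumes "u \<in> H1 D" "open D"
  shows "u \<in> L2 D" "is_weak_grad D u (wgrad D u)" "wgrad D u \<in> L2 D"
proof -
  obtain g where g: "is_weak_grad D u g" "g \<in> L2 D" and u: "u \<in> L2 D" using assms(1) by (auto simp: H1_def)
  show "u \<in> L2 D" by fact
  show "is_weak_grad D u (wgrad D u)" by (rule wgrad_weak_grad[OF g(1)])
  have "AE x in lebesgue_on D. g x = wgrad D u x" using wgrad_AE[OF assms(2) g(1)] by (simp add: eq_commute)
  then show "wgrad D u \<in> L2 D" by (rule L2_AE[OF g(2)]) (use assms(2) in simp)
qed

lemma H1I: "u \<in> L2 D \<Longrightarrow> is_weak_grad D u g \<Longrightarrow> g \<in> L2 D \<Longrightarrow> u \<in> H1 D"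
  by (auto simp: H1_def)

text \<open>\<open>wgrad\<close> is a choice; this evaluates the norm with any square integrable
  weak gradient at hand. Squares avoid the root in the definition.\<close>

lemma H1_norm_eq:
  assumes D: "open D" and u: "is_weak_grad D u g" "g \<in> L2 D"
  shows "(H1_norm D u)\<^sup>2 = (L2_norm D u)\<^sup>2 + (L2_norm D g)\<^sup>2"
proof -
  have "AE x in lebesgue_on D. g x = wgrad D u x" using wgrad_AE[OF D u(1)] by (simp add: eq_commute)
  then have "L2_norm D g = L2_norm D (wgrad D u)" by (rule L2_norm_AE[OF u(2)]) (use D in simp)
  then show ?thesis by (simp add: H1_norm_def)
qed

lemma H1_subset:
  assumes D: "open D" "open T" "T \<subseteq> D" and u: "u \<in> H1 D"
  shows "u \<in> H1 T" "(H1_norm T u)\<^sup>2 \<le> (H1_norm D u)\<^sup>2"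
proof -
  note h = H1D[OF u D(1)]
  have l: "D \<in> sets lebesgue" "T \<in> sets lebesgue" using D by simp_all
  have w: "is_weak_grad T u (wgrad D u)" by (rule is_weak_grad_subset[OF D h(2)])
  note s = L2_subset[OF h(1) D(3) l] and s' = L2_subset[OF h(3) D(3) l]
  show "u \<in> H1 T" by (rule H1I[OF s(1) w s'(1)])
  have "(L2_norm T u)\<^sup>2 \<le> (L2_norm D u)\<^sup>2" "(L2_norm T (wgrad D u))\<^sup>2 \<le> (L2_norm D (wgrad D u))\<^sup>2"
    using s(2) s'(2) by (auto intro: power_mono simp: L2_norm_nonneg)
  then show "(H1_norm T u)\<^sup>2 \<le> (H1_norm D u)\<^sup>2"
    unfolding H1_norm_eq[OF D(2) w s'(1)] H1_norm_eq[OF D(1) h(2,3)] by simp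
qed

lemma H1_diff:
  assumes D: "open D" and u: "u \<in> H1 D" and v: "v \<in> H1 D"
  shows "(\<lambda>x. u x - v x) \<in> H1 D" "(H1_norm D (\<lambda>x. u x - v x))\<^sup>2 \<le> 2 * (H1_norm D u)\<^sup>2 + 2 * (H1_norm D v)\<^sup>2"
proof -
  note hu = H1D[OF u D] and hv = H1D[OF v D]
  note w = is_weak_grad_diff[OF D hu(2) hv(2)] and g = L2_diff[OF hu(3) hv(3)] and l = L2_diff[OF hu(1) hv(1)]
  show "(\<lambda>x. u x - v x) \<in> H1 D" by (rule H1I[OF l(1) w g(1)])
  show "(H1_norm D (\<lambda>x. u x - v x))\<^sup>2 \<le> 2 * (H1_norm D u)\<^sup>2 + 2 * (H1_norm D v)\<^sup>2"
    unfolding H1_norm_eq[OF D w g(1)] H1_norm_eq[OF D hu(2,3)] H1_norm_eq[OF D hv(2,3)] using l(2) g(2) by simp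
qed

section \<open>Weighted test functions\<close>

text \<open>
  The last two conditions make the extension by zero of \<open>a\<^sup>2 p\<close> weakly differentiable in \<open>Om\<close> and continuous
  on \<open>closure Om\<close>, respectively.
\<close>

definition weight :: "(real ^ 'd) set \<Rightarrow> (real ^ 'd) set \<Rightarrow> (real ^ 'd \<Rightarrow> real) \<Rightarrow> (real ^ 'd \<Rightarrow> real ^ 'd) \<Rightarrow> real \<Rightarrow> bool" where
  "weight Om D a b B \<longleftrightarrow> open Om \<and> bounded Om \<and> open D \<and> D \<subseteq> Om \<and> is_weak_grad D a b \<and> continuous_on (closure D) a \<and>
     (\<forall>x\<in>closure D. \<bar>a x\<bar> \<le> B) \<and> (AE x in lebesgue_on D. norm (b x) \<le> B) \<and>
     (\<forall>x\<in>frontier D \<inter> Om. a x = 0) \<and> (\<forall>x\<in>closure D \<inter> closure (closure Om - closure D). a x = 0)"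

lemma weightD:
  assumes "weight Om D a b B"
  shows "open Om" "bounded Om" "open D" "D \<subseteq> Om" "is_weak_grad D a b" "continuous_on (closure D) a"
     "x \<in> closure D \<Longrightarrow> \<bar>a x\<bar> \<le> B" "AE x in lebesgue_on D. norm (b x) \<le> B" "x \<in> frontier D \<Longrightarrow> x \<in> Om \<Longrightarrow> a x = 0"
     "x \<in> closure D \<Longrightarrow> x \<in> closure (closure Om - closure D) \<Longrightarrow> a x = 0"
     "bounded D" "Om \<in> sets lebesgue" "D \<in> sets lebesgue"
     "a \<in> borel_measurable (lebesgue_on D)" "b \<in> borel_measurable (lebesgue_on D)" "AE x in lebesgue_on D. \<bar>a x\<bar> \<le> B"
proof -
  show *: "open Om" "bounded Om" "open D" "D \<subseteq> Om" "is_weak_grad D a b" "continuous_on (closure D) a"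
     "x \<in> closure D \<Longrightarrow> \<bar>a x\<bar> \<le> B" "AE x in lebesgue_on D. norm (b x) \<le> B" "x \<in> frontier D \<Longrightarrow> x \<in> Om \<Longrightarrow> a x = 0"
     "x \<in> closure D \<Longrightarrow> x \<in> closure (closure Om - closure D) \<Longrightarrow> a x = 0"
    using assms by (auto simp: weight_def)
  show "bounded D" using *(2,4) bounded_subset by blast
  show "Om \<in> sets lebesgue" "D \<in> sets lebesgue" using *(1,3) by simp_all
  show "a \<in> borel_measurable (lebesgue_on D)" "b \<in> borel_measurable (lebesgue_on D)"
    using locally_integrable_measurable[OF *(3)] is_weak_gradD(1,2)[OF *(5)] by auto
  have "\<bar>a x\<bar> \<le> B" if "x \<in> D" for x using assms that closure_subset[of D] by (auto simp: weight_def)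
  then show "AE x in lebesgue_on D. \<bar>a x\<bar> \<le> B" by (intro AE_I2) simp
qed

text \<open>The case distinction is on \<open>closure D\<close>, not on \<open>D\<close>, so that
  the formula is meaningful on the boundary, where traces are compared.\<close>

definition weighted_ext :: "(real ^ 'd) set \<Rightarrow> (real ^ 'd \<Rightarrow> real) \<Rightarrow> (real ^ 'd \<Rightarrow> real) \<Rightarrow> real ^ 'd \<Rightarrow> real" where
  "weighted_ext D a p x = (if x \<in> closure D then (a x)\<^sup>2 * p x else 0)"

text \<open>The gradient of \<open>(a x)\<^sup>2 * p x\<close> by the product rule, when
  \<open>b\<close> and \<open>q\<close> are the gradients of \<open>a\<close> and
  \<open>p\<close>.\<close>

definition extg :: "(real ^ 'd \<Rightarrow> real) \<Rightarrow> (real ^ 'd \<Rightarrow> real ^ 'd) \<Rightarrow> (real ^ 'd \<Rightarrow> real) \<Rightarrow> (real ^ 'd \<Rightarrow> real ^ 'd) \<Rightarrow> real ^ 'd \<Rightarrow> real ^ 'd" where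
  "extg a b p q x = (a x)\<^sup>2 *\<^sub>R q x + (2 * a x * p x) *\<^sub>R b x"

lemma ext_eq:
  assumes "weight Om D a b B" "x \<in> Om"
  shows "weighted_ext D a p x = (if x \<in> D then (a x)\<^sup>2 * p x else 0)"
proof -
  have "a x = 0" if "x \<in> closure D" "x \<notin> D"
    using weightD(9)[OF assms(1)] assms(2) that weightD(3)[OF assms(1)] by (simp add: frontier_def interior_open)
  then show ?thesis using closure_subset[of D] by (auto simp: weighted_ext_def)
qed

lemma ext_weak_grad:
  assumes W: "weight Om D a b B" and p: "is_weak_grad D p q" "p \<in> L2 D" "q \<in> L2 D"
  shows "is_weak_grad Om (weighted_ext D a p) (\<lambda>x. if x \<in> D then extg a b p q x else 0)"
proof -
  note w = weightD[OF W]
  have "is_weak_grad Om (\<lambda>x. if x \<in> D then (a x)\<^sup>2 * p x else 0) (\<lambda>x. if x \<in> D then extg a b p q x else 0)"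
    unfolding extg_def
    by (rule is_weak_grad_zero_ext[OF w(1,3,11,4,5,16,8,6) w(9) p(1) L2_integrable[OF p(2) w(13,11)] L2_integrable[OF p(3) w(13,11)]])
  then show ?thesis
    by (rule is_weak_grad_AE[OF w(1)]) (use ext_eq[OF W] in \<open>auto intro!: AE_I2\<close>)
qed

text \<open>Of the constant 9, one unit comes from the function and 8 from the gradient term 2 a p
  b: its square contributes 4, and the square of a sum another factor 2. The term with
  \<open>q\<close> accounts for 2 only.\<close>

lemma ext_L2:
  assumes W: "weight Om D a b B" and p: "p \<in> L2 D" "q \<in> L2 D"
  shows "(\<lambda>x. (a x)\<^sup>2 * p x) \<in> L2 D" "extg a b p q \<in> L2 D"
    "(L2_norm D (\<lambda>x. (a x)\<^sup>2 * p x))\<^sup>2 + (L2_norm D (extg a b p q))\<^sup>2 \<le> 9 * B ^ 4 * ((L2_norm D p)\<^sup>2 + (L2_norm D q)\<^sup>2)"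
proof -
  note w = weightD[OF W]
  have a2: "AE x in lebesgue_on D. \<bar>(a x)\<^sup>2\<bar> \<le> B\<^sup>2"
    using w(16) by eventually_elim (use power_mono[of "\<bar>a _\<bar>" B 2] in simp)
  have m2: "(\<lambda>x. (a x)\<^sup>2) \<in> borel_measurable (lebesgue_on D)" using w(14) by simp
  have 1: "(\<lambda>x. (a x)\<^sup>2 *\<^sub>R p x) \<in> L2 D" "(L2_norm D (\<lambda>x. (a x)\<^sup>2 *\<^sub>R p x))\<^sup>2 \<le> (B\<^sup>2)\<^sup>2 * (L2_norm D p)\<^sup>2"
    by (rule L2_mult[OF p(1) m2 a2])+
  have 2: "(\<lambda>x. (a x)\<^sup>2 *\<^sub>R q x) \<in> L2 D" "(L2_norm D (\<lambda>x. (a x)\<^sup>2 *\<^sub>R q x))\<^sup>2 \<le> (B\<^sup>2)\<^sup>2 * (L2_norm D q)\<^sup>2"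
    by (rule L2_mult[OF p(2) m2 a2])+
  have m3: "(\<lambda>x. 2 * a x * norm (b x)) \<in> borel_measurable (lebesgue_on D)" using w(14,15) by simp
  have a3: "AE x in lebesgue_on D. \<bar>2 * a x * norm (b x)\<bar> \<le> 2 * B\<^sup>2"
    using w(16) w(8)
  proof eventually_elim
    fix x assume x: "\<bar>a x\<bar> \<le> B" "norm (b x) \<le> B"
    have "\<bar>a x\<bar> * norm (b x) \<le> B * B" using x by (intro mult_mono) auto
    then show "\<bar>2 * a x * norm (b x)\<bar> \<le> 2 * B\<^sup>2" by (simp add: power2_eq_square abs_mult)
  qed
  have 3: "(\<lambda>x. (2 * a x * norm (b x)) *\<^sub>R p x) \<in> L2 D" "(L2_norm D (\<lambda>x. (2 * a x * norm (b x)) *\<^sub>R p x))\<^sup>2 \<le> (2 * B\<^sup>2)\<^sup>2 * (L2_norm D p)\<^sup>2"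
    by (rule L2_mult[OF p(1) m3 a3])+
  have eq: "(norm ((2 * a x * p x) *\<^sub>R b x))\<^sup>2 = (norm ((2 * a x * norm (b x)) *\<^sub>R p x))\<^sup>2" for x by (simp add: power_mult_distrib)
  have m4: "(\<lambda>x. (2 * a x * p x) *\<^sub>R b x) \<in> borel_measurable (lebesgue_on D)" using w(14,15) L2D(1)[OF p(1)] by simp
  have 4: "(\<lambda>x. (2 * a x * p x) *\<^sub>R b x) \<in> L2 D" "(L2_norm D (\<lambda>x. (2 * a x * p x) *\<^sub>R b x))\<^sup>2 \<le> (2 * B\<^sup>2)\<^sup>2 * (L2_norm D p)\<^sup>2"
    using L2D(2)[OF 3(1)] 3(2) m4 unfolding L2_def mem_Collect_eq L2_norm_sq eq by blast+
  show "(\<lambda>x. (a x)\<^sup>2 * p x) \<in> L2 D" using 1(1) by simp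
  show "extg a b p q \<in> L2 D" using L2_add(1)[OF 2(1) 4(1)] unfolding extg_def[abs_def] .
  have "(L2_norm D (extg a b p q))\<^sup>2 \<le> 2 * ((B\<^sup>2)\<^sup>2 * (L2_norm D q)\<^sup>2) + 2 * ((2 * B\<^sup>2)\<^sup>2 * (L2_norm D p)\<^sup>2)"
    using L2_add(2)[OF 2(1) 4(1)] 2(2) 4(2) unfolding extg_def[abs_def] by linarith
  moreover have B4: "(B\<^sup>2)\<^sup>2 = B ^ 4" "(2 * B\<^sup>2)\<^sup>2 = 4 * B ^ 4" by (simp_all add: power_mult_distrib flip: power_mult)
  ultimately have "(L2_norm D (extg a b p q))\<^sup>2 \<le> 2 * (B ^ 4 * (L2_norm D q)\<^sup>2) + 8 * (B ^ 4 * (L2_norm D p)\<^sup>2)" by simp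
  moreover have "(L2_norm D (\<lambda>x. (a x)\<^sup>2 * p x))\<^sup>2 \<le> B ^ 4 * (L2_norm D p)\<^sup>2" using 1(2) B4 by simp
  moreover have "0 \<le> B ^ 4 * (L2_norm D q)\<^sup>2" by (intro mult_nonneg_nonneg) auto
  moreover have "9 * B ^ 4 * ((L2_norm D p)\<^sup>2 + (L2_norm D q)\<^sup>2) = 9 * (B ^ 4 * (L2_norm D p)\<^sup>2) + 9 * (B ^ 4 * (L2_norm D q)\<^sup>2)"
    by (simp only: distrib_left mult.assoc)
  ultimately show "(L2_norm D (\<lambda>x. (a x)\<^sup>2 * p x))\<^sup>2 + (L2_norm D (extg a b p q))\<^sup>2 \<le> 9 * B ^ 4 * ((L2_norm D p)\<^sup>2 + (L2_norm D q)\<^sup>2)"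
    by linarith
qed

lemma ext_H1:
  assumes W: "weight Om D a b B" and p: "p \<in> H1 D"
  shows "weighted_ext D a p \<in> H1 Om" "(H1_norm Om (weighted_ext D a p))\<^sup>2 \<le> 9 * B ^ 4 * (H1_norm D p)\<^sup>2"
proof -
  note w = weightD[OF W]
  note h = H1D[OF p w(3)]
  note e = ext_weak_grad[OF W h(2,1,3)] and l = ext_L2[OF W h(1,3)]
  note z = L2_zero_ext[OF _ w(4,12,13)]
  have ae: "AE x in lebesgue_on Om. (if x \<in> D then (a x)\<^sup>2 * p x else 0) = weighted_ext D a p x"
    using ext_eq[OF W] by (auto intro!: AE_I2)
  have L: "weighted_ext D a p \<in> L2 Om" by (rule L2_AE[OF z(1)[OF l(1)] ae w(12)])
  have n: "L2_norm Om (weighted_ext D a p) = L2_norm D (\<lambda>x. (a x)\<^sup>2 * p x)"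
    using L2_norm_AE[OF z(1)[OF l(1)] ae w(12)] z(2)[OF l(1)] by simp
  show "weighted_ext D a p \<in> H1 Om" by (rule H1I[OF L e z(1)[OF l(2)]])
  show "(H1_norm Om (weighted_ext D a p))\<^sup>2 \<le> 9 * B ^ 4 * (H1_norm D p)\<^sup>2"
    unfolding H1_norm_eq[OF w(1) e z(1)[OF l(2)]] H1_norm_eq[OF w(3) h(2,3)] n z(2)[OF l(2)] by (rule l(3))
qed

text \<open>The two formulas are pasted along the closed sets \<open>closure D\<close> and the
  closure of its complement in \<open>closure Om\<close>; the last condition on a weight makes them
  agree on the overlap.\<close>

lemma ext_continuous:
  assumes W: "weight Om D a b B" and p: "continuous_on (closure D) p"
  shows "continuous_on (closure Om) (weighted_ext D a p)"
proof -
  note w = weightD[OF W]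
  let ?T = "closure (closure Om - closure D)"
  have "continuous_on (closure D \<union> ?T) (\<lambda>x. if x \<in> closure D then (a x)\<^sup>2 * p x else 0)"
    by (rule continuous_on_cases) (use w(6,10) p in \<open>auto intro!: continuous_intros\<close>)
  then show ?thesis unfolding weighted_ext_def[abs_def]
    by (rule continuous_on_subset) (use closure_subset[of "closure Om - closure D"] in auto)
qed

lemma ext_diff: "weighted_ext D a p x - weighted_ext D a q x = weighted_ext D a (\<lambda>x. p x - q x) x"
  by (simp add: weighted_ext_def algebra_simps)

section \<open>Boundary values of weighted extensions\<close>

lemma sets_surface_measure [simp, measurable_cong]: "sets surface_measure = sets borel"
  unfolding surface_measure_def by (simp add: sets_measure_of_conv) (metis sets.sigma_sets_eq space_borel)

text \<open>Continuity of \<open>f\<close> is known on \<open>S\<close> only, and its values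
  elsewhere are arbitrary; multiplying by the indicator first gives a Borel function.\<close>

lemma trace_integrand_measurable:
  fixes t :: "real ^ 'd \<Rightarrow> real"
  assumes "closed S" "continuous_on S f" "t \<in> borel_measurable borel"
  shows "(\<lambda>x. ennreal ((f x - t x)\<^sup>2) * indicator S x) \<in> borel_measurable surface_measure"
proof -
  have S: "S \<in> sets borel" using assms(1) by auto
  have m: "(\<lambda>x. indicator S x *\<^sub>R f x) \<in> borel_measurable borel"
    by (rule borel_measurable_continuous_on_indicator[OF S assms(2)])
  have "(\<lambda>x. ennreal ((indicator S x *\<^sub>R f x - t x)\<^sup>2) * indicator S x) \<in> borel_measurable borel"
    using m assms(3) S by measurable
  also have "(\<lambda>x. ennreal ((indicator S x *\<^sub>R f x - t x)\<^sup>2) * indicator S x) = (\<lambda>x. ennreal ((f x - t x)\<^sup>2) * indicator S x)"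
    by (auto simp: indicator_def fun_eq_iff)
  finally show ?thesis by (simp add: measurable_cong_sets[OF sets_surface_measure refl])
qed

text \<open>The weight kills the traces away from the common boundary, where both traces vanish.\<close>

lemma ext_H1_vanishing:
  fixes u \<psi> :: "real ^ 'd \<Rightarrow> real"
  assumes W: "weight Om D a b B" and u: "u \<in> H1_0 Om" and \<psi>: "\<psi> \<in> H1_Gamma Om D" and S: "S = Om \<or> S = D"
  shows "weighted_ext D a (\<lambda>x. u x - \<psi> x) \<in> H1_vanishing S X"
proof -
  note w = weightD[OF W]
  obtain tu U where uH: "u \<in> H1 Om" and tu: "tu \<in> borel_measurable borel" "AE x in surface_measure. x \<in> frontier Om \<longrightarrow> tu x = 0"
    and U: "\<And>n. U n \<in> H1 Om" "\<And>n. continuous_on (closure Om) (U n)" "(\<lambda>n. H1_norm Om (\<lambda>x. U n x - u x)) \<longlonglongrightarrow> 0"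
      "(\<lambda>n. \<integral>\<^sup>+x\<in>frontier Om. ennreal ((U n x - tu x)\<^sup>2) \<partial>surface_measure) \<longlonglongrightarrow> 0"
    using u unfolding H1_0_def H1_vanishing_def has_trace_def by blast
  obtain tp P where \<psi>H: "\<psi> \<in> H1 D" and tp: "tp \<in> borel_measurable borel" "AE x in surface_measure. x \<in> frontier D \<inter> frontier Om \<longrightarrow> tp x = 0"
    and P: "\<And>n. P n \<in> H1 D" "\<And>n. continuous_on (closure D) (P n)" "(\<lambda>n. H1_norm D (\<lambda>x. P n x - \<psi> x)) \<longlonglongrightarrow> 0"
      "(\<lambda>n. \<integral>\<^sup>+x\<in>frontier D. ennreal ((P n x - tp x)\<^sup>2) \<partial>surface_measure) \<longlonglongrightarrow> 0"
    using \<psi> unfolding H1_Gamma_def H1_vanishing_def has_trace_def by blast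
  have So: "open S" "S \<subseteq> Om" using S w(1,4) w(3) by auto
  have UD: "U n \<in> H1 D" "u \<in> H1 D" for n using H1_subset(1)[OF w(1,3,4)] U(1) uH by auto
  \<comment> \<open>Weighted extension is linear, so applying it to the differences of the two
    approximating sequences gives approximants of \<open>v\<close>, with the error controlled by
    both \<open>H1\<close> errors.\<close>
  define \<Phi> where "\<Phi> n = weighted_ext D a (\<lambda>x. U n x - P n x)" for n
  define v where "v = weighted_ext D a (\<lambda>x. u x - \<psi> x)"
  have vH: "v \<in> H1 S" unfolding v_def by (rule H1_subset(1)[OF w(1) So ext_H1(1)[OF W H1_diff(1)[OF w(3) UD(2) \<psi>H]]])
  have \<Phi>H: "\<Phi> n \<in> H1 S" for n unfolding \<Phi>_def by (rule H1_subset(1)[OF w(1) So ext_H1(1)[OF W H1_diff(1)[OF w(3) UD(1) P(1)]]])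
  have cD: "closure D \<subseteq> closure Om" by (rule closure_mono[OF w(4)])
  have \<Phi>c: "continuous_on (closure S) (\<Phi> n)" for n
  proof -
    have "continuous_on (closure D) (\<lambda>x. U n x - P n x)"
      by (intro continuous_on_diff P(2) continuous_on_subset[OF U(2) cD])
    from ext_continuous[OF W this] show ?thesis unfolding \<Phi>_def
      by (rule continuous_on_subset) (rule closure_mono[OF So(2)])
  qed
  have lim: "(\<lambda>n. H1_norm S (\<lambda>x. \<Phi> n x - v x)) \<longlonglongrightarrow> 0"
  proof -
    define K where "K = 9 * B ^ 4"
    have K: "0 \<le> K" by (simp add: K_def)
    have bound: "(H1_norm S (\<lambda>x. \<Phi> n x - v x))\<^sup>2 \<le> K * (2 * (H1_norm Om (\<lambda>x. U n x - u x))\<^sup>2 + 2 * (H1_norm D (\<lambda>x. P n x - \<psi> x))\<^sup>2)" for n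
    proof -
      let ?p = "\<lambda>x. (U n x - u x) - (P n x - \<psi> x)"
      have d1: "(\<lambda>x. U n x - u x) \<in> H1 Om" by (rule H1_diff(1)[OF w(1) U(1) uH])
      have d2: "(\<lambda>x. P n x - \<psi> x) \<in> H1 D" by (rule H1_diff(1)[OF w(3) P(1) \<psi>H])
      note s = H1_subset[OF w(1,3,4) d1]
      note p = H1_diff[OF w(3) s(1) d2]
      have "(\<lambda>x. \<Phi> n x - v x) = weighted_ext D a ?p"
        unfolding \<Phi>_def v_def ext_diff[of D a] by (simp add: weighted_ext_def fun_eq_iff)
      then have "(H1_norm S (\<lambda>x. \<Phi> n x - v x))\<^sup>2 \<le> (H1_norm Om (weighted_ext D a ?p))\<^sup>2"
        using H1_subset(2)[OF w(1) So ext_H1(1)[OF W p(1)]] by simp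
      also have "\<dots> \<le> K * (H1_norm D ?p)\<^sup>2" unfolding K_def by (rule ext_H1(2)[OF W p(1)])
      also have "\<dots> \<le> K * (2 * (H1_norm Om (\<lambda>x. U n x - u x))\<^sup>2 + 2 * (H1_norm D (\<lambda>x. P n x - \<psi> x))\<^sup>2)"
        using p(2) s(2) by (intro mult_left_mono[OF _ K]) linarith
      finally show ?thesis .
    qed
    have "(\<lambda>n. K * (2 * (H1_norm Om (\<lambda>x. U n x - u x))\<^sup>2 + 2 * (H1_norm D (\<lambda>x. P n x - \<psi> x))\<^sup>2)) \<longlonglongrightarrow> K * (2 * 0\<^sup>2 + 2 * 0\<^sup>2)"
      by (intro tendsto_intros U(3) P(3))
    then have r: "(\<lambda>n. K * (2 * (H1_norm Om (\<lambda>x. U n x - u x))\<^sup>2 + 2 * (H1_norm D (\<lambda>x. P n x - \<psi> x))\<^sup>2)) \<longlonglongrightarrow> 0" by simp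
    have "(\<lambda>n. (H1_norm S (\<lambda>x. \<Phi> n x - v x))\<^sup>2) \<longlonglongrightarrow> 0"
      by (rule Lim_null_comparison[OF _ r]) (use bound in auto)
    then have "(\<lambda>n. sqrt ((H1_norm S (\<lambda>x. \<Phi> n x - v x))\<^sup>2)) \<longlonglongrightarrow> sqrt 0" by (rule tendsto_real_sqrt)
    moreover have "0 \<le> H1_norm S f" for f by (simp add: H1_norm_def)
    ultimately show ?thesis by simp
  qed
  have tr: "(\<lambda>n. \<integral>\<^sup>+x\<in>frontier S. ennreal ((\<Phi> n x - 0)\<^sup>2) \<partial>surface_measure) \<longlonglongrightarrow> 0"
  proof -
    \<comment> \<open>The fourth power of the weight is at most \<open>B ^ 4\<close>, and the square
      of a difference costs a factor 2.\<close>
    define C where "C = 2 * B ^ 4"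
    have C: "0 \<le> C" by (simp add: C_def)
    let ?F = "\<lambda>n x. ennreal ((U n x - tu x)\<^sup>2) * indicator (frontier Om) x"
    let ?G = "\<lambda>n x. ennreal ((P n x - tp x)\<^sup>2) * indicator (frontier D) x"
    have mF: "?F n \<in> borel_measurable surface_measure" and mG: "?G n \<in> borel_measurable surface_measure" for n
      by (intro trace_integrand_measurable tu(1) tp(1) continuous_on_subset[OF U(2)] continuous_on_subset[OF P(2)]; auto simp: frontier_def)+
    have bound: "(\<integral>\<^sup>+x\<in>frontier S. ennreal ((\<Phi> n x - 0)\<^sup>2) \<partial>surface_measure) \<le> ennreal C * ((\<integral>\<^sup>+x. ?F n x \<partial>surface_measure) + (\<integral>\<^sup>+x. ?G n x \<partial>surface_measure))" for n
    proof -
      have "(\<integral>\<^sup>+x\<in>frontier S. ennreal ((\<Phi> n x - 0)\<^sup>2) \<partial>surface_measure) \<le> (\<integral>\<^sup>+x. ennreal C * (?F n x + ?G n x) \<partial>surface_measure)"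
      proof (rule nn_integral_mono_AE)
        show "AE x in surface_measure. ennreal ((\<Phi> n x - 0)\<^sup>2) * indicator (frontier S) x \<le> ennreal C * (?F n x + ?G n x)"
          using tu(2) tp(2)
        proof eventually_elim
          fix x assume t: "x \<in> frontier Om \<longrightarrow> tu x = 0" "x \<in> frontier D \<inter> frontier Om \<longrightarrow> tp x = 0"
          show "ennreal ((\<Phi> n x - 0)\<^sup>2) * indicator (frontier S) x \<le> ennreal C * (?F n x + ?G n x)"
          proof (cases "x \<in> frontier S \<and> \<Phi> n x \<noteq> 0")
            \<comment> \<open>A nonzero value forces \<open>a x \<noteq> 0\<close>, hence
              \<open>x\<close> is outside \<open>Om\<close> and lies on both frontiers. There both
              limit traces vanish almost everywhere, so the value is estimated by the two trace
              errors.\<close>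
            case True
            then have xD: "x \<in> closure D" and ax: "a x \<noteq> 0" by (auto simp: \<Phi>_def weighted_ext_def split: if_splits)
            have xO: "x \<in> closure Om" using xD cD by auto
            have xf: "x \<in> frontier Om" "x \<in> frontier D"
            proof -
              have "x \<notin> Om"
              proof
                assume "x \<in> Om"
                then have "S = D" using True S w(1) by (auto simp: frontier_def interior_open)
                then show False using w(9) True \<open>x \<in> Om\<close> ax by blast
              qed
              then show "x \<in> frontier Om" "x \<in> frontier D"
                using xO xD w(1,3,4) by (auto simp: frontier_def interior_open)
            qed
            then have t0: "tu x = 0" "tp x = 0" using t by auto
            have "(\<Phi> n x)\<^sup>2 = (a x) ^ 4 * (U n x - P n x)\<^sup>2"
              using xD by (simp add: \<Phi>_def weighted_ext_def power_mult_distrib flip: power_mult)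
            also have "\<dots> \<le> B ^ 4 * (2 * (U n x)\<^sup>2 + 2 * (P n x)\<^sup>2)"
            proof (intro mult_mono)
              show "(a x) ^ 4 \<le> B ^ 4" using power_mono[OF w(7)[OF xD], of 4] by simp
              show "(U n x - P n x)\<^sup>2 \<le> 2 * (U n x)\<^sup>2 + 2 * (P n x)\<^sup>2"
                using norm_add_sq_le[of "U n x" "- P n x"] by simp
            qed auto
            also have "\<dots> = C * ((U n x - tu x)\<^sup>2 + (P n x - tp x)\<^sup>2)" by (simp add: C_def t0 algebra_simps)
            finally have "ennreal ((\<Phi> n x)\<^sup>2) \<le> ennreal (C * ((U n x - tu x)\<^sup>2 + (P n x - tp x)\<^sup>2))" by (rule ennreal_leI)
            also have "\<dots> = ennreal C * (?F n x + ?G n x)" using xf C by (simp add: ennreal_mult ennreal_plus)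
            finally show ?thesis using True by simp
          qed auto
        qed
      qed
      also have "\<dots> = ennreal C * ((\<integral>\<^sup>+x. ?F n x \<partial>surface_measure) + (\<integral>\<^sup>+x. ?G n x \<partial>surface_measure))"
        by (simp only: nn_integral_cmult[OF borel_measurable_add[OF mF mG]] nn_integral_add[OF mF mG])
      finally show ?thesis .
    qed
    have "(\<lambda>n. ennreal C * ((\<integral>\<^sup>+x. ?F n x \<partial>surface_measure) + (\<integral>\<^sup>+x. ?G n x \<partial>surface_measure))) \<longlonglongrightarrow> ennreal C * (0 + 0)"
      by (intro ennreal_tendsto_cmult tendsto_add U(4) P(4)) simp
    then have r: "(\<lambda>n. ennreal C * ((\<integral>\<^sup>+x. ?F n x \<partial>surface_measure) + (\<integral>\<^sup>+x. ?G n x \<partial>surface_measure))) \<longlonglongrightarrow> 0" by simp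
    show ?thesis
      by (rule tendsto_sandwich[OF _ _ tendsto_const r]) (use bound in auto)
  qed
  \<comment> \<open>The trace is 0 on the whole frontier of \<open>S\<close>, so \<open>v\<close>
    vanishes on an arbitrary boundary part \<open>X\<close>.\<close>
  have "has_trace S v (\<lambda>x. 0)"
    unfolding has_trace_def using \<Phi>H \<Phi>c lim tr by (intro conjI exI[of _ \<Phi>]) auto
  then show ?thesis using vH unfolding H1_vanishing_def v_def by auto
qed

section \<open>The energy identity\<close>

lemma admissible_coeffD:
  assumes "admissible_coeff \<Omega> A amin amax"
  shows "0 < amin" "0 < amax" "A \<in> borel_measurable (lebesgue_on \<Omega>)"
    "x \<in> \<Omega> \<Longrightarrow> (A x *v \<xi>) \<bullet> \<zeta> = (A x *v \<zeta>) \<bullet> \<xi>"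
    "x \<in> \<Omega> \<Longrightarrow> 0 \<le> (A x *v \<xi>) \<bullet> \<xi>" "x \<in> \<Omega> \<Longrightarrow> (A x *v \<xi>) \<bullet> \<xi> \<le> amax * (norm \<xi>)\<^sup>2"
    "x \<in> \<Omega> \<Longrightarrow> \<bar>(A x *v \<xi>) \<bullet> \<zeta>\<bar> \<le> amax * ((norm \<xi>)\<^sup>2 + (norm \<zeta>)\<^sup>2)"
proof -
  show a: "0 < amin" "0 < amax" "A \<in> borel_measurable (lebesgue_on \<Omega>)"
    using assms by (auto simp: admissible_coeff_def Linf_def)
  have x: "transpose (A x) = A x" "amin * (norm \<xi>)\<^sup>2 \<le> (A x *v \<xi>) \<bullet> \<xi>" "(A x *v \<xi>) \<bullet> \<xi> \<le> amax * (norm \<xi>)\<^sup>2" if "x \<in> \<Omega>" for x \<xi>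
    using assms that by (auto simp: admissible_coeff_def)
  have sym: "(A x *v \<xi>) \<bullet> \<zeta> = (A x *v \<zeta>) \<bullet> \<xi>" if "x \<in> \<Omega>" for x \<xi> \<zeta>
    using dot_lmul_matrix[of \<xi> "A x" \<zeta>] x(1)[OF that] transpose_matrix_vector[of "A x" \<xi>] by (simp add: inner_commute)
  have pos: "0 \<le> (A x *v \<xi>) \<bullet> \<xi>" if "x \<in> \<Omega>" for x \<xi>
    using x(2)[OF that, of \<xi>] a(1) by (meson less_imp_le mult_nonneg_nonneg order_trans zero_le_power2)
  show "x \<in> \<Omega> \<Longrightarrow> (A x *v \<xi>) \<bullet> \<zeta> = (A x *v \<zeta>) \<bullet> \<xi>" "x \<in> \<Omega> \<Longrightarrow> 0 \<le> (A x *v \<xi>) \<bullet> \<xi>" "x \<in> \<Omega> \<Longrightarrow> (A x *v \<xi>) \<bullet> \<xi> \<le> amax * (norm \<xi>)\<^sup>2"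
    using sym pos x(3) by auto
  assume xO: "x \<in> \<Omega>"
  \<comment> \<open>Polarisation: the assumption bounds only the quadratic form, and the
    parallelogram law passes the bound on to mixed arguments.\<close>
  let ?q = "\<lambda>\<xi>. (A x *v \<xi>) \<bullet> \<xi>"
  have "?q (\<xi> + \<zeta>) - ?q (\<xi> - \<zeta>) = 4 * ((A x *v \<xi>) \<bullet> \<zeta>)"
    using sym[OF xO, of \<xi> \<zeta>] by (simp add: matrix_vector_right_distrib matrix_vector_mult_diff_distrib inner_simps)
  moreover have "?q (\<xi> + \<zeta>) \<le> amax * (2 * (norm \<xi>)\<^sup>2 + 2 * (norm \<zeta>)\<^sup>2)" "?q (\<xi> - \<zeta>) \<le> amax * (2 * (norm \<xi>)\<^sup>2 + 2 * (norm \<zeta>)\<^sup>2)"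
    using norm_add_sq_le[of \<xi> \<zeta>] norm_add_sq_le[of \<xi> "- \<zeta>"] a(2)
    by (auto intro!: order_trans[OF x(3)[OF xO]] mult_left_mono)
  moreover have "amax * (2 * (norm \<xi>)\<^sup>2 + 2 * (norm \<zeta>)\<^sup>2) = 2 * (amax * ((norm \<xi>)\<^sup>2 + (norm \<zeta>)\<^sup>2))" by (simp add: algebra_simps)
  moreover have "0 \<le> amax * ((norm \<xi>)\<^sup>2 + (norm \<zeta>)\<^sup>2)" using a(2) by simp
  ultimately show "\<bar>(A x *v \<xi>) \<bullet> \<zeta>\<bar> \<le> amax * ((norm \<xi>)\<^sup>2 + (norm \<zeta>)\<^sup>2)"
    using pos[OF xO, of "\<xi> + \<zeta>"] pos[OF xO, of "\<xi> - \<zeta>"] by linarith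
qed

lemma borel_measurable_vec_nth': "f \<in> borel_measurable M \<Longrightarrow> (\<lambda>x. f x $ i) \<in> borel_measurable M"
  for f :: "'a \<Rightarrow> ('b::euclidean_space) ^ 'n"
  by (rule measurable_compose[OF _ borel_measurable_continuous_onI]) (auto intro!: continuous_intros)

lemma coeff_measurable:
  fixes A :: "real ^ 'd \<Rightarrow> real ^ 'd ^ 'd" and g h :: "real ^ 'd \<Rightarrow> real ^ 'd"
  assumes "A \<in> borel_measurable M" "g \<in> borel_measurable M" "h \<in> borel_measurable M"
  shows "(\<lambda>x. (A x *v g x) \<bullet> h x) \<in> borel_measurable M"
  unfolding matrix_vector_mult_def inner_vec_def inner_real_def vec_lambda_beta
  by (intro borel_measurable_sum borel_measurable_times borel_measurable_vec_nth' assms)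

lemma coeff_integrable:
  fixes A :: "real ^ 'd \<Rightarrow> real ^ 'd ^ 'd" and g h :: "real ^ 'd \<Rightarrow> real ^ 'd"
  assumes A: "admissible_coeff \<Omega> A amin amax" and D: "D \<subseteq> \<Omega>" and g: "g \<in> L2 D" and h: "h \<in> L2 D"
  shows "integrable (lebesgue_on D) (\<lambda>x. (A x *v g x) \<bullet> h x)"
proof (rule Bochner_Integration.integrable_bound)
  note a = admissible_coeffD[OF A]
  show "integrable (lebesgue_on D) (\<lambda>x. amax * ((norm (g x))\<^sup>2 + (norm (h x))\<^sup>2))" using L2D(2)[OF g] L2D(2)[OF h] by auto
  show "(\<lambda>x. (A x *v g x) \<bullet> h x) \<in> borel_measurable (lebesgue_on D)"
    by (rule coeff_measurable[OF measurable_leb_on_mono[OF a(3) D] L2D(1)[OF g] L2D(1)[OF h]])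
  show "AE x in lebesgue_on D. norm ((A x *v g x) \<bullet> h x) \<le> norm (amax * ((norm (g x))\<^sup>2 + (norm (h x))\<^sup>2))"
  proof (rule AE_I2)
    fix x assume "x \<in> space (lebesgue_on D)"
    then have "x \<in> \<Omega>" using D by auto
    from a(7)[OF this, of "g x" "h x"]
    show "norm ((A x *v g x) \<bullet> h x) \<le> norm (amax * ((norm (g x))\<^sup>2 + (norm (h x))\<^sup>2))"
      unfolding real_norm_def by (rule order_trans[OF _ abs_ge_self])
  qed
qed

text \<open>Makes the form independent of the choice hidden in \<open>wgrad\<close>, so that it can
  be computed with gradients given by the product rule.\<close>

lemma energy_form_eq:
  fixes A :: "real ^ 'd \<Rightarrow> real ^ 'd ^ 'd"
  assumes A: "admissible_coeff \<Omega> A amin amax" and D: "D \<subseteq> \<Omega>" "open D"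
    and u: "is_weak_grad D u g" and v: "is_weak_grad D v h"
  shows "energy_form A \<epsilon> D u v = \<epsilon>\<^sup>2 * (LINT x|lebesgue_on D. (A x *v g x) \<bullet> h x) + (LINT x|lebesgue_on D. u x * v x)"
proof -
  have mA: "A \<in> borel_measurable (lebesgue_on D)" by (rule measurable_leb_on_mono[OF admissible_coeffD(3)[OF A] D(1)])
  have m: "g \<in> borel_measurable (lebesgue_on D)" "h \<in> borel_measurable (lebesgue_on D)"
     "wgrad D u \<in> borel_measurable (lebesgue_on D)" "wgrad D v \<in> borel_measurable (lebesgue_on D)"
    using locally_integrable_measurable[OF D(2)] is_weak_gradD(2) u v wgrad_weak_grad by blast+
  have "(LINT x|lebesgue_on D. (A x *v wgrad D u x) \<bullet> wgrad D v x) = (LINT x|lebesgue_on D. (A x *v g x) \<bullet> h x)"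
  proof (rule integral_cong_AE)
    show "AE x in lebesgue_on D. (A x *v wgrad D u x) \<bullet> wgrad D v x = (A x *v g x) \<bullet> h x"
      using wgrad_AE[OF D(2) u] wgrad_AE[OF D(2) v] by eventually_elim simp
  qed (intro coeff_measurable mA m)+
  then show ?thesis by (simp add: energy_form_def)
qed

lemma L2_scaleR_bounded:
  fixes p :: "real ^ 'd \<Rightarrow> real" and b :: "real ^ 'd \<Rightarrow> real ^ 'd"
  assumes p: "p \<in> L2 D" and b: "b \<in> borel_measurable (lebesgue_on D)" "AE x in lebesgue_on D. norm (b x) \<le> B"
  shows "(\<lambda>x. p x *\<^sub>R b x) \<in> L2 D"
proof -
  have m: "(\<lambda>x. norm (b x)) \<in> borel_measurable (lebesgue_on D)" using b(1) by simp
  have "AE x in lebesgue_on D. \<bar>norm (b x)\<bar> \<le> B" using b(2) by eventually_elim simp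
  from L2D(2)[OF L2_mult(1)[OF p m this]]
  have "integrable (lebesgue_on D) (\<lambda>x. (norm (p x *\<^sub>R b x))\<^sup>2)" by (simp add: power_mult_distrib mult.commute)
  moreover have "(\<lambda>x. p x *\<^sub>R b x) \<in> borel_measurable (lebesgue_on D)" using L2D(1)[OF p] b(1) by simp
  ultimately show ?thesis by (simp add: L2_def)
qed

text \<open>Testing both equations with \<open>a\<^sup>2 (u - \<psi>)\<close>, extended by zero.\<close>

lemma energy_identity:
  fixes A :: "real ^ 'd \<Rightarrow> real ^ 'd ^ 'd" and u \<psi> f :: "real ^ 'd \<Rightarrow> real"
  assumes W: "weight Om D a b B" and A: "admissible_coeff Om A amin amax" and f: "f \<in> L2 Om"
    and u: "weak_solution A \<epsilon> Om (H1_0 Om) f u" and \<psi>: "weak_solution A \<epsilon> D (H1_Gamma Om D) f \<psi>"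
  defines "w \<equiv> (\<lambda>x. u x - \<psi> x)" and "gw \<equiv> (\<lambda>x. wgrad Om u x - wgrad D \<psi> x)"
  shows "\<epsilon>\<^sup>2 * (LINT x|lebesgue_on D. (A x *v (a x *\<^sub>R gw x + w x *\<^sub>R b x)) \<bullet> (a x *\<^sub>R gw x + w x *\<^sub>R b x)) + (LINT x|lebesgue_on D. (a x * w x)\<^sup>2)
     = \<epsilon>\<^sup>2 * (LINT x|lebesgue_on D. (w x)\<^sup>2 * ((A x *v b x) \<bullet> b x))"
proof -
  note wt = weightD[OF W]
  have uH0: "u \<in> H1_0 Om" and \<psi>HG: "\<psi> \<in> H1_Gamma Om D" using u \<psi> by (auto simp: weak_solution_def)
  have uH: "u \<in> H1 Om" and \<psi>H: "\<psi> \<in> H1 D" using uH0 \<psi>HG by (auto simp: H1_0_def H1_Gamma_def H1_vanishing_def)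
  note hu = H1D[OF uH wt(1)] and h\<psi> = H1D[OF \<psi>H wt(3)]
  have uD: "is_weak_grad D u (wgrad Om u)" by (rule is_weak_grad_subset[OF wt(1,3,4) hu(2)])
  have uL: "u \<in> L2 D" "wgrad Om u \<in> L2 D" using L2_subset(1)[OF _ wt(4,12,13)] hu by auto
  have fL: "f \<in> L2 D" by (rule L2_subset(1)[OF f wt(4,12,13)])
  have wg: "is_weak_grad D w gw" unfolding w_def gw_def by (rule is_weak_grad_diff[OF wt(3) uD h\<psi>(2)])
  have wL: "w \<in> L2 D" "gw \<in> L2 D" unfolding w_def gw_def using L2_diff(1) uL h\<psi> by auto
  define v where "v = weighted_ext D a w"
  define G where "G = extg a b w gw"
  \<comment> \<open>The same function is admissible globally and locally: the membership is applied
    once with \<open>S = Om\<close> and once with \<open>S = D\<close>.\<close>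
  have vH: "v \<in> H1_0 Om" "v \<in> H1_Gamma Om D"
    unfolding v_def w_def H1_0_def H1_Gamma_def using ext_H1_vanishing[OF W uH0 \<psi>HG] by blast+
  have vg: "is_weak_grad Om v (\<lambda>x. if x \<in> D then G x else 0)" unfolding v_def G_def by (rule ext_weak_grad[OF W wg wL])
  have vD: "is_weak_grad D v G"
    by (rule is_weak_grad_AE[OF wt(3) is_weak_grad_subset[OF wt(1,3,4) vg]]) (auto intro!: AE_I2)
  note el = ext_L2[OF W wL]
  have GL: "G \<in> L2 D" unfolding G_def by (rule el(2))
  have vx: "v x = (if x \<in> D then (a x)\<^sup>2 * w x else 0)" if "x \<in> Om" for x unfolding v_def by (rule ext_eq[OF W that])
  have LOm: "(LINT x|lebesgue_on Om. k x * v x) = (LINT x|lebesgue_on D. k x * ((a x)\<^sup>2 * w x))" for k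
  proof -
    have "(LINT x|lebesgue_on Om. k x * v x) = (LINT x|lebesgue_on Om. (if x \<in> D then k x * ((a x)\<^sup>2 * w x) else 0))"
      by (intro Bochner_Integration.integral_cong refl) (use vx in auto)
    then show ?thesis using leb_on_zero_ext(1)[OF wt(4,12,13)] by simp
  qed
  have LD: "(LINT x|lebesgue_on D. k x * v x) = (LINT x|lebesgue_on D. k x * ((a x)\<^sup>2 * w x))" for k
    by (intro Bochner_Integration.integral_cong refl) (use vx wt(4) in auto)
  have LA: "(LINT x|lebesgue_on Om. (A x *v wgrad Om u x) \<bullet> (if x \<in> D then G x else 0)) = (LINT x|lebesgue_on D. (A x *v wgrad Om u x) \<bullet> G x)"
  proof -
    have "(LINT x|lebesgue_on Om. (A x *v wgrad Om u x) \<bullet> (if x \<in> D then G x else 0)) = (LINT x|lebesgue_on Om. (if x \<in> D then (A x *v wgrad Om u x) \<bullet> G x else 0))"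
      by (intro Bochner_Integration.integral_cong refl) auto
    then show ?thesis using leb_on_zero_ext(1)[OF wt(4,12,13)] by simp
  qed
  have e1: "\<epsilon>\<^sup>2 * (LINT x|lebesgue_on D. (A x *v wgrad Om u x) \<bullet> G x) + (LINT x|lebesgue_on D. u x * ((a x)\<^sup>2 * w x)) = (LINT x|lebesgue_on D. f x * ((a x)\<^sup>2 * w x))"
  proof -
    have "energy_form A \<epsilon> Om u v = (LINT x|lebesgue_on Om. f x * v x)" using u vH(1) by (auto simp: weak_solution_def)
    then show ?thesis unfolding energy_form_eq[OF A order_refl wt(1) hu(2) vg] LA LOm .
  qed
  have e2: "\<epsilon>\<^sup>2 * (LINT x|lebesgue_on D. (A x *v wgrad D \<psi> x) \<bullet> G x) + (LINT x|lebesgue_on D. \<psi> x * ((a x)\<^sup>2 * w x)) = (LINT x|lebesgue_on D. f x * ((a x)\<^sup>2 * w x))"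
  proof -
    have "energy_form A \<epsilon> D \<psi> v = (LINT x|lebesgue_on D. f x * v x)" using \<psi> vH(2) by (auto simp: weak_solution_def)
    then show ?thesis unfolding energy_form_eq[OF A wt(4,3) h\<psi>(2) vD] LD .
  qed
  have aw: "(\<lambda>x. (a x)\<^sup>2 * w x) \<in> L2 D" by (rule el(1))
  have d1: "(LINT x|lebesgue_on D. (A x *v wgrad Om u x) \<bullet> G x) - (LINT x|lebesgue_on D. (A x *v wgrad D \<psi> x) \<bullet> G x) = (LINT x|lebesgue_on D. (A x *v gw x) \<bullet> G x)"
    using coeff_integrable[OF A wt(4) uL(2) GL] coeff_integrable[OF A wt(4) h\<psi>(3) GL]
    by (subst Bochner_Integration.integral_diff[symmetric]) (simp_all add: gw_def matrix_vector_mult_diff_distrib inner_diff_left)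
  have d2: "(LINT x|lebesgue_on D. u x * ((a x)\<^sup>2 * w x)) - (LINT x|lebesgue_on D. \<psi> x * ((a x)\<^sup>2 * w x)) = (LINT x|lebesgue_on D. (a x * w x)\<^sup>2)"
  proof -
    have "integrable (lebesgue_on D) (\<lambda>x. u x * ((a x)\<^sup>2 * w x))" "integrable (lebesgue_on D) (\<lambda>x. \<psi> x * ((a x)\<^sup>2 * w x))"
      using L2_inner_integrable[OF uL(1) aw] L2_inner_integrable[OF h\<psi>(1) aw] by simp_all
    then have "(LINT x|lebesgue_on D. u x * ((a x)\<^sup>2 * w x)) - (LINT x|lebesgue_on D. \<psi> x * ((a x)\<^sup>2 * w x)) = (LINT x|lebesgue_on D. u x * ((a x)\<^sup>2 * w x) - \<psi> x * ((a x)\<^sup>2 * w x))"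
      by (rule Bochner_Integration.integral_diff[symmetric])
    also have "(\<lambda>x. u x * ((a x)\<^sup>2 * w x) - \<psi> x * ((a x)\<^sup>2 * w x)) = (\<lambda>x. (a x * w x)\<^sup>2)"
      by (rule ext) (simp add: w_def power2_eq_square algebra_simps)
    finally show ?thesis .
  qed
  \<comment> \<open>The right-hand sides coincide because \<open>v\<close> lives on
    \<open>D\<close>, so \<open>f\<close> cancels on subtraction.\<close>
  have star: "\<epsilon>\<^sup>2 * (LINT x|lebesgue_on D. (A x *v gw x) \<bullet> G x) + (LINT x|lebesgue_on D. (a x * w x)\<^sup>2) = 0"
    unfolding d1[symmetric] d2[symmetric] using e1 e2 by (simp add: algebra_simps)
  have wbL: "(\<lambda>x. w x *\<^sub>R b x) \<in> L2 D" by (rule L2_scaleR_bounded[OF wL(1) wt(15,8)])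
  \<comment> \<open>Expanding the square, symmetry merges the two mixed terms into 2 a w (A gw) b.
    Together with the term in \<open>gw\<close> they form the pairing with \<open>G\<close>, and
    only the term quadratic in \<open>b\<close> is left over.\<close>
  have pt: "(A x *v (a x *\<^sub>R gw x + w x *\<^sub>R b x)) \<bullet> (a x *\<^sub>R gw x + w x *\<^sub>R b x) = (A x *v gw x) \<bullet> G x + (A x *v (w x *\<^sub>R b x)) \<bullet> (w x *\<^sub>R b x)"
    if "x \<in> D" for x
  proof -
    have "(A x *v b x) \<bullet> gw x = (A x *v gw x) \<bullet> b x" using admissible_coeffD(4)[OF A] that wt(4) by blast
    then show ?thesis
      by (simp add: G_def extg_def matrix_vector_right_distrib matrix_vector_mult_scaleR inner_simps power2_eq_square algebra_simps)
  qed
  have "(LINT x|lebesgue_on D. (A x *v (a x *\<^sub>R gw x + w x *\<^sub>R b x)) \<bullet> (a x *\<^sub>R gw x + w x *\<^sub>R b x))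
      = (LINT x|lebesgue_on D. (A x *v gw x) \<bullet> G x + (A x *v (w x *\<^sub>R b x)) \<bullet> (w x *\<^sub>R b x))"
    by (intro Bochner_Integration.integral_cong refl) (use pt in auto)
  also have "\<dots> = (LINT x|lebesgue_on D. (A x *v gw x) \<bullet> G x) + (LINT x|lebesgue_on D. (A x *v (w x *\<^sub>R b x)) \<bullet> (w x *\<^sub>R b x))"
    by (rule Bochner_Integration.integral_add[OF coeff_integrable[OF A wt(4) wL(2) GL] coeff_integrable[OF A wt(4) wbL wbL]])
  also have "(LINT x|lebesgue_on D. (A x *v (w x *\<^sub>R b x)) \<bullet> (w x *\<^sub>R b x)) = (LINT x|lebesgue_on D. (w x)\<^sup>2 * ((A x *v b x) \<bullet> b x))"
    by (simp add: matrix_vector_mult_scaleR power2_eq_square mult.assoc)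
  finally show ?thesis using star by (simp add: distrib_left)
qed

text \<open>The solution itself is the test function; the gradient term is nonnegative and is
  dropped, and Cauchy-Schwarz leaves one factor to cancel.\<close>

lemma weak_solution_L2_le:
  fixes A :: "real ^ 'd \<Rightarrow> real ^ 'd ^ 'd" and \<psi> f :: "real ^ 'd \<Rightarrow> real"
  assumes A: "admissible_coeff Om A amin amax" and D: "D \<subseteq> Om" "open D" and f: "f \<in> L2 D"
    and \<psi>: "weak_solution A \<epsilon> D V f \<psi>" "V \<subseteq> H1 D"
  shows "L2_norm D \<psi> \<le> L2_norm D f"
proof -
  have "\<psi> \<in> H1 D" using \<psi> by (auto simp: weak_solution_def)
  note h = H1D[OF this D(2)]
  have "energy_form A \<epsilon> D \<psi> \<psi> = (LINT x|lebesgue_on D. f x * \<psi> x)" using \<psi>(1) by (auto simp: weak_solution_def)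
  then have e: "\<epsilon>\<^sup>2 * (LINT x|lebesgue_on D. (A x *v wgrad D \<psi> x) \<bullet> wgrad D \<psi> x) + (L2_norm D \<psi>)\<^sup>2 = (LINT x|lebesgue_on D. f x * \<psi> x)"
    unfolding energy_form_def L2_norm_sq by (simp add: power2_eq_square[of "\<psi> _"])
  have "0 \<le> (LINT x|lebesgue_on D. (A x *v wgrad D \<psi> x) \<bullet> wgrad D \<psi> x)"
    by (rule Bochner_Integration.integral_nonneg) (use admissible_coeffD(5)[OF A] D(1) in auto)
  then have "0 \<le> \<epsilon>\<^sup>2 * (LINT x|lebesgue_on D. (A x *v wgrad D \<psi> x) \<bullet> wgrad D \<psi> x)" by simp
  then have "(L2_norm D \<psi>)\<^sup>2 \<le> L2_norm D f * L2_norm D \<psi>" using e L2_Cauchy_Schwarz[OF f h(1)] by linarith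
  then show ?thesis using L2_norm_nonneg[of D \<psi>] L2_norm_nonneg[of D f]
    by (cases "L2_norm D \<psi> = 0") (auto simp: power2_eq_square)
qed

section \<open>The two weights\<close>

text \<open>\<open>enn2real\<close> sends infinity to 0, so the essential supremum must be known to
  be finite before its real value can serve as a bound; \<open>B\<close> provides this.\<close>

lemma AE_Linf_norm:
  assumes b: "b \<in> borel_measurable (lebesgue_on S)" "AE x in lebesgue_on S. norm (b x) \<le> B"
  shows "AE x in lebesgue_on S. norm (b x) \<le> Linf_norm S b"
proof -
  let ?s = "esssup (lebesgue_on S) (\<lambda>x. ennreal (norm (b x)))"
  have "?s \<le> ennreal B"
    by (rule esssup_I) (use b in \<open>auto elim!: eventually_mono intro!: ennreal_leI\<close>)
  then have fin: "?s < top" using le_less_trans ennreal_less_top by blast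
  have "AE x in lebesgue_on S. ennreal (norm (b x)) \<le> ?s" by (rule esssup_AE)
  then show ?thesis
  proof eventually_elim
    fix x assume "ennreal (norm (b x)) \<le> ?s"
    from enn2real_mono[OF this fin] show "norm (b x) \<le> Linf_norm S b" by (simp add: Linf_norm_def)
  qed
qed

lemma Linf_AE_bound:
  assumes "g \<in> Linf S" obtains B where "0 \<le> B" "AE x in lebesgue_on S. norm (g x) \<le> B"
proof -
  let ?s = "esssup (lebesgue_on S) (\<lambda>x. ennreal (norm (g x)))"
  have fin: "?s < top" using assms by (simp add: Linf_def)
  have "AE x in lebesgue_on S. ennreal (norm (g x)) \<le> ?s" by (rule esssup_AE)
  then have "AE x in lebesgue_on S. norm (g x) \<le> enn2real ?s"
    by eventually_elim (use enn2real_mono[OF _ fin] in fastforce)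
  then show thesis using that[of "enn2real ?s"] by simp
qed

lemma compact_norm_bound:
  fixes f :: "'a::topological_space \<Rightarrow> 'b::real_normed_vector"
  assumes "compact K" "continuous_on K f" shows "\<exists>B. \<forall>x\<in>K. norm (f x) \<le> B"
  using compact_imp_bounded[OF compact_continuous_image[OF assms(2,1)]] by (auto simp: bounded_iff)

lemma closed_zero_set:
  fixes a :: "'a::topological_space \<Rightarrow> real"
  assumes "continuous_on S a" "closed S" "Z \<subseteq> S" "\<And>x. x \<in> Z \<Longrightarrow> a x = 0" "x \<in> closure Z"
  shows "a x = 0"
proof -
  have "closed {x \<in> S. a x = 0}" using assms(1,2) by (rule continuous_closed_preimage_constant)
  then have "closure Z \<subseteq> {x \<in> S. a x = 0}" using assms(3,4) by (intro closure_minimal) auto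
  then show ?thesis using assms(5) by auto
qed

text \<open>The values of \<open>\<theta>\<close> carry no continuity, so the weight is its
  continuous representative on \<open>closure Om\<close>, with the same weak gradient. Pointwise
  vanishing of \<open>\<theta>\<close> outside \<open>\<omega>\<close> reaches the representative
  through dense sets of full measure.\<close>

lemma weight_of_W1inf:
  fixes \<theta> :: "real ^ 'd \<Rightarrow> real"
  assumes Om: "lipschitz_domain Om" and D: "lipschitz_domain D" "D \<subseteq> Om" and \<omega>: "\<omega> \<subseteq> D"
    and \<theta>: "\<theta> \<in> W1inf Om" "\<And>x. x \<in> Om \<Longrightarrow> 0 \<le> \<theta> x \<and> \<theta> x \<le> 1" "\<And>x. x \<in> Om - \<omega> \<Longrightarrow> \<theta> x = 0"
  obtains a B where "weight Om D a (wgrad Om \<theta>) B" "is_weak_grad Om \<theta> (wgrad Om \<theta>)"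
    "AE x in lebesgue_on D. \<theta> x = a x" "AE x in lebesgue_on Om. norm (wgrad Om \<theta> x) \<le> B" "0 \<le> B"
proof -
  note O = lipschitz_domainD[OF Om] and DD = lipschitz_domainD[OF D(1)]
  have l: "Om \<in> sets lebesgue" "D \<in> sets lebesgue" using O(1) DD(1) by simp_all
  obtain g where g: "is_weak_grad Om \<theta> g" "g \<in> Linf Om" using \<theta>(1) by (auto simp: W1inf_def)
  obtain B0 where B0: "0 \<le> B0" "AE x in lebesgue_on Om. norm (g x) \<le> B0" by (rule Linf_AE_bound[OF g(2)]) (rule that)
  let ?b = "wgrad Om \<theta>"
  have wg: "is_weak_grad Om \<theta> ?b" by (rule wgrad_weak_grad[OF g(1)])
  define B1 where "B1 = max B0 1"
  have b1: "AE x in lebesgue_on Om. norm (?b x) \<le> B1"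
    using wgrad_AE[OF O(1) g(1)] B0(2) by eventually_elim (simp add: B1_def)
  have t1: "AE x in lebesgue_on Om. \<bar>\<theta> x\<bar> \<le> B1"
    by (rule AE_I2) (use \<theta>(2) in \<open>fastforce simp: B1_def\<close>)
  obtain a where a: "continuous_on (closure Om) a" "AE x in lebesgue_on Om. \<theta> x = a x"
    by (rule lipschitz_domain_continuous_rep[OF Om wg t1 b1]) (use B0(1) in \<open>auto simp: B1_def intro: that\<close>)
  have cD: "closure D \<subseteq> closure Om" by (rule closure_mono[OF D(2)])
  obtain B2 where B2: "\<And>x. x \<in> closure Om \<Longrightarrow> \<bar>a x\<bar> \<le> B2"
    using compact_norm_bound[OF _ a(1)] O(3) by (auto simp: compact_closure)
  define B where "B = max B1 B2"
  \<comment> \<open>Close to \<open>x\<close> there are points of \<open>Om\<close> outside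
    \<open>closure D\<close> at which \<open>\<theta>\<close> and \<open>a\<close> agree; there both
    are 0, and continuity carries this to \<open>x\<close>.\<close>
  have out: "a x = 0" if x: "x \<in> closure Om" "x \<notin> closure D" for x
  proof (rule closed_zero_set[OF a(1) closed_closure])
    show "{x \<in> Om. a x = 0} \<subseteq> closure Om" using closure_subset[of Om] by auto
    show "x \<in> closure {x \<in> Om. a x = 0}"
      unfolding closure_approachable
    proof (intro allI impI)
      fix e :: real assume e: "e > 0"
      have o: "open (Om \<inter> - closure D)" using O(1) by auto
      have "x \<in> - closure D" using x by simp
      then obtain r where r: "r > 0" "ball x r \<subseteq> - closure D" using open_contains_ball[of "- closure D"] by auto
      have "min e r > 0" using e r(1) by simp
      from closure_approachable[THEN iffD1, rule_format, OF x(1) this]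
      obtain y where y: "y \<in> Om" "dist y x < min e r" by auto
      have yo: "y \<in> Om \<inter> - closure D" using y r(2) by (auto simp: dist_commute)
      have ae: "AE x in lebesgue_on (Om \<inter> - closure D). \<theta> x = a x"
        by (rule AE_leb_on_mono[OF a(2) _ l(1) sets_leb_open[OF o]]) auto
      have "e - dist y x > 0" using y by simp
      from AE_dense[OF o ae yo this] obtain z where z: "z \<in> Om" "z \<notin> closure D" "dist y z < e - dist y x" "\<theta> z = a z" by auto
      have "z \<in> Om - \<omega>" using z \<omega> closure_subset[of D] by auto
      then have "a z = 0" using \<theta>(3) z(4) by metis
      moreover have "dist z x < e" using z(3) dist_triangle[of z x y] by (simp add: dist_commute)
      ultimately show "\<exists>y\<in>{x \<in> Om. a x = 0}. dist y x < e" using z(1) by auto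
    qed
  qed auto
  have S: "a x = 0" if x: "x \<in> closure (closure Om - closure D)" for x
    by (rule closed_zero_set[OF a(1) closed_closure _ _ x]) (use out in auto)
  \<comment> \<open>Inside \<open>Om\<close> a frontier point of \<open>D\<close> is a limit of
    exterior points by the Lipschitz property of \<open>D\<close>, so the vanishing just obtained
    applies to it.\<close>
  have fr: "x \<in> closure (closure Om - closure D)" if x: "x \<in> frontier D" "x \<in> Om" for x
    unfolding closure_approachable
  proof (intro allI impI)
    fix e :: real assume e: "e > 0"
    obtain r where r: "r > 0" "ball x r \<subseteq> Om" using x(2) O(1) open_contains_ball by blast
    have "min e r > 0" using e r by simp
    from lipschitz_domain_exterior[OF D(1) x(1) this] obtain y where y: "y \<in> ball x (min e r)" "y \<notin> closure D" by blast
    have "y \<in> Om" using y(1) r(2) by auto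
    then have "y \<in> closure Om" using closure_subset by blast
    then show "\<exists>y\<in>closure Om - closure D. dist y x < e" using y by (auto simp: dist_commute)
  qed
  have "is_weak_grad D a ?b"
    by (rule is_weak_grad_AE[OF DD(1) is_weak_grad_subset[OF O(1) DD(1) D(2) wg] AE_leb_on_mono[OF a(2) D(2) l]]) simp
  moreover have "AE x in lebesgue_on Om. norm (?b x) \<le> B" using b1 by eventually_elim (simp add: B_def)
  moreover from this have "AE x in lebesgue_on D. norm (?b x) \<le> B" by (rule AE_leb_on_mono[OF _ D(2) l])
  moreover have "\<bar>a x\<bar> \<le> B" if "x \<in> closure D" for x using B2[of x] cD that by (auto simp: B_def)
  ultimately have "weight Om D a ?b B"
    unfolding weight_def using O(1,3) DD(1) D(2) continuous_on_subset[OF a(1) cD] S fr by auto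
  moreover have "AE x in lebesgue_on D. \<theta> x = a x" by (rule AE_leb_on_mono[OF a(2) D(2) l])
  moreover have "0 \<le> B" using B0(1) by (simp add: B_def B1_def)
  ultimately show thesis using that wg \<open>AE x in lebesgue_on Om. norm (?b x) \<le> B\<close> by blast
qed

text \<open>Near \<open>x\<close> there are a point of \<open>D\<close> and a point of
  \<open>Om\<close> outside \<open>closure D\<close>; a short polygon inside \<open>Om\<close> joins
  them and must cross the frontier of \<open>D\<close>. The cutoff is prescribed only on the
  frontier of \<open>D\<close> away from that of \<open>Om\<close>; by density it vanishes also at
  such points \<open>x\<close> of the outer boundary.\<close>

lemma frontier_dense_on_boundary:
  fixes Om D :: "(real ^ 'd) set"
  assumes Om: "lipschitz_domain Om" and D: "open D" "D \<subseteq> Om"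
    and x: "x \<in> closure D" "x \<in> closure (closure Om - closure D)"
  shows "x \<in> closure (frontier D \<inter> Om)"
  unfolding closure_approachable
proof (intro allI impI)
  fix e :: real assume e: "e > 0"
  have "x \<in> closure Om" using x(1) closure_mono[OF D(2)] by blast
  then obtain r K where r: "0 < r" "0 \<le> K" and ts: "\<And>y z. y \<in> Om \<inter> ball x r \<Longrightarrow> z \<in> Om \<inter> ball x r \<Longrightarrow> three_segments Om K y z"
    using lipschitz_domain_three_segments[OF Om] by blast
  \<comment> \<open>The two points are less than 2 \<rho> apart, so the crossing is within 6 K
    \<rho> of \<open>y\<close> and within (6 K + 1) \<rho> of \<open>x\<close>; the choice makes
    this less than \<open>e\<close>.\<close>
  define \<rho> where "\<rho> = min r (e / (6 * K + 2))"
  have \<rho>: "0 < \<rho>" "\<rho> \<le> r" using r e by (auto simp: \<rho>_def)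
  have \<rho>e: "6 * (K * \<rho>) + \<rho> < e"
  proof -
    have "(6 * K + 2) * \<rho> \<le> (6 * K + 2) * (e / (6 * K + 2))" using r(2) by (intro mult_left_mono) (auto simp: \<rho>_def)
    also have "\<dots> = e" using r(2) by simp
    finally show ?thesis using \<rho>(1) by (simp add: algebra_simps)
  qed
  obtain y where y: "y \<in> D" "dist y x < \<rho>"
    using closure_approachable[THEN iffD1, rule_format, OF x(1) \<rho>(1)] by auto
  obtain z' where z': "z' \<in> closure Om" "z' \<notin> closure D" "dist z' x < \<rho>"
    using closure_approachable[THEN iffD1, rule_format, OF x(2) \<rho>(1)] by auto
  have "z' \<in> - closure D \<inter> ball x \<rho>" using z' by (auto simp: dist_commute)
  moreover have "open (- closure D \<inter> ball x \<rho>)" by auto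
  \<comment> \<open>The point \<open>z'\<close> lies only in the closure of \<open>Om\<close>; an
    open neighbourhood of it that avoids \<open>closure D\<close> meets \<open>Om\<close>
    itself.\<close>
  ultimately have "(- closure D \<inter> ball x \<rho>) \<inter> Om \<noteq> {}"
    using z'(1) open_Int_closure_eq_empty[of "- closure D \<inter> ball x \<rho>" Om] by blast
  then obtain z where z: "z \<in> Om" "z \<notin> closure D" "dist x z < \<rho>" by auto
  have "three_segments Om K y z" using y z D(2) \<rho>(2) by (intro ts) (auto simp: dist_commute)
  then obtain P where P: "connected P" "P \<subseteq> Om" "y \<in> P" "z \<in> P" "\<And>w. w \<in> P \<Longrightarrow> norm (w - y) \<le> 3 * (K * norm (y - z))"
    by (rule three_segments_subset) (rule that)
  have "P \<inter> frontier D \<noteq> {}"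
    using P y z closure_subset[of D] by (intro connected_Int_frontier) auto
  then obtain w where w: "w \<in> P" "w \<in> frontier D" by blast
  have "norm (y - z) \<le> 2 * \<rho>" using dist_triangle[of y z x] y z by (simp add: dist_norm)
  then have "K * norm (y - z) \<le> K * (2 * \<rho>)" using r(2) by (rule mult_left_mono)
  then have "norm (w - y) \<le> 6 * (K * \<rho>)" using P(5)[OF w(1)] by simp
  then have "dist w x < e" using dist_triangle[of w x y] y(2) \<rho>e by (simp add: dist_norm)
  then show "\<exists>y\<in>frontier D \<inter> Om. dist y x < e" using w P(2) by blast
qed

lemma weight_of_C1:
  fixes W :: "real ^ 'd \<Rightarrow> real"
  assumes Om: "lipschitz_domain Om" and D: "open D" "D \<subseteq> Om"
    and W: "continuous_on (closure D) W" "continuous_on (closure D) b"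
      "\<And>x. x \<in> D \<Longrightarrow> (W has_derivative (\<lambda>h. b x \<bullet> h)) (at x)" "\<And>x. x \<in> frontier D - frontier Om \<Longrightarrow> W x = 0"
  obtains B where "weight Om D W b B"
proof -
  note O = lipschitz_domainD[OF Om]
  have "bounded D" using O(3) D(2) bounded_subset by blast
  then have cD: "compact (closure D)" by (simp add: compact_closure)
  obtain B1 where "\<And>x. x \<in> closure D \<Longrightarrow> \<bar>W x\<bar> \<le> B1" using compact_norm_bound[OF cD W(1)] by auto
  moreover obtain B2 where "\<And>x. x \<in> closure D \<Longrightarrow> norm (b x) \<le> B2" using compact_norm_bound[OF cD W(2)] by auto
  ultimately have B: "\<And>x. x \<in> closure D \<Longrightarrow> \<bar>W x\<bar> \<le> B1" "\<And>x. x \<in> closure D \<Longrightarrow> norm (b x) \<le> B2" by auto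
  have z: "W x = 0" if "x \<in> frontier D" "x \<in> Om" for x
    using W(4)[of x] that O(1) by (auto simp: frontier_def interior_open)
  have S: "W x = 0" if x: "x \<in> closure D" "x \<in> closure (closure Om - closure D)" for x
    by (rule closed_zero_set[OF W(1) closed_closure _ _ frontier_dense_on_boundary[OF Om D x]])
       (use z in \<open>auto simp: frontier_def\<close>)
  have "is_weak_grad D W b"
    by (rule C1_is_weak_grad[OF D(1) W(3) continuous_on_subset[OF W(2) closure_subset]])
  moreover have "AE x in lebesgue_on D. norm (b x) \<le> max B1 B2"
    by (rule AE_I2) (use B(2) closure_subset[of D] in fastforce)
  moreover have "\<bar>W x\<bar> \<le> max B1 B2" if "x \<in> closure D" for x using B(1)[OF that] by simp
  ultimately have "weight Om D W b (max B1 B2)"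
    unfolding weight_def using O(1,3) D W(1) z S by blast
  then show thesis by (rule that)
qed

section \<open>The estimates\<close>

lemma weighted_error_in_L2:
  fixes A :: "real ^ 'd \<Rightarrow> real ^ 'd ^ 'd" and u \<psi> f :: "real ^ 'd \<Rightarrow> real"
  assumes W: "weight Om D a b B"
    and u: "weak_solution A \<epsilon> Om (H1_0 Om) f u" and \<psi>: "weak_solution A \<epsilon> D (H1_Gamma Om D) f \<psi>"
  shows "u \<in> L2 D" "\<psi> \<in> L2 D" "(\<lambda>x. u x - \<psi> x) \<in> L2 D" "(\<lambda>x. wgrad Om u x - wgrad D \<psi> x) \<in> L2 D"
    "is_weak_grad D (\<lambda>x. u x - \<psi> x) (\<lambda>x. wgrad Om u x - wgrad D \<psi> x)"
proof -
  note wt = weightD[OF W]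
  have uH: "u \<in> H1 Om" and \<psi>H: "\<psi> \<in> H1 D"
    using u \<psi> by (auto simp: weak_solution_def H1_0_def H1_Gamma_def H1_vanishing_def)
  note hu = H1D[OF uH wt(1)] and h\<psi> = H1D[OF \<psi>H wt(3)]
  show uL: "u \<in> L2 D" "\<psi> \<in> L2 D" using L2_subset(1)[OF hu(1) wt(4,12,13)] h\<psi> by auto
  show "(\<lambda>x. u x - \<psi> x) \<in> L2 D" by (rule L2_diff(1)[OF uL])
  show "(\<lambda>x. wgrad Om u x - wgrad D \<psi> x) \<in> L2 D" by (rule L2_diff(1)[OF L2_subset(1)[OF hu(3) wt(4,12,13)] h\<psi>(3)])
  show "is_weak_grad D (\<lambda>x. u x - \<psi> x) (\<lambda>x. wgrad Om u x - wgrad D \<psi> x)"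
    by (rule is_weak_grad_diff[OF wt(3) is_weak_grad_subset[OF wt(1,3,4) hu(2)] h\<psi>(2)])
qed

text \<open>Covers both uses of the energy identity: \<open>k = 1\<close> with the essential
  supremum of the gradient on \<open>\<omega>\<close>, and the exponential \<open>k\<close> with a
  gradient proportional to it on \<open>D\<close>.\<close>

lemma coeff_weight_integral_le:
  fixes A :: "real ^ 'd \<Rightarrow> real ^ 'd ^ 'd" and w k :: "real ^ 'd \<Rightarrow> real"
  assumes A: "admissible_coeff Om A amin amax" and S: "S \<subseteq> Om" "S \<in> sets lebesgue"
    and w: "w \<in> L2 S" and b: "b \<in> borel_measurable (lebesgue_on S)" "AE x in lebesgue_on S. norm (b x) \<le> B"
    and le: "AE x in lebesgue_on S. norm (b x) \<le> c * \<bar>k x\<bar>" and kw: "(\<lambda>x. k x * w x) \<in> L2 S"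
  shows "(LINT x|lebesgue_on S. (w x)\<^sup>2 * ((A x *v b x) \<bullet> b x)) \<le> amax * c\<^sup>2 * (L2_norm S (\<lambda>x. k x * w x))\<^sup>2"
proof -
  have wb: "(\<lambda>x. w x *\<^sub>R b x) \<in> L2 S" by (rule L2_scaleR_bounded[OF w b])
  have "(\<lambda>x. (A x *v (w x *\<^sub>R b x)) \<bullet> (w x *\<^sub>R b x)) = (\<lambda>x. (w x)\<^sup>2 * ((A x *v b x) \<bullet> b x))"
    by (rule ext) (simp add: matrix_vector_mult_scaleR power2_eq_square mult.assoc)
  then have i: "integrable (lebesgue_on S) (\<lambda>x. (w x)\<^sup>2 * ((A x *v b x) \<bullet> b x))"
    using coeff_integrable[OF A S(1) wb wb] by simp
  have i2: "integrable (lebesgue_on S) (\<lambda>x. amax * c\<^sup>2 * (norm (k x * w x))\<^sup>2)" using L2D(2)[OF kw] by auto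
  have "AE x in lebesgue_on S. x \<in> S" by (rule AE_I2) simp
  with le have "AE x in lebesgue_on S. (w x)\<^sup>2 * ((A x *v b x) \<bullet> b x) \<le> amax * c\<^sup>2 * (norm (k x * w x))\<^sup>2"
  proof eventually_elim
    fix x assume x: "norm (b x) \<le> c * \<bar>k x\<bar>" "x \<in> S"
    have "(norm (b x))\<^sup>2 \<le> c\<^sup>2 * (k x)\<^sup>2" using power_mono[OF x(1), of 2] by (simp add: power_mult_distrib)
    then have "amax * (norm (b x))\<^sup>2 \<le> amax * (c\<^sup>2 * (k x)\<^sup>2)" using admissible_coeffD(2)[OF A] by (intro mult_left_mono) auto
    then have "(A x *v b x) \<bullet> b x \<le> amax * (c\<^sup>2 * (k x)\<^sup>2)" using admissible_coeffD(6)[OF A, of x "b x"] x(2) S by auto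
    then have "(w x)\<^sup>2 * ((A x *v b x) \<bullet> b x) \<le> (w x)\<^sup>2 * (amax * (c\<^sup>2 * (k x)\<^sup>2))" by (intro mult_left_mono) auto
    then show "(w x)\<^sup>2 * ((A x *v b x) \<bullet> b x) \<le> amax * c\<^sup>2 * (norm (k x * w x))\<^sup>2" by (simp add: power_mult_distrib mult_ac)
  qed
  from integral_mono_AE[OF i i2 this] show ?thesis by (simp add: L2_norm_sq)
qed

text \<open>The identity holds on \<open>D\<close>, while the claim involves \<open>\<omega>\<close>
  alone. The left side only shrinks on passing to \<open>\<omega>\<close> since its integrands are
  nonnegative, and the right side lives on \<open>\<omega>\<close> because a weak gradient vanishes
  almost everywhere on the zero set of its function.\<close>

lemma partition_function_estimate:
  fixes A :: "real ^ 'd \<Rightarrow> real ^ 'd ^ 'd" and u \<psi> f \<theta> :: "real ^ 'd \<Rightarrow> real"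
  assumes Om: "lipschitz_domain Om" and D: "lipschitz_domain D" "D \<subseteq> Om" and \<omega>: "open \<omega>" "\<omega> \<subseteq> D"
    and \<theta>: "\<theta> \<in> W1inf Om" "\<And>x. x \<in> Om \<Longrightarrow> 0 \<le> \<theta> x \<and> \<theta> x \<le> 1" "\<And>x. x \<in> Om - \<omega> \<Longrightarrow> \<theta> x = 0"
    and A: "admissible_coeff Om A amin amax" and f: "f \<in> L2 Om" and \<epsilon>: "0 < \<epsilon>"
    and u: "weak_solution A \<epsilon> Om (H1_0 Om) f u" and \<psi>: "weak_solution A \<epsilon> D (H1_Gamma Om D) f \<psi>"
  shows "energy_norm A \<epsilon> \<omega> (\<lambda>x. \<theta> x * (u x - \<psi> x))
    \<le> \<epsilon> * sqrt amax * Linf_norm \<omega> (wgrad Om \<theta>) * L2_norm \<omega> (\<lambda>x. u x - \<psi> x)"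
proof -
  let ?b = "wgrad Om \<theta>"
  obtain a B where W: "weight Om D a ?b B" and wg: "is_weak_grad Om \<theta> ?b"
    and \<theta>a: "AE x in lebesgue_on D. \<theta> x = a x" and bB: "AE x in lebesgue_on Om. norm (?b x) \<le> B" and B: "0 \<le> B"
    by (rule weight_of_W1inf[OF Om D \<omega>(2) \<theta>(1)], erule \<theta>(2), erule \<theta>(3), rule that)
  note wt = weightD[OF W]
  define w where "w = (\<lambda>x. u x - \<psi> x)"
  define gw where "gw = (\<lambda>x. wgrad Om u x - wgrad D \<psi> x)"
  note e = weighted_error_in_L2[OF W u \<psi>, folded w_def gw_def]
  have l: "\<omega> \<in> sets lebesgue" using \<omega>(1) by simp
  have \<omega>O: "\<omega> \<subseteq> Om" using \<omega>(2) D(2) by blast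
  define F where "F = (\<lambda>x. (A x *v (\<theta> x *\<^sub>R gw x + w x *\<^sub>R ?b x)) \<bullet> (\<theta> x *\<^sub>R gw x + w x *\<^sub>R ?b x))"
  have aL: "(\<lambda>x. a x *\<^sub>R gw x + w x *\<^sub>R ?b x) \<in> L2 D"
    by (rule L2_add(1)[OF L2_mult(1)[OF e(4) wt(14,16)] L2_scaleR_bounded[OF e(3) wt(15,8)]])
  have gL: "(\<lambda>x. \<theta> x *\<^sub>R gw x + w x *\<^sub>R ?b x) \<in> L2 D"
    by (rule L2_AE[OF aL _ wt(13)]) (use \<theta>a in eventually_elim, simp)
  have awL: "(\<lambda>x. a x * w x) \<in> L2 D" using L2_mult(1)[OF e(3) wt(14,16)] by simp
  have \<theta>wL: "(\<lambda>x. \<theta> x * w x) \<in> L2 D"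
    by (rule L2_AE[OF awL _ wt(13)]) (use \<theta>a in eventually_elim, simp)
  have iF: "integrable (lebesgue_on D) F" unfolding F_def by (rule coeff_integrable[OF A D(2) gL gL])
  have F0: "0 \<le> F x" if "x \<in> D" for x unfolding F_def using admissible_coeffD(5)[OF A] that D(2) by blast
  have eqF: "(LINT x|lebesgue_on D. F x) = (LINT x|lebesgue_on D. (A x *v (a x *\<^sub>R gw x + w x *\<^sub>R ?b x)) \<bullet> (a x *\<^sub>R gw x + w x *\<^sub>R ?b x))"
    by (rule integral_cong_AE[OF borel_measurable_integrable[OF iF] borel_measurable_integrable[OF coeff_integrable[OF A D(2) aL aL]]])
       (use \<theta>a in eventually_elim, simp add: F_def)
  have eqw: "(L2_norm D (\<lambda>x. \<theta> x * w x))\<^sup>2 = (LINT x|lebesgue_on D. (a x * w x)\<^sup>2)"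
  proof -
    have "AE x in lebesgue_on D. \<theta> x * w x = a x * w x" using \<theta>a by eventually_elim simp
    from L2_norm_AE[OF \<theta>wL this wt(13)] show ?thesis by (simp add: L2_norm_sq)
  qed
  have id: "\<epsilon>\<^sup>2 * (LINT x|lebesgue_on D. F x) + (L2_norm D (\<lambda>x. \<theta> x * w x))\<^sup>2 = \<epsilon>\<^sup>2 * (LINT x|lebesgue_on D. (w x)\<^sup>2 * ((A x *v ?b x) \<bullet> ?b x))"
    unfolding eqF eqw unfolding w_def gw_def by (rule energy_identity[OF W A f u \<psi>])
  \<comment> \<open>Needed almost everywhere on \<open>D - \<omega>\<close>, including the boundary
    of \<open>\<omega>\<close>, which may have positive measure.\<close>
  have b0: "AE x in lebesgue_on D. x \<notin> \<omega> \<longrightarrow> ?b x = 0"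
  proof -
    have "AE x in lebesgue_on Om. \<theta> x = 0 \<longrightarrow> ?b x = 0"
      by (rule weak_grad_zero_set[OF wt(1,2) wg bB, of 1]) (use \<theta>(2) in \<open>auto intro!: AE_I2\<close>)
    moreover have "AE x in lebesgue_on Om. x \<in> Om" by (rule AE_I2) simp
    ultimately have "AE x in lebesgue_on Om. x \<notin> \<omega> \<longrightarrow> ?b x = 0" by eventually_elim (use \<theta>(3) in auto)
    then show ?thesis by (rule AE_leb_on_mono[OF _ wt(4,12,13)])
  qed
  have wbL: "(\<lambda>x. w x *\<^sub>R ?b x) \<in> L2 D" by (rule L2_scaleR_bounded[OF e(3) wt(15,8)])
  have "(\<lambda>x. (A x *v (w x *\<^sub>R ?b x)) \<bullet> (w x *\<^sub>R ?b x)) = (\<lambda>x. (w x)\<^sup>2 * ((A x *v ?b x) \<bullet> ?b x))"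
    by (rule ext) (simp add: matrix_vector_mult_scaleR power2_eq_square mult.assoc)
  then have ir: "integrable (lebesgue_on D) (\<lambda>x. (w x)\<^sup>2 * ((A x *v ?b x) \<bullet> ?b x))"
    using coeff_integrable[OF A D(2) wbL wbL] by simp
  have ir\<omega>: "integrable (lebesgue_on \<omega>) (\<lambda>x. (w x)\<^sup>2 * ((A x *v ?b x) \<bullet> ?b x))"
    by (rule integrable_leb_on_mono[OF ir \<omega>(2) wt(13) l])
  note z = leb_on_zero_ext[OF \<omega>(2) wt(13) l]
  have r: "(LINT x|lebesgue_on D. (w x)\<^sup>2 * ((A x *v ?b x) \<bullet> ?b x)) = (LINT x|lebesgue_on \<omega>. (w x)\<^sup>2 * ((A x *v ?b x) \<bullet> ?b x))"
  proof -
    have "(LINT x|lebesgue_on D. (w x)\<^sup>2 * ((A x *v ?b x) \<bullet> ?b x)) = (LINT x|lebesgue_on D. (if x \<in> \<omega> then (w x)\<^sup>2 * ((A x *v ?b x) \<bullet> ?b x) else 0))"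
    proof (rule integral_cong_AE[OF borel_measurable_integrable[OF ir] borel_measurable_integrable])
      show "integrable (lebesgue_on D) (\<lambda>x. if x \<in> \<omega> then (w x)\<^sup>2 * ((A x *v ?b x) \<bullet> ?b x) else 0)"
        by (subst z(2)) (rule ir\<omega>)
      show "AE x in lebesgue_on D. (w x)\<^sup>2 * ((A x *v ?b x) \<bullet> ?b x) = (if x \<in> \<omega> then (w x)\<^sup>2 * ((A x *v ?b x) \<bullet> ?b x) else 0)"
        using b0 by eventually_elim auto
    qed
    then show ?thesis unfolding z(1) .
  qed
  let ?L = "Linf_norm \<omega> ?b"
  have w\<omega>: "w \<in> L2 \<omega>" by (rule L2_subset(1)[OF e(3) \<omega>(2) wt(13) l])
  have b\<omega>: "?b \<in> borel_measurable (lebesgue_on \<omega>)" "AE x in lebesgue_on \<omega>. norm (?b x) \<le> B"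
    by (rule measurable_leb_on_mono[OF wt(15) \<omega>(2)], rule AE_leb_on_mono[OF wt(8) \<omega>(2) wt(13) l])
  have "AE x in lebesgue_on \<omega>. norm (?b x) \<le> ?L * \<bar>1::real\<bar>" using AE_Linf_norm[OF b\<omega>] by simp
  from coeff_weight_integral_le[OF A \<omega>O l w\<omega> b\<omega> this] w\<omega>
  have r2: "(LINT x|lebesgue_on \<omega>. (w x)\<^sup>2 * ((A x *v ?b x) \<bullet> ?b x)) \<le> amax * ?L\<^sup>2 * (L2_norm \<omega> w)\<^sup>2" by simp
  have wg\<omega>: "is_weak_grad \<omega> (\<lambda>x. \<theta> x * w x) (\<lambda>x. \<theta> x *\<^sub>R gw x + w x *\<^sub>R ?b x)"
  proof (rule is_weak_grad_mult[OF \<omega>(1), where B="max B 1"])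
    show "bounded \<omega>" using wt(11) \<omega>(2) bounded_subset by blast
    show "is_weak_grad \<omega> \<theta> ?b" by (rule is_weak_grad_subset[OF wt(1) \<omega>(1) \<omega>O wg])
    show "is_weak_grad \<omega> w gw" by (rule is_weak_grad_subset[OF wt(3) \<omega>(1,2) e(5)])
    show "AE x in lebesgue_on \<omega>. \<bar>\<theta> x\<bar> \<le> max B 1" by (rule AE_I2) (use \<theta>(2) \<omega>O in \<open>auto simp: subset_iff le_max_iff_disj\<close>)
    show "AE x in lebesgue_on \<omega>. norm (?b x) \<le> max B 1" using b\<omega>(2) by eventually_elim simp
  qed
  have "energy_form A \<epsilon> \<omega> (\<lambda>x. \<theta> x * w x) (\<lambda>x. \<theta> x * w x) = \<epsilon>\<^sup>2 * (LINT x|lebesgue_on \<omega>. F x) + (L2_norm \<omega> (\<lambda>x. \<theta> x * w x))\<^sup>2"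
    unfolding energy_form_eq[OF A \<omega>O \<omega>(1) wg\<omega> wg\<omega>] F_def L2_norm_sq by (simp add: power2_eq_square)
  also have "\<dots> \<le> \<epsilon>\<^sup>2 * (LINT x|lebesgue_on D. F x) + (L2_norm D (\<lambda>x. \<theta> x * w x))\<^sup>2"
  proof (intro add_mono mult_left_mono power_mono)
    have "(LINT x|lebesgue_on \<omega>. F x) = (LINT x|lebesgue_on D. (if x \<in> \<omega> then F x else 0))" by (rule z(1)[symmetric])
    also have "\<dots> \<le> (LINT x|lebesgue_on D. F x)"
      by (rule integral_mono[OF _ iF]) (use z(2)[of F] integrable_leb_on_mono[OF iF \<omega>(2) wt(13) l] F0 in auto)
    finally show "(LINT x|lebesgue_on \<omega>. F x) \<le> (LINT x|lebesgue_on D. F x)" .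
    show "L2_norm \<omega> (\<lambda>x. \<theta> x * w x) \<le> L2_norm D (\<lambda>x. \<theta> x * w x)" by (rule L2_subset(2)[OF \<theta>wL \<omega>(2) wt(13) l])
  qed (auto simp: L2_norm_nonneg)
  also have "\<dots> \<le> \<epsilon>\<^sup>2 * (amax * ?L\<^sup>2 * (L2_norm \<omega> w)\<^sup>2)"
    unfolding id r by (intro mult_left_mono r2) auto
  also have "\<dots> = (\<epsilon> * sqrt amax * ?L * L2_norm \<omega> w)\<^sup>2"
    using admissible_coeffD(2)[OF A] by (simp add: power_mult_distrib)
  finally have "sqrt (energy_form A \<epsilon> \<omega> (\<lambda>x. \<theta> x * w x) (\<lambda>x. \<theta> x * w x)) \<le> sqrt ((\<epsilon> * sqrt amax * ?L * L2_norm \<omega> w)\<^sup>2)"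
    by (rule real_sqrt_le_mono)
  moreover have "0 \<le> \<epsilon> * sqrt amax * ?L * L2_norm \<omega> w"
    using \<epsilon> admissible_coeffD(2)[OF A] by (intro mult_nonneg_nonneg) (auto simp: Linf_norm_def L2_norm_nonneg)
  ultimately show ?thesis unfolding energy_norm_def w_def by simp
qed

text \<open>A single cutoff, used through the exponential weight \<open>exp (\<gamma> \<eta>) - 1\<close>, replaces the usual
  iteration over nested subdomains: the absorption constant is \<open>exp (-1)\<close>.\<close>

lemma exponential_decay:
  fixes A :: "real ^ 'd \<Rightarrow> real ^ 'd ^ 'd" and u \<psi> f :: "real ^ 'd \<Rightarrow> real"
  assumes Om: "lipschitz_domain Om" and D: "lipschitz_domain D" "D \<subseteq> Om" and \<omega>: "open \<omega>" "connected \<omega>" "\<omega> \<subseteq> D"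
    and A: "admissible_coeff Om A amin amax" and f: "f \<in> L2 Om" and \<epsilon>: "0 < \<epsilon>"
    and u: "weak_solution A \<epsilon> Om (H1_0 Om) f u" and \<psi>: "weak_solution A \<epsilon> D (H1_Gamma Om D) f \<psi>"
    and Cd: "cutoff_constant Om Cd"
  defines "\<delta> \<equiv> setdist \<omega> (frontier D - frontier Om)" and "\<gamma> \<equiv> setdist \<omega> (frontier D - frontier Om) / (exp 1 * \<epsilon> * sqrt amax * Cd)"
  assumes pos: "0 < \<delta>" "1 < \<gamma>"
  shows "L2_norm \<omega> (\<lambda>x. u x - \<psi> x) \<le> exp (1 - \<gamma>) * L2_norm D (\<lambda>x. u x - \<psi> x)"
proof -
  note DD = lipschitz_domainD[OF D(1)]
  have am: "0 < amax" by (rule admissible_coeffD(2)[OF A])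
  have Cp: "0 < Cd" using Cd by (simp add: cutoff_constant_def)
  obtain \<eta> g where \<eta>: "continuous_on (closure D) \<eta>" "continuous_on (closure D) g"
    "\<And>x. x \<in> D \<Longrightarrow> (\<eta> has_derivative (\<lambda>h. g x \<bullet> h)) (at x)"
    "\<And>x. x \<in> frontier D - frontier Om \<Longrightarrow> \<eta> x = 0" "\<And>x. x \<in> \<omega> \<Longrightarrow> \<eta> x = (1::real)" "\<And>x. x \<in> D \<Longrightarrow> norm (g x) \<le> Cd / \<delta>"
    using Cd \<omega> DD(1,2) D(2) pos(1) unfolding cutoff_constant_def \<delta>_def by metis
  \<comment> \<open>Subtracting 1 makes the weight vanish with the cutoff, while its gradient stays
    proportional to \<open>W + 1\<close>.\<close>
  define W where "W = (\<lambda>x. exp (\<gamma> * \<eta> x) - 1)"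
  define b where "b = (\<lambda>x. (\<gamma> * exp (\<gamma> * \<eta> x)) *\<^sub>R g x)"
  have Wd: "(W has_derivative (\<lambda>h. b x \<bullet> h)) (at x)" if "x \<in> D" for x
    unfolding W_def b_def by (auto intro!: derivative_eq_intros \<eta>(3)[OF that] simp: fun_eq_iff)
  obtain B where wW: "weight Om D W b B"
    by (rule weight_of_C1[OF Om DD(1) D(2) _ _ Wd]) (use \<eta>(1,2,4) in \<open>auto simp: W_def b_def intro!: continuous_intros intro: that\<close>)
  note wt = weightD[OF wW]
  define w where "w = (\<lambda>x. u x - \<psi> x)"
  define gw where "gw = (\<lambda>x. wgrad Om u x - wgrad D \<psi> x)"
  note e = weighted_error_in_L2[OF wW u \<psi>, folded w_def gw_def]
  have l: "\<omega> \<in> sets lebesgue" using \<omega>(1) by simp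
  have WwL: "(\<lambda>x. W x * w x) \<in> L2 D" using L2_mult(1)[OF e(3) wt(14,16)] by simp
  have kL: "(\<lambda>x. exp (\<gamma> * \<eta> x) * w x) \<in> L2 D" using L2_add(1)[OF WwL e(3)] by (simp add: W_def algebra_simps)
  define X where "X = L2_norm D (\<lambda>x. W x * w x)"
  define Y where "Y = L2_norm D w"
  define Z where "Z = L2_norm \<omega> w"
  have n: "0 \<le> X" "0 \<le> Y" "0 \<le> Z" by (simp_all add: X_def Y_def Z_def L2_norm_nonneg)
  have "AE x in lebesgue_on D. norm (b x) \<le> (\<gamma> * (Cd / \<delta>)) * \<bar>exp (\<gamma> * \<eta> x)\<bar>"
  proof (rule AE_I2)
    fix x assume "x \<in> space (lebesgue_on D)"
    then have "norm (g x) \<le> Cd / \<delta>" using \<eta>(6) by simp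
    then have "(\<gamma> * exp (\<gamma> * \<eta> x)) * norm (g x) \<le> (\<gamma> * exp (\<gamma> * \<eta> x)) * (Cd / \<delta>)" using pos(2) by (intro mult_left_mono) auto
    then show "norm (b x) \<le> (\<gamma> * (Cd / \<delta>)) * \<bar>exp (\<gamma> * \<eta> x)\<bar>" using pos(2) by (simp add: b_def mult_ac)
  qed
  from coeff_weight_integral_le[OF A D(2) wt(13) e(3) wt(15,8) this kL]
  have r: "(LINT x|lebesgue_on D. (w x)\<^sup>2 * ((A x *v b x) \<bullet> b x)) \<le> amax * (\<gamma> * (Cd / \<delta>))\<^sup>2 * (L2_norm D (\<lambda>x. exp (\<gamma> * \<eta> x) * w x))\<^sup>2" .
  have "0 \<le> \<epsilon>\<^sup>2 * (LINT x|lebesgue_on D. (A x *v (W x *\<^sub>R gw x + w x *\<^sub>R b x)) \<bullet> (W x *\<^sub>R gw x + w x *\<^sub>R b x))"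
    by (intro mult_nonneg_nonneg Bochner_Integration.integral_nonneg) (use admissible_coeffD(5)[OF A] D(2) in auto)
  then have "X\<^sup>2 \<le> \<epsilon>\<^sup>2 * (LINT x|lebesgue_on D. (w x)\<^sup>2 * ((A x *v b x) \<bullet> b x))"
    using energy_identity[OF wW A f u \<psi>] unfolding X_def L2_norm_sq w_def gw_def by simp
  also have "\<dots> \<le> \<epsilon>\<^sup>2 * (amax * (\<gamma> * (Cd / \<delta>))\<^sup>2 * (L2_norm D (\<lambda>x. exp (\<gamma> * \<eta> x) * w x))\<^sup>2)"
    by (intro mult_left_mono r) auto
  also have "\<dots> = (\<epsilon> * sqrt amax * (\<gamma> * (Cd / \<delta>)) * L2_norm D (\<lambda>x. exp (\<gamma> * \<eta> x) * w x))\<^sup>2"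
    by (simp only: power_mult_distrib real_sqrt_pow2[OF less_imp_le[OF am]] mult.assoc)
  \<comment> \<open>The definition of \<open>\<gamma>\<close> is made for this cancellation: the
    slope of the cutoff, the diffusion length and the constants leave exactly 1/e.\<close>
  also have "\<epsilon> * sqrt amax * (\<gamma> * (Cd / \<delta>)) = exp (- 1)"
  proof -
    have "\<gamma> = \<delta> / (exp 1 * \<epsilon> * sqrt amax * Cd)" by (simp add: \<gamma>_def \<delta>_def)
    then show ?thesis using \<epsilon> am Cp pos(1) by (simp add: exp_minus field_simps)
  qed
  finally have "X \<le> exp (- 1) * L2_norm D (\<lambda>x. exp (\<gamma> * \<eta> x) * w x)"
    by (rule power2_le_imp_le) (simp add: L2_norm_nonneg)
  \<comment> \<open>The exponential is \<open>W + 1\<close>, so its product with \<open>w\<close>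
    splits into the quantity to be absorbed and the unweighted error.\<close>
  also have "L2_norm D (\<lambda>x. exp (\<gamma> * \<eta> x) * w x) \<le> X + Y"
    using L2_norm_triangle[OF WwL e(3)] unfolding X_def Y_def by (simp add: W_def algebra_simps)
  finally have "X \<le> exp (- 1) * (X + Y)" by simp
  then have "exp 1 * X \<le> exp 1 * (exp (- 1) * (X + Y))" by (intro mult_left_mono) auto
  also have "\<dots> = X + Y" by (simp add: mult.assoc[symmetric] mult_exp_exp)
  finally have XY: "(exp 1 - 1) * X \<le> Y" by (simp add: algebra_simps)
  have "(exp \<gamma> - 1) * Z \<le> X"
  proof -
    have g1: "1 \<le> exp \<gamma>" using pos(2) by simp
    have w\<omega>: "w \<in> L2 \<omega>" by (rule L2_subset(1)[OF e(3) \<omega>(3) wt(13) l])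
    have "L2_norm \<omega> (\<lambda>x. W x * w x) = (exp \<gamma> - 1) * Z"
    proof -
      have "(L2_norm \<omega> (\<lambda>x. W x * w x))\<^sup>2 = (LINT x|lebesgue_on \<omega>. (exp \<gamma> - 1)\<^sup>2 * (norm (w x))\<^sup>2)"
        unfolding L2_norm_sq by (intro Bochner_Integration.integral_cong refl) (simp add: W_def \<eta>(5) power_mult_distrib)
      also have "\<dots> = ((exp \<gamma> - 1) * Z)\<^sup>2" by (simp add: Z_def L2_norm_sq power_mult_distrib)
      finally show ?thesis using power2_eq_iff_nonneg[of "L2_norm \<omega> (\<lambda>x. W x * w x)" "(exp \<gamma> - 1) * Z"] g1 n
        by (simp add: L2_norm_nonneg)
    qed
    then show ?thesis using L2_subset(2)[OF WwL \<omega>(3) wt(13) l] by (simp add: X_def)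
  qed
  then have "(exp 1 - 1) * ((exp \<gamma> - 1) * Z) \<le> (exp 1 - 1) * X" by (intro mult_left_mono) auto
  from order_trans[OF this XY] have Z1: "((exp 1 - 1) * (exp \<gamma> - 1)) * Z \<le> Y" by (simp only: mult.assoc)
  \<comment> \<open>With E = e and H = e^\<gamma>, the difference of the two sides equals (E (E - 1)
    - 1) (H - E) + E^2 (E - 2). It is nonnegative since E is at least 2 and, by \<gamma> > 1, H is
    at least E.\<close>
  have num: "exp \<gamma> \<le> exp 1 * ((exp 1 - 1) * (exp \<gamma> - 1))"
  proof -
    define E where "E = exp (1::real)"
    define H where "H = exp \<gamma>"
    have E: "2 \<le> E" using exp_ge_add_one_self[of "1::real"] by (simp add: E_def)
    have H: "E \<le> H" using pos(2) by (simp add: E_def H_def)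
    have "0 \<le> (E * (E - 1) - 1) * (H - E) + E * E * (E - 2)"
      using E H mult_mono[of 2 E 1 "E - 1"] by (intro add_nonneg_nonneg mult_nonneg_nonneg) auto
    then show ?thesis unfolding E_def[symmetric] H_def[symmetric] by (simp add: algebra_simps)
  qed
  have "exp \<gamma> * Z \<le> (exp 1 * ((exp 1 - 1) * (exp \<gamma> - 1))) * Z" by (rule mult_right_mono[OF num n(3)])
  also have "\<dots> \<le> exp 1 * Y" using Z1 by (simp add: mult.assoc)
  finally have "Z \<le> exp 1 * Y / exp \<gamma>" by (simp add: pos_le_divide_eq mult.commute)
  also have "\<dots> = exp (1 - \<gamma>) * Y" by (simp add: exp_diff)
  finally show ?thesis by (simp add: Z_def Y_def w_def)
qed

theorem theorem3p3:
  fixes \<Omega> :: "(real ^ 'd) set"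
    and A :: "real ^ 'd \<Rightarrow> real ^ 'd ^ 'd"
    and f u \<psi> :: "real ^ 'd \<Rightarrow> real"
    and \<omega> \<omega>s :: "nat \<Rightarrow> (real ^ 'd) set"
    and \<theta> :: "nat \<Rightarrow> real ^ 'd \<Rightarrow> real"
    and \<epsilon> amin amax C Cd :: real
    and M \<kappa> i :: nat
  assumes "CARD('d) = 2 \<or> CARD('d) = 3"
    and "lipschitz_polyhedral_domain \<Omega>"
    and "0 < \<epsilon>" and "\<epsilon> \<le> 1"
    and "f \<in> L2 \<Omega>"
    and "admissible_coeff \<Omega> A amin amax"
    and "open_cover \<Omega> M \<omega> \<kappa>"
    and "partition_of_unity \<Omega> M \<omega> \<theta> C"
    and "\<forall>j\<in>{1..M}. lipschitz_domain (\<omega>s j) \<and> \<omega> j \<subseteq> \<omega>s j \<and> \<omega>s j \<subseteq> \<Omega>"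
    and "cutoff_constant \<Omega> Cd"
    and "weak_solution A \<epsilon> \<Omega> (H1_0 \<Omega>) f u"
    and "i \<in> {1..M}"
    and "weak_solution A \<epsilon> (\<omega>s i) (H1_Gamma \<Omega> (\<omega>s i)) f \<psi>"
  shows "energy_norm A \<epsilon> (\<omega> i) (\<lambda>x. \<theta> i x * (u x - \<psi> x))
           \<le> \<epsilon> * sqrt amax * Linf_norm (\<omega> i) (wgrad \<Omega> (\<theta> i)) * (L2_norm (\<omega> i) u + L2_norm (\<omega>s i) f)
         \<and> (let \<delta> = setdist (\<omega> i) (frontier (\<omega>s i) - frontier \<Omega>);
                \<gamma> = \<delta> / (exp 1 * \<epsilon> * sqrt amax * Cd)
            in 0 < \<delta> \<and> 1 < \<gamma> \<longrightarrow>
               energy_norm A \<epsilon> (\<omega> i) (\<lambda>x. \<theta> i x * (u x - \<psi> x))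
                 \<le> \<epsilon> * sqrt amax * exp (1 - \<gamma>) * Linf_norm (\<omega> i) (wgrad \<Omega> (\<theta> i))
                    * (L2_norm (\<omega>s i) u + L2_norm (\<omega>s i) f))"
proof -
  note \<epsilon> = assms(3) and f = assms(5) and A = assms(6) and u = assms(11) and \<psi> = assms(13)
  have Om: "lipschitz_domain \<Omega>" using assms(2) by (simp add: lipschitz_polyhedral_domain_def)
  have D: "lipschitz_domain (\<omega>s i)" "\<omega> i \<subseteq> \<omega>s i" "\<omega>s i \<subseteq> \<Omega>" using assms(9,12) by auto
  have \<omega>: "open (\<omega> i)" "connected (\<omega> i)" using assms(7,12) by (auto simp: open_cover_def)
  have \<theta>: "\<theta> i \<in> W1inf \<Omega>" "\<And>x. x \<in> \<Omega> \<Longrightarrow> 0 \<le> \<theta> i x \<and> \<theta> i x \<le> 1" "\<And>x. x \<in> \<Omega> - \<omega> i \<Longrightarrow> \<theta> i x = 0"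
    using assms(8,12) by (auto simp: partition_of_unity_def)
  note O = lipschitz_domainD[OF Om] and DD = lipschitz_domainD[OF D(1)]
  have l: "\<Omega> \<in> sets lebesgue" "\<omega>s i \<in> sets lebesgue" "\<omega> i \<in> sets lebesgue" using O(1) DD(1) \<omega>(1) by simp_all
  have uH: "u \<in> H1 \<Omega>" and \<psi>H: "\<psi> \<in> H1 (\<omega>s i)"
    using u \<psi> by (auto simp: weak_solution_def H1_0_def H1_Gamma_def H1_vanishing_def)
  have uD: "u \<in> L2 (\<omega>s i)" by (rule L2_subset(1)[OF H1D(1)[OF uH O(1)] D(3) l(1,2)])
  have \<psi>D: "\<psi> \<in> L2 (\<omega>s i)" by (rule H1D(1)[OF \<psi>H DD(1)])
  have fD: "f \<in> L2 (\<omega>s i)" by (rule L2_subset(1)[OF f D(3) l(1,2)])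
  have \<psi>f: "L2_norm (\<omega>s i) \<psi> \<le> L2_norm (\<omega>s i) f"
    by (rule weak_solution_L2_le[OF A D(3) DD(1) fD \<psi>]) (auto simp: H1_Gamma_def H1_vanishing_def)
  \<comment> \<open>The norm of \<open>u\<close> stays on \<open>S\<close>, whereas that of the
    local solution is enlarged to the oversampling domain, where \<open>f\<close> controls it. The
    two claims use \<open>S = \<omega> i\<close> and \<open>S = \<omega>s i\<close>.\<close>
  have tri: "L2_norm S (\<lambda>x. u x - \<psi> x) \<le> L2_norm S u + L2_norm (\<omega>s i) f" if S: "S \<subseteq> \<omega>s i" "S \<in> sets lebesgue" for S
  proof -
    note uS = L2_subset(1)[OF uD S(1) l(2) S(2)] and \<psi>S = L2_subset[OF \<psi>D S(1) l(2) S(2)]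
    have "L2_norm S (\<lambda>x. u x - \<psi> x) \<le> L2_norm S u + L2_norm S \<psi>"
      using L2_norm_triangle[OF uS L2_scale[OF \<psi>S(1), of "- 1"]] L2_norm_minus[of S \<psi>] by simp
    then show ?thesis using \<psi>S(2) \<psi>f by linarith
  qed
  let ?L = "Linf_norm (\<omega> i) (wgrad \<Omega> (\<theta> i))"
  have K: "0 \<le> \<epsilon> * sqrt amax * ?L"
    using \<epsilon> admissible_coeffD(2)[OF A] by (intro mult_nonneg_nonneg) (auto simp: Linf_norm_def)
  \<comment> \<open>Reduces both claims to the \<open>L2\<close> error on \<open>\<omega> i\<close>,
    bounded directly in one case and by exponential decay in the other.\<close>
  have main: "energy_norm A \<epsilon> (\<omega> i) (\<lambda>x. \<theta> i x * (u x - \<psi> x)) \<le> \<epsilon> * sqrt amax * ?L * L2_norm (\<omega> i) (\<lambda>x. u x - \<psi> x)"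
    by (rule partition_function_estimate[OF Om D(1,3) \<omega>(1) D(2) \<theta> A f \<epsilon> u \<psi>])
  show ?thesis
    unfolding Let_def
  proof (intro conjI impI)
    show "energy_norm A \<epsilon> (\<omega> i) (\<lambda>x. \<theta> i x * (u x - \<psi> x)) \<le> \<epsilon> * sqrt amax * ?L * (L2_norm (\<omega> i) u + L2_norm (\<omega>s i) f)"
      by (rule order_trans[OF main mult_left_mono[OF tri[OF D(2) l(3)] K]])
    let ?\<delta> = "setdist (\<omega> i) (frontier (\<omega>s i) - frontier \<Omega>)"
    let ?\<gamma> = "?\<delta> / (exp 1 * \<epsilon> * sqrt amax * Cd)"
    assume h: "0 < ?\<delta> \<and> 1 < ?\<gamma>"
    have "L2_norm (\<omega> i) (\<lambda>x. u x - \<psi> x) \<le> exp (1 - ?\<gamma>) * L2_norm (\<omega>s i) (\<lambda>x. u x - \<psi> x)"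
      by (rule exponential_decay[OF Om D(1,3) \<omega> D(2) A f \<epsilon> u \<psi> assms(10)]) (use h in auto)
    also have "\<dots> \<le> exp (1 - ?\<gamma>) * (L2_norm (\<omega>s i) u + L2_norm (\<omega>s i) f)"
      by (intro mult_left_mono tri l order_refl) auto
    finally have "\<epsilon> * sqrt amax * ?L * L2_norm (\<omega> i) (\<lambda>x. u x - \<psi> x) \<le> \<epsilon> * sqrt amax * ?L * (exp (1 - ?\<gamma>) * (L2_norm (\<omega>s i) u + L2_norm (\<omega>s i) f))"
      by (rule mult_left_mono[OF _ K])
    from order_trans[OF main this]
    show "energy_norm A \<epsilon> (\<omega> i) (\<lambda>x. \<theta> i x * (u x - \<psi> x))
       \<le> \<epsilon> * sqrt amax * exp (1 - ?\<gamma>) * ?L * (L2_norm (\<omega>s i) u + L2_norm (\<omega>s i) f)"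
      by (simp only: mult_ac)
  qed
qed

end
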